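(* Let $m=2l$ be even, $G_m=G_{2l}$ the dihedral group of order $2m=4l$, and let $\mu_0,\mu_1,\tau_0,\tau_1\in\mathbb{C}$ be parameters $\Upsilon$ such that the four $l\times l$ matrices $M^0,M^1,A^0,A^1$ defined in the context satisfy $\det M^0\ne0$, $\det M^1\neq0$, $\det A^0\neq0$, $\det A^1\ne0$. Then $B_{G_{2l}}(\Upsilon)$ is a semisimple algebra of dimension $4l+4l^2$, and the subset $G_{2l}\amalg\{we_i: w\in G_{2l},\ 0\le i\le 2l-1\}$ is a basis of it.
   Context: Indices of $s,e,\mu,\tau$, etc. are read modulo $m=2l$; $[k]\in\{0,\dots,m-1\}$ is the residue of $k$ mod $m$. $G_m$ acts on $\mathbb{R}^2$; $H_i$ ($0\le i\le m-1$) is the line through the origin at angle $\pi i/m$ to the $x$-axis and $s_i\in G_m$ is the reflection in $H_i$. $G_m$ is generated by $s_0,s_1$. Put $\mu_i=\mu_0$, $\tau_i=\tau_0$ for $i$ even and $\mu_i=\mu_1$, $\tau_i=\tau_1$ for $i$ odd. For $i\ne j$ with $i-j$ even, the reflections $s$ with $ss_js=s_i$ are exactly $s_{k}$ and $s_{k'}$ with $k=(i+j)/2$, $k'=[(i+j)/2+l]$. $B_{G_m}(\Upsilon)$: unital $\mathbb{C}$-algebra generated by $s_0,s_1,e_0,\dots,e_{m-1}$ with relations $s_0^2=s_1^2=(s_0s_1)^m=1$; $s_ie_i=e_is_i=e_i$; $we_iw^{-1}=e_j$ if $w\in G_m$ and $ws_iw^{-1}=s_j$; $e_i^2=\tau_ie_i$;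 $e_ie_j=0$ if $i-j$ is odd; $e_ie_j=(\mu_ks_k+\mu_{k'}s_{k'})e_j$ with $k=(i+j)/2$, $k'=[(i+j)/2+l]$ if $i\neq j$ and $i-j$ is even. In the basis, repeated elements among the $we_i$ (note $ws_ie_i=we_i$) are counted once. Matrices $M^0,M^1$: for $i,j\in\{0,\dots,m-1\}$ with $i-j$ even let $\beta_{i,i}=\tau_i$ and $\beta_{i,j}=\mu_k+\mu_{k'}$ for $i\ne j$ ($k=(i+j)/2$, $k'=[(i+j)/2+l]$). Then $M^0=(\beta_{2(i-1),2(j-1)})_{1\le i,j\le l}$ and $M^1=(\beta_{2i-1,2j-1})_{1\le i,j\le l}$. Matrices $A^0,A^1$: choose for each $i$ a unit vector $a_i\in\mathbb{R}^2$ perpendicular to $H_i$. For indices with $s_i(H_{[j+l]})=H_{[k+l]}$ define $\epsilon^i_{j,k}\in\{\pm1\}$ by $s_i(a_{[j+l]})=\epsilon^i_{j,k}a_{[k+l]}$. For $i-j$ even let $\gamma_{i,i}=\tau_i$ and $\gamma_{i,j}=\mu_k\epsilon^{k}_{j,i}+\mu_{k'}\epsilon^{k'}_{j,i}$ for $i\neq j$ ($k=(i+j)/2$, $k'=[(i+j)/2+l]$). Then $A^0=(\gamma_{2(i-1),2(j-1)})_{1\le i,j\le l}$ and $A^1=(\gamma_{2i-1,2j-1})_{1\le i,j\le l}$. *)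

theory Defs
  imports
    "HOL-Analysis.Analysis"
    "HOL-Algebra.Bij"
    "HOL-Algebra.QuotRing"
    "HOL-Algebra.Embedded_Algebras"
    "HOL-Library.Poly_Mapping"
    "Jordan_Normal_Form.Determinant"
begin

section \<open>Free algebras\<close>

text \<open>Words form a monoid under concatenation; \<^class>\<open>monoid_add\<close> is the class over which
  \<open>Poly_Mapping\<close> defines the convolution product, so that \<open>'x list \<Rightarrow>\<^sub>0 complex\<close> is the free unital
  complex algebra on the type \<open>'x\<close>.\<close>

instantiation list :: (type) monoid_add
begin

definition zero_list :: "'a list" where "zero_list = []"

definition plus_list :: "'a list \<Rightarrow> 'a list \<Rightarrow> 'a list" where "plus_list u v = u @ v"

instance by standard (simp_all add: zero_list_def plus_list_def)

end

definition free_algebra :: "'x set \<Rightarrow> ('x list \<Rightarrow>\<^sub>0 complex) ring" where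
  "free_algebra A =
     \<lparr>carrier = {p. Poly_Mapping.keys p \<subseteq> lists A},
      monoid.mult = (*), one = 1, ring.zero = 0, add = (+)\<rparr>"

definition monomial :: "'x list \<Rightarrow> ('x list \<Rightarrow>\<^sub>0 complex)" where
  "monomial u = Poly_Mapping.single u 1"

definition scalar :: "complex \<Rightarrow> ('x list \<Rightarrow>\<^sub>0 complex)" where
  "scalar c = Poly_Mapping.single [] c"

lemma ring_free_algebra: "ring (free_algebra (A :: 'x set))"
proof -
  let ?C = "{p :: 'x list \<Rightarrow>\<^sub>0 complex. Poly_Mapping.keys p \<subseteq> lists A}"
  have plus: "p + q \<in> ?C" if "p \<in> ?C" "q \<in> ?C" for p q
    using that Poly_Mapping.keys_add[of p q] by blast
  have uminus: "- p \<in> ?C" if "p \<in> ?C" for p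
    using that by simp
  have times: "p * q \<in> ?C" if "p \<in> ?C" "q \<in> ?C" for p q
    using that Poly_Mapping.keys_mult[of p q] by (force simp: plus_list_def)
  have one: "1 \<in> ?C"
    by (simp add: Poly_Mapping.keys_one zero_list_def)
  have inv: "\<exists>y. Poly_Mapping.keys y \<subseteq> lists A \<and> y + x = 0 \<and> x + y = 0"
    if "Poly_Mapping.keys x \<subseteq> lists A" for x :: "'x list \<Rightarrow>\<^sub>0 complex"
    using that uminus by (intro exI[of _ "- x"]) simp
  show ?thesis
    using plus times one inv unfolding free_algebra_def
    by unfold_locales (auto simp: algebra_simps Units_def)
qed

section \<open>Semisimplicity\<close>

definition left_ideal :: "'a set \<Rightarrow> ('a, 'b) ring_scheme \<Rightarrow> bool" where
  "left_ideal I R \<longleftrightarrow>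
     additive_subgroup I R \<and> (\<forall>r \<in> carrier R. \<forall>x \<in> I. r \<otimes>\<^bsub>R\<^esub> x \<in> I)"

definition minimal_left_ideal :: "'a set \<Rightarrow> ('a, 'b) ring_scheme \<Rightarrow> bool" where
  "minimal_left_ideal I R \<longleftrightarrow>
     left_ideal I R \<and> I \<noteq> {\<zero>\<^bsub>R\<^esub>} \<and>
     (\<forall>J. left_ideal J R \<and> J \<subseteq> I \<longrightarrow> J = {\<zero>\<^bsub>R\<^esub>} \<or> J = I)"

text \<open>The left regular module is a direct sum of simple submodules. Finitely many summands are no
  restriction, as \<open>\<one>\<close> lies in the sum of finitely many of them. The left ideals of a unital algebra
  are automatically linear subspaces.\<close>

definition semisimple_ring :: "('a, 'b) ring_scheme \<Rightarrow> bool" where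
  "semisimple_ring R \<longleftrightarrow>
     ring R \<and>
     (\<exists>(n::nat) L. (\<forall>i < n. minimal_left_ideal (L i) R) \<and>
        (\<forall>x \<in> carrier R. \<exists>!f. f \<in> (\<Pi>\<^sub>E i \<in> {..<n}. L i) \<and> x = (\<Oplus>\<^bsub>R\<^esub> i \<in> {..<n}. f i)))"

section \<open>The dihedral group of order \<open>4l\<close>\<close>

text \<open>In all that follows \<open>m = 2 * l\<close>.\<close>

definition mirror_dir :: "nat \<Rightarrow> nat \<Rightarrow> real ^ 2" where
  "mirror_dir l i = vector [cos (pi * real i / real (2 * l)), sin (pi * real i / real (2 * l))]"

definition mirror :: "nat \<Rightarrow> nat \<Rightarrow> (real ^ 2) set" where
  "mirror l i = span {mirror_dir l i}"

definition reflection :: "nat \<Rightarrow> nat \<Rightarrow> real ^ 2 \<Rightarrow> real ^ 2" where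
  "reflection l i x = (2 * inner x (mirror_dir l i)) *\<^sub>R mirror_dir l i - x"

abbreviation plane_group :: "(real ^ 2 \<Rightarrow> real ^ 2) monoid" where
  "plane_group \<equiv> BijGroup UNIV"

definition dihedral :: "nat \<Rightarrow> (real ^ 2 \<Rightarrow> real ^ 2) set" where
  "dihedral l = generate plane_group {reflection l 0, reflection l 1}"

section \<open>The algebra\<close>

datatype gen = SG nat | EG nat

definition gens :: "nat \<Rightarrow> gen set" where
  "gens l = {SG 0, SG 1} \<union> EG ` {..<2 * l}"

text \<open>An element of the dihedral group enters the relations through some word in \<open>s\<^sub>0, s\<^sub>1\<close> that
  represents it. The choice of the word does not matter: \<open>s\<^sub>0\<^sup>2 = s\<^sub>1\<^sup>2 = (s\<^sub>0s\<^sub>1)\<^sup>m = 1\<close> is a presentation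
  of the dihedral group, so that any two such words agree modulo these relations.\<close>

definition eval_word :: "nat \<Rightarrow> nat list \<Rightarrow> real ^ 2 \<Rightarrow> real ^ 2" where
  "eval_word l u = foldr (\<lambda>i f. reflection l i \<circ> f) u id"

definition grp :: "nat \<Rightarrow> (real ^ 2 \<Rightarrow> real ^ 2) \<Rightarrow> (gen list \<Rightarrow>\<^sub>0 complex)" where
  "grp l w = monomial (map SG (SOME u. u \<in> lists {0, 1} \<and> eval_word l u = w))"

definition by_parity :: "complex \<Rightarrow> complex \<Rightarrow> nat \<Rightarrow> complex" where
  "by_parity x0 x1 i = (if even i then x0 else x1)"

text \<open>The indices \<open>k\<close> and \<open>k'\<close> of the two reflections exchanging \<open>s\<^sub>i\<close> and \<open>s\<^sub>j\<close>, for \<open>i, j < 2 * l\<close>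
  distinct and of equal parity.\<close>

definition mid :: "nat \<Rightarrow> nat \<Rightarrow> nat" where
  "mid i j = (i + j) div 2"

definition mid' :: "nat \<Rightarrow> nat \<Rightarrow> nat \<Rightarrow> nat" where
  "mid' l i j = (mid i j + l) mod (2 * l)"

text \<open>A relation \<open>p = q\<close> is represented by \<open>p - q\<close>.\<close>

definition relations ::
  "nat \<Rightarrow> complex \<Rightarrow> complex \<Rightarrow> complex \<Rightarrow> complex \<Rightarrow> (gen list \<Rightarrow>\<^sub>0 complex) set" where
  "relations l \<mu>0 \<mu>1 \<tau>0 \<tau>1 =
    (let m = 2 * l;
         s0 = monomial [SG 0];
         s1 = monomial [SG 1];
         e = (\<lambda>i. monomial [EG i]);
         s = (\<lambda>i. grp l (reflection l i));
         \<mu> = (\<lambda>i. scalar (by_parity \<mu>0 \<mu>1 i));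
         \<tau> = (\<lambda>i. scalar (by_parity \<tau>0 \<tau>1 i))
     in {s0 * s0 - 1, s1 * s1 - 1, (s0 * s1) ^ m - 1}
      \<union> {s i * e i - e i | i. i < m}
      \<union> {e i * s i - e i | i. i < m}
      \<union> {grp l w * e i * grp l (inv\<^bsub>plane_group\<^esub> w) - e j | w i j.
           w \<in> dihedral l \<and> i < m \<and> j < m \<and>
           w \<otimes>\<^bsub>plane_group\<^esub> reflection l i \<otimes>\<^bsub>plane_group\<^esub> inv\<^bsub>plane_group\<^esub> w = reflection l j}
      \<union> {e i * e i - \<tau> i * e i | i. i < m}
      \<union> {e i * e j | i j. i < m \<and> j < m \<and> odd (i + j)}
      \<union> {e i * e j - (\<mu> (mid i j) * s (mid i j) + \<mu> (mid' l i j) * s (mid' l i j)) * e j | i j.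
           i < m \<and> j < m \<and> i \<noteq> j \<and> even (i + j)})"

definition rel_ideal ::
  "nat \<Rightarrow> complex \<Rightarrow> complex \<Rightarrow> complex \<Rightarrow> complex \<Rightarrow> (gen list \<Rightarrow>\<^sub>0 complex) set" where
  "rel_ideal l \<mu>0 \<mu>1 \<tau>0 \<tau>1 = genideal (free_algebra (gens l)) (relations l \<mu>0 \<mu>1 \<tau>0 \<tau>1)"

definition brauer_algebra ::
  "nat \<Rightarrow> complex \<Rightarrow> complex \<Rightarrow> complex \<Rightarrow> complex \<Rightarrow> (gen list \<Rightarrow>\<^sub>0 complex) set ring" where
  "brauer_algebra l \<mu>0 \<mu>1 \<tau>0 \<tau>1 = free_algebra (gens l) Quot rel_ideal l \<mu>0 \<mu>1 \<tau>0 \<tau>1"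

definition residue_class :: "nat \<Rightarrow> complex \<Rightarrow> complex \<Rightarrow> complex \<Rightarrow> complex \<Rightarrow>
    (gen list \<Rightarrow>\<^sub>0 complex) \<Rightarrow> (gen list \<Rightarrow>\<^sub>0 complex) set" where
  "residue_class l \<mu>0 \<mu>1 \<tau>0 \<tau>1 p = rel_ideal l \<mu>0 \<mu>1 \<tau>0 \<tau>1 +>\<^bsub>free_algebra (gens l)\<^esub> p"

text \<open>The copy of the complex numbers in the algebra, over which dimension and linear independence
  are taken.\<close>

definition scalars ::
  "nat \<Rightarrow> complex \<Rightarrow> complex \<Rightarrow> complex \<Rightarrow> complex \<Rightarrow> (gen list \<Rightarrow>\<^sub>0 complex) set set" where
  "scalars l \<mu>0 \<mu>1 \<tau>0 \<tau>1 = (\<lambda>c. residue_class l \<mu>0 \<mu>1 \<tau>0 \<tau>1 (scalar c)) ` UNIV"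

definition group_elem :: "nat \<Rightarrow> complex \<Rightarrow> complex \<Rightarrow> complex \<Rightarrow> complex \<Rightarrow>
    (real ^ 2 \<Rightarrow> real ^ 2) \<Rightarrow> (gen list \<Rightarrow>\<^sub>0 complex) set" where
  "group_elem l \<mu>0 \<mu>1 \<tau>0 \<tau>1 w = residue_class l \<mu>0 \<mu>1 \<tau>0 \<tau>1 (grp l w)"

definition e_elem :: "nat \<Rightarrow> complex \<Rightarrow> complex \<Rightarrow> complex \<Rightarrow> complex \<Rightarrow>
    nat \<Rightarrow> (gen list \<Rightarrow>\<^sub>0 complex) set" where
  "e_elem l \<mu>0 \<mu>1 \<tau>0 \<tau>1 i = residue_class l \<mu>0 \<mu>1 \<tau>0 \<tau>1 (monomial [EG i])"

text \<open>Linear independence in \<open>Embedded_Algebras\<close> is a property of lists and forces the entries to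
  be distinct.\<close>

definition basis_over :: "'a set \<Rightarrow> ('a, 'b) ring_scheme \<Rightarrow> 'a set \<Rightarrow> bool" where
  "basis_over K R B \<longleftrightarrow>
     (\<exists>us. set us = B \<and> ring.independent R K us \<and> ring.Span R K us = carrier R)"

section \<open>The four matrices\<close>

definition beta ::
  "nat \<Rightarrow> complex \<Rightarrow> complex \<Rightarrow> complex \<Rightarrow> complex \<Rightarrow> nat \<Rightarrow> nat \<Rightarrow> complex" where
  "beta l \<mu>0 \<mu>1 \<tau>0 \<tau>1 i j =
     (if i = j then by_parity \<tau>0 \<tau>1 i
      else by_parity \<mu>0 \<mu>1 (mid i j) + by_parity \<mu>0 \<mu>1 (mid' l i j))"

text \<open>For parity \<open>p \<in> {0, 1}\<close>. Matrix indices start at \<open>0\<close> here, so the entries \<open>\<beta>\<close> at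
  \<open>(2(i-1), 2(j-1))\<close> and \<open>(2i-1, 2j-1)\<close> with \<open>1 \<le> i, j \<le> l\<close> become those at
  \<open>(2i, 2j)\<close> and \<open>(2i+1, 2j+1)\<close> with \<open>0 \<le> i, j < l\<close>.\<close>

definition M_mat ::
  "nat \<Rightarrow> complex \<Rightarrow> complex \<Rightarrow> complex \<Rightarrow> complex \<Rightarrow> nat \<Rightarrow> complex mat" where
  "M_mat l \<mu>0 \<mu>1 \<tau>0 \<tau>1 p =
     Matrix.mat l l (\<lambda>(i, j). beta l \<mu>0 \<mu>1 \<tau>0 \<tau>1 (2 * i + p) (2 * j + p))"

definition normal_vectors :: "nat \<Rightarrow> (nat \<Rightarrow> real ^ 2) \<Rightarrow> bool" where
  "normal_vectors l a \<longleftrightarrow>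
     (\<forall>i < 2 * l. norm (a i) = 1 \<and> (\<forall>x \<in> mirror l i. inner (a i) x = 0))"

text \<open>Only meaningful if \<open>s\<^sub>i\<close> maps the mirror with index \<open>[j + l]\<close> to the one with index
  \<open>[k + l]\<close>.\<close>

definition eps :: "nat \<Rightarrow> (nat \<Rightarrow> real ^ 2) \<Rightarrow> nat \<Rightarrow> nat \<Rightarrow> nat \<Rightarrow> real" where
  "eps l a i j k =
     (THE x. x \<in> {1, -1} \<and> reflection l i (a ((j + l) mod (2 * l))) = x *\<^sub>R a ((k + l) mod (2 * l)))"

definition gamma :: "nat \<Rightarrow> complex \<Rightarrow> complex \<Rightarrow> complex \<Rightarrow> complex \<Rightarrow> (nat \<Rightarrow> real ^ 2) \<Rightarrow>
    nat \<Rightarrow> nat \<Rightarrow> complex" where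
  "gamma l \<mu>0 \<mu>1 \<tau>0 \<tau>1 a i j =
     (if i = j then by_parity \<tau>0 \<tau>1 i
      else by_parity \<mu>0 \<mu>1 (mid i j) * of_real (eps l a (mid i j) j i)
         + by_parity \<mu>0 \<mu>1 (mid' l i j) * of_real (eps l a (mid' l i j) j i))"

definition A_mat :: "nat \<Rightarrow> complex \<Rightarrow> complex \<Rightarrow> complex \<Rightarrow> complex \<Rightarrow> (nat \<Rightarrow> real ^ 2) \<Rightarrow>
    nat \<Rightarrow> complex mat" where
  "A_mat l \<mu>0 \<mu>1 \<tau>0 \<tau>1 a p =
     Matrix.mat l l (\<lambda>(i, j). gamma l \<mu>0 \<mu>1 \<tau>0 \<tau>1 a (2 * i + p) (2 * j + p))"

end

theory Submission
  imports Defs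
begin

text \<open>The regular module is written down explicitly, on a vector space with the expected basis, by
  rewriting \<open>s\<^sub>a r\<^sup>k e\<^sub>j\<close> and \<open>e\<^sub>i r\<^sup>k e\<^sub>j\<close> in terms of the elements \<open>r\<^sup>k e\<^sub>j\<close>, where \<open>r = s\<^sub>1 s\<^sub>0\<close>.
  Acting on the vector of \<open>1\<close> separates the residue classes of the basis words, and the relations
  reduce every word to a combination of them, so the quotient algebra is this module.

  Semisimplicity then means that the module is generated by simple submodules. The left ideal of
  \<open>e\<^sub>j\<close> splits into the two eigenspaces of the central rotation \<open>r\<^sup>l\<close>, on which the \<open>e\<^sub>i\<close> act through
  \<open>M\<^sup>p\<close> and, up to signs, \<open>A\<^sup>p\<close>. Invertibility makes both eigenspaces simple, and the inverse matrices
  provide an \<open>f\<close> in the span of the \<open>w e\<^sub>j\<close> with \<open>e\<^sub>i f = e\<^sub>i\<close> for all \<open>i\<close>. All \<open>e\<^sub>i\<close> kill \<open>1 - f\<close>, so it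
  generates a module of the dihedral group, which the eigenvectors of \<open>r\<close> decompose.\<close>

section \<open>Sums of minimal left ideals\<close>

text \<open>The hard half of the basis statement is that the relations do not collapse the algebra.
  A concrete vector space of the right dimension, on which every relation can be checked, settles
  this at the price of index arithmetic. A half such as (i + j) / 2 is determined by residues modulo
  m = 2 l only modulo l. This is why the reflections with indices k and k' = k + l occur together:
  changing a representative exchanges the two summands.

  The four matrices come from the same pair. The elements s_k e_j and s_{k'} e_j differ by the
  rotation r^l, which commutes with everything. So e_i e_j equals (\<mu>_k + \<zeta> \<mu>_{k'}) s_k
  e_j wherever r^l acts by \<zeta>. The value \<zeta> = 1 gives the entries of M. The value \<zeta>
  = -1 gives those of A, because s_k and s_{k'} send a normal vector to opposite vectors.

  Semisimplicity is reduced to one membership: every submodule that contains a certain finite family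
  of simple ones contains the vector of 1. No complements or dimensions of submodules are
  computed.\<close>

context ring
begin

lemma left_ideal_closed:
  assumes "left_ideal I R"
  shows "\<zero> \<in> I" "x \<in> I \<Longrightarrow> y \<in> I \<Longrightarrow> x \<oplus> y \<in> I" "x \<in> I \<Longrightarrow> y \<in> I \<Longrightarrow> x \<ominus> y \<in> I"
    "r \<in> carrier R \<Longrightarrow> x \<in> I \<Longrightarrow> r \<otimes> x \<in> I" "I \<subseteq> carrier R"
proof -
  interpret additive_subgroup I R
    using assms by (simp add: left_ideal_def)
  show "\<zero> \<in> I" "x \<in> I \<Longrightarrow> y \<in> I \<Longrightarrow> x \<oplus> y \<in> I" "I \<subseteq> carrier R"
    using a_subset by auto
  show "x \<in> I \<Longrightarrow> y \<in> I \<Longrightarrow> x \<ominus> y \<in> I"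
    unfolding a_minus_def by (intro a_closed a_inv_closed)
  show "r \<in> carrier R \<Longrightarrow> x \<in> I \<Longrightarrow> r \<otimes> x \<in> I"
    using assms by (simp add: left_ideal_def)
qed

text \<open>In a ring with one, closure under negatives comes for free, as
  \<open>\<ominus> x = (\<ominus> \<one>) \<otimes> x\<close>.\<close>

lemma left_idealI:
  assumes "I \<subseteq> carrier R" "\<zero> \<in> I" "\<And>x y. x \<in> I \<Longrightarrow> y \<in> I \<Longrightarrow> x \<oplus> y \<in> I"
    and smult: "\<And>r x. r \<in> carrier R \<Longrightarrow> x \<in> I \<Longrightarrow> r \<otimes> x \<in> I"
  shows "left_ideal I R"
  unfolding left_ideal_def
proof
  have "\<ominus> x \<in> I" if "x \<in> I" for x
  proof -
    have "(\<ominus> \<one>) \<otimes> x = \<ominus> x"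
      using that assms(1) by (simp add: l_minus subsetD)
    then show ?thesis
      using smult[of "\<ominus> \<one>" x] that by simp
  qed
  then show "additive_subgroup I R"
    using assms by (intro additive_subgroup.intro subgroup.intro) (auto simp flip: a_inv_def)
qed (use smult in blast)

lemma left_ideal_Int: "left_ideal I R \<Longrightarrow> left_ideal J R \<Longrightarrow> left_ideal (I \<inter> J) R"
  using left_ideal_closed[of I] left_ideal_closed[of J]
  by (intro left_idealI) auto

lemma left_ideal_set_add:
  assumes "left_ideal I R" "left_ideal J R" shows "left_ideal (I <+>\<^bsub>R\<^esub> J) R"
proof (rule left_idealI)
  note I = left_ideal_closed[OF assms(1)] and J = left_ideal_closed[OF assms(2)]
  show "I <+>\<^bsub>R\<^esub> J \<subseteq> carrier R"
    using I(5) J(5) by (auto simp: set_add_def')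
  show "\<zero> \<in> I <+>\<^bsub>R\<^esub> J"
    using I(1) J(1) by (auto simp: set_add_def' intro!: bexI[of _ \<zero>])
  show "x \<oplus> y \<in> I <+>\<^bsub>R\<^esub> J" if xy: "x \<in> I <+>\<^bsub>R\<^esub> J" "y \<in> I <+>\<^bsub>R\<^esub> J" for x y
  proof -
    obtain a b c d where abcd: "a \<in> I" "b \<in> J" "x = a \<oplus> b" "c \<in> I" "d \<in> J" "y = c \<oplus> d"
      using xy by (auto simp: set_add_def')
    then have "x \<oplus> y = (a \<oplus> c) \<oplus> (b \<oplus> d)"
      using I(5) J(5) by (simp add: subsetD a_ac)
    moreover have "a \<oplus> c \<in> I" "b \<oplus> d \<in> J"
      using abcd I(2) J(2) by auto
    ultimately show ?thesis
      unfolding set_add_def' by blast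
  qed
  show "r \<otimes> x \<in> I <+>\<^bsub>R\<^esub> J" if r: "r \<in> carrier R" and x: "x \<in> I <+>\<^bsub>R\<^esub> J" for r x
  proof -
    obtain a b where ab: "a \<in> I" "b \<in> J" "x = a \<oplus> b"
      using x by (auto simp: set_add_def')
    then have "r \<otimes> x = r \<otimes> a \<oplus> r \<otimes> b"
      using r I(5) J(5) by (simp add: subsetD r_distr)
    moreover have "r \<otimes> a \<in> I" "r \<otimes> b \<in> J"
      using ab r I(4) J(4) by auto
    ultimately show ?thesis
      unfolding set_add_def' by blast
  qed
qed

lemma finsum_left_ideal:
  assumes "left_ideal I R" "finite A" "f \<in> A \<rightarrow> I" shows "finsum R f A \<in> I"
  using assms(2,3) left_ideal_closed[OF assms(1)]
proof (induction A rule: finite_induct)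
  case (insert a A)
  then have "finsum R f (insert a A) = f a \<oplus> finsum R f A"
    by (intro finsum_insert) auto
  then show ?case
    using insert by auto
qed simp

text \<open>Two decompositions of \<open>x\<close> differ in coordinate \<open>n\<close> by an
  element of \<open>M \<inter> S\<close>, hence agree there, and uniqueness in \<open>S\<close>
  settles the rest. \<open>restrict\<close> removes coordinate \<open>n\<close>, because members of
  the smaller product are \<open>undefined\<close> outside \<open>{..<n}\<close>.\<close>

lemma direct_sum_extend:
  fixes L :: "nat \<Rightarrow> 'a set"
  assumes S: "left_ideal S R" and M: "left_ideal M R" and MS: "M \<inter> S = {\<zero>}"
    and LS: "\<And>i. i < n \<Longrightarrow> L i \<subseteq> S"
    and ex1: "\<And>x. x \<in> S \<Longrightarrow> \<exists>!f. f \<in> (\<Pi>\<^sub>E i\<in>{..<n}. L i) \<and> x = finsum R f {..<n}"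
    and x: "x \<in> M <+>\<^bsub>R\<^esub> S"
  shows "\<exists>!f. f \<in> (\<Pi>\<^sub>E i\<in>{..<Suc n}. (L(n := M)) i) \<and> x = finsum R f {..<Suc n}"
proof -
  note Mc = left_ideal_closed[OF M] and Sc = left_ideal_closed[OF S]
  let ?L = "L(n := M)"
  have sum_S: "finsum R f {..<n} \<in> S" if "f \<in> (\<Pi>\<^sub>E i\<in>{..<n}. L i)" for f
  proof (intro finsum_left_ideal[OF S] Pi_I)
    fix i assume "i \<in> {..<n}"
    then show "f i \<in> S"
      using PiE_mem[OF that, of i] LS[of i] by auto
  qed simp
  have restr: "restrict f {..<n} \<in> (\<Pi>\<^sub>E i\<in>{..<n}. L i)" if "f \<in> (\<Pi>\<^sub>E i\<in>{..<Suc n}. ?L i)" for f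
  proof -
    have "f i \<in> L i" if "i < n" for i
      using PiE_mem[OF \<open>f \<in> _\<close>, of i] that by simp
    then show ?thesis by auto
  qed
  have split: "finsum R f {..<Suc n} = f n \<oplus> finsum R (restrict f {..<n}) {..<n}"
    if f: "f \<in> (\<Pi>\<^sub>E i\<in>{..<Suc n}. ?L i)" for f
  proof -
    have fc: "f i \<in> carrier R" if "i < Suc n" for i
      using PiE_mem[OF f, of i] that LS[of i] Sc(5) Mc(5) by (cases "i = n") auto
    have "finsum R f {..<Suc n} = f n \<oplus> finsum R f {..<n}"
      unfolding lessThan_Suc using fc by (intro finsum_insert) auto
    also have "finsum R f {..<n} = finsum R (restrict f {..<n}) {..<n}"
      using fc by (intro finsum_cong') auto
    finally show ?thesis .
  qed
  have fn: "f n \<in> M" if "f \<in> (\<Pi>\<^sub>E i\<in>{..<Suc n}. ?L i)" for f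
    using PiE_mem[OF that, of n] by simp
  obtain a s where as: "a \<in> M" "s \<in> S" "x = a \<oplus> s"
    using x by (auto simp: set_add_def')
  obtain g where g: "g \<in> (\<Pi>\<^sub>E i\<in>{..<n}. L i)" "s = finsum R g {..<n}"
    using ex1[OF as(2)] by blast
  show ?thesis
  proof (rule ex_ex1I)
    let ?f = "g(n := a)"
    have f: "?f \<in> (\<Pi>\<^sub>E i\<in>{..<Suc n}. ?L i)"
      using g(1) as(1) by (auto simp: PiE_iff extensional_def)
    moreover have "restrict ?f {..<n} = g"
      using g(1) by (auto simp: PiE_iff extensional_def)
    ultimately show "\<exists>f. f \<in> (\<Pi>\<^sub>E i\<in>{..<Suc n}. ?L i) \<and> x = finsum R f {..<Suc n}"
      using split[OF f] as g by (intro exI[of _ ?f]) simp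
  next
    fix f h
    assume "f \<in> (\<Pi>\<^sub>E i\<in>{..<Suc n}. ?L i) \<and> x = finsum R f {..<Suc n}"
      and "h \<in> (\<Pi>\<^sub>E i\<in>{..<Suc n}. ?L i) \<and> x = finsum R h {..<Suc n}"
    then have f: "f \<in> (\<Pi>\<^sub>E i\<in>{..<Suc n}. ?L i)" and h: "h \<in> (\<Pi>\<^sub>E i\<in>{..<Suc n}. ?L i)"
      and eq: "finsum R f {..<Suc n} = finsum R h {..<Suc n}" by auto
    define sf where "sf = finsum R (restrict f {..<n}) {..<n}"
    define sh where "sh = finsum R (restrict h {..<n}) {..<n}"
    have s: "sf \<in> S" "sh \<in> S"
      unfolding sf_def sh_def using sum_S restr f h by auto
    have c: "f n \<in> carrier R" "h n \<in> carrier R" "sf \<in> carrier R" "sh \<in> carrier R"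
      using s fn[OF f] fn[OF h] Mc(5) Sc(5) by auto
    have e: "f n \<oplus> sf = h n \<oplus> sh"
      using eq unfolding split[OF f] split[OF h] sf_def sh_def .
    have "f n \<ominus> h n = sh \<ominus> sf"
    proof -
      have "f n \<ominus> h n = (f n \<oplus> sf) \<ominus> (h n \<oplus> sf)"
        using c by algebra
      also have "\<dots> = (h n \<oplus> sh) \<ominus> (h n \<oplus> sf)"
        by (simp only: e)
      also have "\<dots> = sh \<ominus> sf"
        using c by algebra
      finally show ?thesis .
    qed
    then have "f n \<ominus> h n \<in> M \<inter> S"
      using Mc(3)[OF fn[OF f] fn[OF h]] Sc(3)[OF s(2) s(1)] by simp
    then have fh: "f n = h n"
      using MS c r_right_minus_eq by auto
    then have "sf = sh"
      using e c by simp
    then have "restrict f {..<n} = restrict h {..<n}"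
      using ex1[OF s(1)] restr[OF f] restr[OF h] unfolding sf_def sh_def by blast
    then have "f i = h i" if "i < n" for i
      using that by (metis lessThan_iff restrict_apply')
    then show "f = h"
      using fh f h by (intro PiE_ext[OF f h]) (auto simp: less_Suc_eq)
  qed
qed

text \<open>Greedy selection: a minimal left ideal \<open>M\<close> that is not contained in the
  current sum \<open>S\<close> meets it in zero, since \<open>M \<inter> S\<close> is a left ideal
  properly inside \<open>M\<close>. Then \<open>M\<close> is appended as a further direct summand. A
  member already inside \<open>S\<close> is skipped, so the family itself may be dependent.\<close>

lemma sum_minimal_left_ideals_direct:
  assumes "finite \<L>" "\<And>L. L \<in> \<L> \<Longrightarrow> minimal_left_ideal L R"
  shows "\<exists>(n::nat) L S. (\<forall>i<n. minimal_left_ideal (L i) R \<and> L i \<subseteq> S) \<and> left_ideal S R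
    \<and> \<Union>\<L> \<subseteq> S \<and> (\<forall>x\<in>S. \<exists>!f. f \<in> (\<Pi>\<^sub>E i\<in>{..<n}. L i) \<and> x = finsum R f {..<n})"
  using assms
proof (induction \<L> rule: finite_induct)
  case empty
  have "left_ideal {\<zero>} R"
    by (rule left_idealI) auto
  then show ?case
    by (intro exI[of _ 0] exI[of _ "\<lambda>_. {}"] exI[of _ "{\<zero>}"]) auto
next
  case (insert M \<L>)
  have "\<exists>(n::nat) L S. (\<forall>i<n. minimal_left_ideal (L i) R \<and> L i \<subseteq> S) \<and> left_ideal S R
    \<and> \<Union>\<L> \<subseteq> S \<and> (\<forall>x\<in>S. \<exists>!f. f \<in> (\<Pi>\<^sub>E i\<in>{..<n}. L i) \<and> x = finsum R f {..<n})"
    using insert.prems by (intro insert.IH) auto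
  then obtain n :: nat and L S where IH: "\<And>i. i < n \<Longrightarrow> minimal_left_ideal (L i) R"
    "\<And>i. i < n \<Longrightarrow> L i \<subseteq> S" "left_ideal S R" "\<Union>\<L> \<subseteq> S"
    "\<And>x. x \<in> S \<Longrightarrow> \<exists>!f. f \<in> (\<Pi>\<^sub>E i\<in>{..<n}. L i) \<and> x = finsum R f {..<n}"
    by (elim exE conjE) metis
  have Mm: "minimal_left_ideal M R" and M: "left_ideal M R"
    using insert.prems[of M] by (simp_all add: minimal_left_ideal_def)
  show ?case
  proof (cases "M \<subseteq> S")
    case True
    then show ?thesis
      using IH by (intro exI[of _ n] exI[of _ L] exI[of _ S]) auto
  next
    case False
    then have MS: "M \<inter> S = {\<zero>}"
      using Mm left_ideal_Int[OF M IH(3)] unfolding minimal_left_ideal_def by blast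
    note Mc = left_ideal_closed[OF M] and Sc = left_ideal_closed[OF IH(3)]
    have M_sub: "M \<subseteq> M <+>\<^bsub>R\<^esub> S"
    proof
      fix x assume x: "x \<in> M"
      then have "x = x \<oplus> \<zero>"
        using Mc(5) by auto
      then show "x \<in> M <+>\<^bsub>R\<^esub> S"
        using x Sc(1) unfolding set_add_def' by blast
    qed
    have S_sub: "S \<subseteq> M <+>\<^bsub>R\<^esub> S"
    proof
      fix x assume x: "x \<in> S"
      then have "x = \<zero> \<oplus> x"
        using Sc(5) by auto
      then show "x \<in> M <+>\<^bsub>R\<^esub> S"
        using x Mc(1) unfolding set_add_def' by blast
    qed
    have "\<forall>x\<in>M <+>\<^bsub>R\<^esub> S. \<exists>!f. f \<in> (\<Pi>\<^sub>E i\<in>{..<Suc n}. (L(n := M)) i) \<and> x = finsum R f {..<Suc n}"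
      by (intro ballI direct_sum_extend[OF IH(3) M MS IH(2) IH(5)])
    moreover have "minimal_left_ideal ((L(n := M)) i) R \<and> (L(n := M)) i \<subseteq> M <+>\<^bsub>R\<^esub> S" if "i < Suc n" for i
    proof (cases "i = n")
      case True
      then show ?thesis using Mm M_sub by simp
    next
      case False
      then have "i < n" using that by simp
      then show ?thesis using IH(1)[of i] IH(2)[of i] S_sub False by auto
    qed
    moreover have "\<Union>(insert M \<L>) \<subseteq> M <+>\<^bsub>R\<^esub> S"
      using IH(4) M_sub S_sub by auto
    ultimately show ?thesis
      using left_ideal_set_add[OF M IH(3)]
      by (intro exI[of _ "Suc n"] exI[of _ "L(n := M)"] exI[of _ "M <+>\<^bsub>R\<^esub> S"]) (intro conjI allI impI; assumption?; blast)
  qed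
qed

text \<open>\<open>gen\<close> is applied to the sum of the selected ideals: once this contains
  \<one>, it is everything. Phrasing \<open>gen\<close> for all left ideals above the family keeps
  that sum out of the applications.\<close>

lemma semisimple_ringI:
  assumes "finite \<L>" "\<And>L. L \<in> \<L> \<Longrightarrow> minimal_left_ideal L R"
    and gen: "\<And>J. left_ideal J R \<Longrightarrow> \<Union>\<L> \<subseteq> J \<Longrightarrow> \<one> \<in> J"
  shows "semisimple_ring R"
proof -
  have "\<exists>(n::nat) L S. (\<forall>i<n. minimal_left_ideal (L i) R \<and> L i \<subseteq> S) \<and> left_ideal S R
    \<and> \<Union>\<L> \<subseteq> S \<and> (\<forall>x\<in>S. \<exists>!f. f \<in> (\<Pi>\<^sub>E i\<in>{..<n}. L i) \<and> x = finsum R f {..<n})"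
    by (rule sum_minimal_left_ideals_direct[OF assms(1,2)])
  then obtain n :: nat and L S where *: "(\<forall>i<n. minimal_left_ideal (L i) R \<and> L i \<subseteq> S) \<and> left_ideal S R
    \<and> \<Union>\<L> \<subseteq> S \<and> (\<forall>x\<in>S. \<exists>!f. f \<in> (\<Pi>\<^sub>E i\<in>{..<n}. L i) \<and> x = finsum R f {..<n})"
    by (elim exE)
  then have S: "left_ideal S R" "\<Union>\<L> \<subseteq> S" by auto
  have "x \<in> S" if "x \<in> carrier R" for x
    using left_ideal_closed(4)[OF S(1) that gen[OF S]] that by simp
  then show ?thesis
    unfolding semisimple_ring_def using * ring_axioms
    by (intro conjI exI[of _ n] exI[of _ L]) auto
qed

end

section \<open>Linear extension on free vector spaces\<close>

definition pscale :: "complex \<Rightarrow> ('a \<Rightarrow>\<^sub>0 complex) \<Rightarrow> ('a \<Rightarrow>\<^sub>0 complex)" where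
  "pscale c p = Poly_Mapping.map ((*) c) p"

lemma lookup_pscale [simp]: "Poly_Mapping.lookup (pscale c p) x = c * Poly_Mapping.lookup p x"
  unfolding pscale_def by (simp add: Poly_Mapping.map.rep_eq when_def)

interpretation pm: vector_space "pscale :: complex \<Rightarrow> ('a \<Rightarrow>\<^sub>0 complex) \<Rightarrow> 'a \<Rightarrow>\<^sub>0 complex"
  by unfold_locales
    (auto intro!: poly_mapping_eqI simp: lookup_add algebra_simps)

lemma pscale_single [simp]: "pscale c (Poly_Mapping.single a d) = Poly_Mapping.single a (c * d)"
  by (intro poly_mapping_eqI) (simp add: lookup_single when_def)

lemma keys_pscale: "Poly_Mapping.keys (pscale c p) \<subseteq> Poly_Mapping.keys p"
  by (auto simp: in_keys_iff)

lemma scalar_mult: "scalar c * p = pscale c p"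
  unfolding scalar_def pscale_def mult_map_scale_conv_mult zero_list_def by simp

definition lin :: "('a \<Rightarrow> ('b \<Rightarrow>\<^sub>0 complex)) \<Rightarrow> ('a \<Rightarrow>\<^sub>0 complex) \<Rightarrow> ('b \<Rightarrow>\<^sub>0 complex)" where
  "lin f p = (\<Sum>a\<in>Poly_Mapping.keys p. pscale (Poly_Mapping.lookup p a) (f a))"

lemma lin_superset:
  assumes "finite A" "Poly_Mapping.keys p \<subseteq> A"
  shows "lin f p = (\<Sum>a\<in>A. pscale (Poly_Mapping.lookup p a) (f a))"
  unfolding lin_def using assms
  by (intro sum.mono_neutral_left) (auto simp: in_keys_iff)

lemma lin_single [simp]: "lin f (Poly_Mapping.single a c) = pscale c (f a)"
  by (simp add: lin_def)

lemma lin_zero [simp]: "lin f 0 = 0"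
  by (simp add: lin_def)

lemma lin_add: "lin f (p + q) = lin f p + lin f q"
proof -
  let ?A = "Poly_Mapping.keys p \<union> Poly_Mapping.keys q"
  show ?thesis
    using Poly_Mapping.keys_add[of p q]
    by (simp add: lin_superset[of ?A] lookup_add pm.scale_left_distrib sum.distrib)
qed

lemma lin_pscale: "lin f (pscale c p) = pscale c (lin f p)"
proof -
  have "lin f (pscale c p) = (\<Sum>a\<in>Poly_Mapping.keys p. pscale (c * Poly_Mapping.lookup p a) (f a))"
    using keys_pscale[of c p] by (simp add: lin_superset[of "Poly_Mapping.keys p"])
  then show ?thesis
    by (simp add: lin_def pm.scale_sum_right)
qed

lemma lin_uminus: "lin f (- p) = - lin f p"
  using lin_pscale[of f "-1" p] by simp

lemma lin_diff: "lin f (p - q) = lin f p - lin f q"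
  using lin_add[of f p "- q"] by (simp add: lin_uminus)

lemma lin_sum: "lin f (sum g A) = (\<Sum>a\<in>A. lin f (g a))"
  by (induction A rule: infinite_finite_induct) (auto simp: lin_add)

lemma lin_lin: "lin f (lin g p) = lin (\<lambda>a. lin f (g a)) p"
  by (simp add: lin_def[of g] lin_def[of "\<lambda>a. lin f (g a)"] lin_sum lin_pscale)

lemma lin_cong: "(\<And>a. a \<in> Poly_Mapping.keys p \<Longrightarrow> f a = g a) \<Longrightarrow> lin f p = lin g p"
  by (simp add: lin_def)

lemma lin_delta [simp]: "lin (\<lambda>a. Poly_Mapping.single a 1) p = p"
proof (rule poly_mapping_eqI)
  fix k
  have "Poly_Mapping.lookup (lin (\<lambda>a. Poly_Mapping.single a 1) p) k
      = (\<Sum>a\<in>Poly_Mapping.keys p. if k = a then Poly_Mapping.lookup p a else 0)"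
    by (auto simp: lin_def lookup_sum lookup_single when_def intro!: sum.cong)
  also have "\<dots> = Poly_Mapping.lookup p k"
    by (simp add: in_keys_iff)
  finally show "Poly_Mapping.lookup (lin (\<lambda>a. Poly_Mapping.single a 1) p) k = Poly_Mapping.lookup p k" .
qed

lemma lin_const_add: "lin (\<lambda>a. f a + g a) p = lin f p + lin g p"
  by (simp add: lin_def pm.scale_right_distrib sum.distrib)

lemma keys_lin:
  assumes "\<And>a. a \<in> Poly_Mapping.keys p \<Longrightarrow> Poly_Mapping.keys (f a) \<subseteq> B"
  shows "Poly_Mapping.keys (lin f p) \<subseteq> B"
  unfolding lin_def
  using Poly_Mapping.keys_sum[of "\<lambda>a. pscale (Poly_Mapping.lookup p a) (f a)" "Poly_Mapping.keys p"]
    assms keys_pscale by fast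

section \<open>The regular module\<close>

text \<open>With \<open>r = s\<^sub>1 s\<^sub>0\<close>, the basis vectors \<open>Rot k\<close>, \<open>Ref k\<close> and \<open>Ed k j\<close> stand for \<open>r\<^sup>k\<close>,
  \<open>r\<^sup>k s\<^sub>0\<close> (the reflection with index \<open>k\<close>) and \<open>r\<^sup>k e\<^sub>j\<close>, all indices being residues modulo \<open>2 l\<close>.\<close>

datatype bas = Rot int | Ref int | Ed int int

text \<open>Reduces well-definedness on residues to a single shift by \<open>m\<close>. It serves
  formulas with parities and halves, through which \<open>mod\<close> cannot be pushed
  directly.\<close>

lemma mod_if_periodic:
  fixes P :: "int \<Rightarrow> 'a"
  assumes "\<And>x. P (x + m) = P x"
  shows "P (x mod m) = P x"
proof -
  have *: "P (x + int n * m) = P x" for n x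
  proof (induction n)
    case (Suc n)
    have "x + int (Suc n) * m = (x + int n * m) + m"
      by (simp add: algebra_simps)
    then show ?case
      using assms Suc by metis
  qed simp
  have "P (x + k * m) = P x" for k x
  proof (cases "k \<ge> 0")
    case True
    then show ?thesis using *[of x "nat k"] by simp
  next
    case False
    then show ?thesis using *[of "x + k * m" "nat (- k)"] by (simp add: algebra_simps)
  qed
  from this[of "x mod m" "x div m"] show ?thesis
    by (simp add: algebra_simps)
qed

locale brauer_params =
  fixes l :: nat and \<mu>0 \<mu>1 \<tau>0 \<tau>1 :: complex
  assumes l_pos: "l \<ge> 1"
begin

definition m :: int where "m = 2 * int l"

lemma m_pos: "m > 0" and m_ge2: "m \<ge> 2" and even_m [simp]: "even m"
  using l_pos by (auto simp: m_def)

definition \<mu> :: "int \<Rightarrow> complex" where "\<mu> a = (if even a then \<mu>0 else \<mu>1)"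
definition \<tau> :: "int \<Rightarrow> complex" where "\<tau> a = (if even a then \<tau>0 else \<tau>1)"

definition R :: "int \<Rightarrow> bas" where "R k = Rot (k mod m)"
definition S :: "int \<Rightarrow> bas" where "S k = Ref (k mod m)"
definition E :: "int \<Rightarrow> int \<Rightarrow> bas" where "E k j = Ed (k mod m) (j mod m)"

definition Bas :: "bas set" where
  "Bas = range R \<union> range S \<union> range (case_prod E)"

lemma Bas_cases:
  assumes "b \<in> Bas"
  obtains k where "b = R k" | k where "b = S k" | k j where "b = E k j"
  using assms by (auto simp: Bas_def)

lemma in_Bas [simp]: "R k \<in> Bas" "S k \<in> Bas" "E k j \<in> Bas"
  by (auto simp: Bas_def)

lemma bas_eq [simp]:
  "R k = R k' \<longleftrightarrow> k mod m = k' mod m" "S k = S k' \<longleftrightarrow> k mod m = k' mod m"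
  "E k j = E k' j' \<longleftrightarrow> k mod m = k' mod m \<and> j mod m = j' mod m"
  "R k \<noteq> S k'" "R k \<noteq> E k' j" "S k \<noteq> E k' j" "S k' \<noteq> R k" "E k' j \<noteq> R k" "E k' j \<noteq> S k"
  by (auto simp: R_def S_def E_def)

definition \<delta> :: "bas \<Rightarrow> bas \<Rightarrow>\<^sub>0 complex" where "\<delta> b = Poly_Mapping.single b 1"

lemma delta_eq [simp]: "\<delta> b = \<delta> b' \<longleftrightarrow> b = b'"
  unfolding \<delta>_def by (metis lookup_single_eq lookup_single_not_eq zero_neq_one)

definition V :: "(bas \<Rightarrow>\<^sub>0 complex) set" where "V = {v. Poly_Mapping.keys v \<subseteq> Bas}"

text \<open>\<open>s_a r^k = r^(a-k) s_0\<close>, and in front of \<open>e_j\<close> the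
  \<open>s_0\<close> turns into \<open>r^(-j)\<close>, because
  \<open>e_j = s_j e_j = r^j s_0 e_j\<close>.\<close>

definition sact :: "int \<Rightarrow> bas \<Rightarrow> bas" where
  "sact a b = (case b of Rot k \<Rightarrow> S (a - k) | Ref k \<Rightarrow> R (a - k) | Ed k j \<Rightarrow> E (a - k - j) j)"

definition ract :: "int \<Rightarrow> bas \<Rightarrow> bas" where
  "ract a b = (case b of Rot k \<Rightarrow> R (k + a) | Ref k \<Rightarrow> S (k + a) | Ed k j \<Rightarrow> E (k + a) j)"

lemma sact_simps [simp]:
  "sact a (R k) = S (a - k)" "sact a (S k) = R (a - k)" "sact a (E k j) = E (a - k - j) j"
  by (simp_all add: sact_def R_def S_def E_def mod_simps)
    (metis mod_diff_left_eq mod_diff_right_eq)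

lemma ract_simps [simp]:
  "ract a (R k) = R (k + a)" "ract a (S k) = S (k + a)" "ract a (E k j) = E (k + a) j"
  by (auto simp: ract_def R_def S_def E_def mod_simps)

text \<open>The vector of \<open>e_i r^k e_j = r^k e_(i-2k) e_j\<close>. If \<open>i - 2k\<close>
  and \<open>j\<close> agree modulo \<open>m\<close>, the square of \<open>e_j\<close> appears.
  Otherwise \<open>s_c e_j = r^(c-j) e_j\<close>, for \<open>c = (i + j) / 2 - k\<close> and for
  \<open>c + l\<close>, gives the two summands. The resulting power of \<open>r\<close> is free of
  \<open>k\<close>, and \<open>k\<close> enters \<mu> only through its parity, so its sign there is
  immaterial.\<close>

definition ee :: "int \<Rightarrow> int \<Rightarrow> int \<Rightarrow> bas \<Rightarrow>\<^sub>0 complex" where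
  "ee i k j =
     (if odd (i - j) then 0
      else if m dvd (i - j - 2 * k) then pscale (\<tau> i) (\<delta> (E k j))
      else pscale (\<mu> ((i + j) div 2 + k)) (\<delta> (E ((i - j) div 2) j))
         + pscale (\<mu> ((i + j) div 2 + k + int l)) (\<delta> (E ((i - j) div 2 + int l) j)))"

text \<open>For \<open>Ref k\<close>: \<open>e_i r^k s_0 = r^k s_0 e_(2k-i)\<close>, and the
  \<open>s_0\<close> is absorbed as \<open>r^(i-2k)\<close>, which leaves
  \<open>r^(i-k) e_(2k-i)\<close>.\<close>

definition eact :: "int \<Rightarrow> bas \<Rightarrow> bas \<Rightarrow>\<^sub>0 complex" where
  "eact i b = (case b of Rot k \<Rightarrow> \<delta> (E k (i - 2 * k)) | Ref k \<Rightarrow> \<delta> (E (i - k) (2 * k - i))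
     | Ed k j \<Rightarrow> ee i k j)"

lemma mu_shift [simp]: "\<mu> (a + m) = \<mu> a" "\<mu> (a + 2 * int l) = \<mu> a" 
  by (auto simp: \<mu>_def)

lemma tau_shift [simp]: "\<tau> (a + m) = \<tau> a"
  by (auto simp: \<tau>_def)

text \<open>The shift changes \<open>(i + j) div 2\<close> and \<open>(i - j) div 2\<close> by
  \<open>l\<close> and so exchanges the two summands; it is their sum that depends on the residue of
  \<open>i\<close> alone.\<close>

lemma ee_shift1: "ee (i + m) k j = ee i k j"
proof -
  have 1: "m dvd (i + m - j - 2 * k) \<longleftrightarrow> m dvd (i - j - 2 * k)"
    using dvd_add_triv_right_iff[of m "i - j - 2 * k"] by (simp add: algebra_simps)
  have 2: "(i + m + j) div 2 = (i + j) div 2 + int l" "(i + m - j) div 2 = (i - j) div 2 + int l"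
    by (auto simp: m_def)
  have 3: "E ((i - j) div 2 + int l + int l) j = E ((i - j) div 2) j"
    by (simp add: m_def)
  have 4: "\<mu> ((i + j) div 2 + int l + k + int l) = \<mu> ((i + j) div 2 + k)"
    using mu_shift(2)[of "(i + j) div 2 + k"] by (simp add: algebra_simps)
  show ?thesis
    unfolding ee_def 1 2 3 4 by (auto simp: algebra_simps)
qed

lemma ee_shift2: "ee i (k + m) j = ee i k j"
proof -
  have 1: "m dvd (i - j - 2 * (k + m)) \<longleftrightarrow> m dvd (i - j - 2 * k)"
    using dvd_add_times_triv_right_iff[of m "i - j - 2 * k" "-2"] by (simp add: algebra_simps)
  have 4: "\<mu> ((i + j) div 2 + (k + m)) = \<mu> ((i + j) div 2 + k)"
    "\<mu> ((i + j) div 2 + (k + m) + int l) = \<mu> ((i + j) div 2 + k + int l)"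
    using mu_shift(1)[of "(i + j) div 2 + k"] mu_shift(1)[of "(i + j) div 2 + k + int l"]
    by (simp_all add: algebra_simps)
  have 5: "E (k + m) j = E k j"
    by simp
  show ?thesis
    unfolding ee_def 1 4 5 ..
qed

lemma ee_shift3: "ee i k (j + m) = ee i k j"
proof -
  have 1: "m dvd (i - (j + m) - 2 * k) \<longleftrightarrow> m dvd (i - j - 2 * k)"
    using dvd_add_times_triv_right_iff[of m "i - j - 2 * k" "-1"] by (simp add: algebra_simps)
  have 2: "(i + (j + m)) div 2 = (i + j) div 2 + int l" "(i - (j + m)) div 2 = (i - j) div 2 - int l"
    by (auto simp: m_def)
  have 3: "E ((i - j) div 2 - int l + int l) (j + m) = E ((i - j) div 2) j"
    "E ((i - j) div 2 - int l) (j + m) = E ((i - j) div 2 + int l) j" "E k (j + m) = E k j"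
    using mod_add_self2[of "(i - j) div 2 - int l" m]
    by (simp_all add: m_def algebra_simps)
  have 4: "\<mu> ((i + j) div 2 + int l + k + int l) = \<mu> ((i + j) div 2 + k)"
    using mu_shift(2)[of "(i + j) div 2 + k"] by (simp add: algebra_simps)
  show ?thesis
    unfolding ee_def 1 2 3 4 by (auto simp: algebra_simps)
qed

lemma eact_simps [simp]:
  "eact i (R k) = \<delta> (E k (i - 2 * k))" "eact i (S k) = \<delta> (E (i - k) (2 * k - i))"
  "eact i (E k j) = ee i k j"
proof -
  show "eact i (R k) = \<delta> (E k (i - 2 * k))" "eact i (S k) = \<delta> (E (i - k) (2 * k - i))"
    by (simp_all add: eact_def R_def S_def E_def mod_simps)
      (metis mod_diff_left_eq mod_diff_right_eq mod_mult_right_eq)+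
  have "eact i (E k j) = ee i (k mod m) (j mod m)"
    by (simp add: eact_def E_def)
  also have "\<dots> = ee i k j"
    using mod_if_periodic[of "\<lambda>k. ee i k (j mod m)" m k] mod_if_periodic[of "\<lambda>j. ee i k j" m j]
    by (simp add: ee_shift2 ee_shift3)
  finally show "eact i (E k j) = ee i k j" .
qed

lemma eact_period:
  assumes "b \<in> Bas" "i mod m = i' mod m"
  shows "eact i b = eact i' b"
proof -
  have "eact (i + m) b = eact i b" for i
    using assms(1)
  proof (cases rule: Bas_cases)
    case (1 k)
    have "(i + m - 2 * k) mod m = (i - 2 * k) mod m"
      by (metis add_diff_eq diff_add_eq mod_add_self2)
    with 1 show ?thesis by simp
  next
    case (2 k)
    have "(i + m - k) mod m = (i - k) mod m" "(2 * k - (i + m)) mod m = (2 * k - i) mod m"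
      by (metis add_diff_eq diff_add_eq mod_add_self2)
         (metis diff_diff_eq minus_mod_self2)
    with 2 show ?thesis by simp
  next
    case (3 k j)
    then show ?thesis by (simp add: ee_shift1)
  qed
  then show ?thesis
    using mod_if_periodic[of "\<lambda>i. eact i b" m i] mod_if_periodic[of "\<lambda>i. eact i b" m i'] assms(2)
    by simp
qed

text \<open>Reflections and rotations of arbitrary index get operators, although only
  \<open>Sop 0\<close> and \<open>Sop 1\<close> belong to generators. Their multiplication table
  replaces computations with words.\<close>

definition Sop :: "int \<Rightarrow> (bas \<Rightarrow>\<^sub>0 complex) \<Rightarrow> (bas \<Rightarrow>\<^sub>0 complex)" where
  "Sop a = lin (\<lambda>b. \<delta> (sact a b))"

definition Rop :: "int \<Rightarrow> (bas \<Rightarrow>\<^sub>0 complex) \<Rightarrow> (bas \<Rightarrow>\<^sub>0 complex)" where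
  "Rop a = lin (\<lambda>b. \<delta> (ract a b))"

definition Eop :: "int \<Rightarrow> (bas \<Rightarrow>\<^sub>0 complex) \<Rightarrow> (bas \<Rightarrow>\<^sub>0 complex)" where
  "Eop i = lin (eact i)"

lemma op_delta [simp]:
  "Sop a (\<delta> b) = \<delta> (sact a b)" "Rop a (\<delta> b) = \<delta> (ract a b)" "Eop i (\<delta> b) = eact i b"
  by (auto simp: Sop_def Rop_def Eop_def \<delta>_def)

lemma op_add: "Sop a (v + w) = Sop a v + Sop a w" "Rop a (v + w) = Rop a v + Rop a w"
  "Eop i (v + w) = Eop i v + Eop i w"
  by (auto simp: Sop_def Rop_def Eop_def lin_add)

lemma op_pscale: "Sop a (pscale c v) = pscale c (Sop a v)" "Rop a (pscale c v) = pscale c (Rop a v)"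
  "Eop i (pscale c v) = pscale c (Eop i v)"
  by (auto simp: Sop_def Rop_def Eop_def lin_pscale)

lemma op_zero [simp]: "Sop a 0 = 0" "Rop a 0 = 0" "Eop i 0 = 0"
  by (auto simp: Sop_def Rop_def Eop_def)

lemma op_sum: "Sop a (sum f A) = (\<Sum>x\<in>A. Sop a (f x))" "Rop a (sum f A) = (\<Sum>x\<in>A. Rop a (f x))"
  "Eop i (sum f A) = (\<Sum>x\<in>A. Eop i (f x))"
  by (auto simp: Sop_def Rop_def Eop_def lin_sum)

lemma op_diff: "Sop a (v - w) = Sop a v - Sop a w" "Rop a (v - w) = Rop a v - Rop a w"
  "Eop i (v - w) = Eop i v - Eop i w"
  by (auto simp: Sop_def Rop_def Eop_def lin_diff)

lemma sact_Bas: "b \<in> Bas \<Longrightarrow> sact a b \<in> Bas"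
  and ract_Bas: "b \<in> Bas \<Longrightarrow> ract a b \<in> Bas"
  by (auto elim!: Bas_cases)

lemma delta_V [simp]: "\<delta> b \<in> V \<longleftrightarrow> b \<in> Bas"
  by (simp add: V_def \<delta>_def)

lemma V_zero [simp]: "0 \<in> V"
  by (simp add: V_def)

lemma V_add: "v \<in> V \<Longrightarrow> w \<in> V \<Longrightarrow> v + w \<in> V"
  using Poly_Mapping.keys_add[of v w] by (auto simp: V_def)

lemma V_pscale: "v \<in> V \<Longrightarrow> pscale c v \<in> V"
  using keys_pscale[of c v] by (auto simp: V_def)

lemma V_sum: "(\<And>x. x \<in> A \<Longrightarrow> f x \<in> V) \<Longrightarrow> sum f A \<in> V"
  by (induction A rule: infinite_finite_induct) (auto simp: V_add)

lemma ee_V: "ee i k j \<in> V"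
  unfolding ee_def by (auto intro!: V_add V_pscale)

lemma eact_V: "b \<in> Bas \<Longrightarrow> eact i b \<in> V"
  by (auto elim!: Bas_cases simp: ee_V)

lemma lin_V: "v \<in> V \<Longrightarrow> (\<And>b. b \<in> Bas \<Longrightarrow> f b \<in> V) \<Longrightarrow> lin f v \<in> V"
  using keys_lin[of v f Bas] by (auto simp: V_def)

lemma op_V: "v \<in> V \<Longrightarrow> Sop a v \<in> V" "v \<in> V \<Longrightarrow> Rop a v \<in> V" "v \<in> V \<Longrightarrow> Eop i v \<in> V"
  unfolding Sop_def Rop_def Eop_def
  by (auto intro!: lin_V sact_Bas ract_Bas eact_V)

lemma lin_eqI:
  assumes "v \<in> V" "\<And>b. b \<in> Bas \<Longrightarrow> f b = g b"
  shows "lin f v = lin g v"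
  using assms by (intro lin_cong) (auto simp: V_def)

lemma lin_delta_id [simp]: "lin \<delta> v = v"
  unfolding \<delta>_def by simp

subsection \<open>Relations between the operators\<close>

lemma Sop_Sop: assumes "v \<in> V" shows "Sop a (Sop b v) = Rop (a - b) v"
  unfolding Sop_def Rop_def lin_lin
  by (rule lin_eqI[OF assms]) (auto elim!: Bas_cases simp: \<delta>_def algebra_simps)

lemma Rop_Rop: assumes "v \<in> V" shows "Rop a (Rop b v) = Rop (a + b) v"
  unfolding Rop_def lin_lin
  by (rule lin_eqI[OF assms]) (auto elim!: Bas_cases simp: \<delta>_def algebra_simps)

lemma Rop_Sop: assumes "v \<in> V" shows "Rop a (Sop b v) = Sop (a + b) v"
  unfolding Rop_def Sop_def lin_lin
  by (rule lin_eqI[OF assms]) (auto elim!: Bas_cases simp: \<delta>_def algebra_simps)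

lemma Sop_Rop: assumes "v \<in> V" shows "Sop a (Rop b v) = Sop (a - b) v"
  unfolding Rop_def Sop_def lin_lin
  by (rule lin_eqI[OF assms]) (auto elim!: Bas_cases simp: \<delta>_def algebra_simps)

lemma Rop_period:
  assumes "v \<in> V" "a mod m = b mod m"
  shows "Rop a v = Rop b v"
proof -
  have "(k + a) mod m = (k + b) mod m" for k
    using assms(2) mod_add_cong by blast
  then show ?thesis
    unfolding Rop_def using assms(1)
    by (intro lin_eqI) (auto elim!: Bas_cases)
qed

lemma Sop_period:
  assumes "v \<in> V" "a mod m = b mod m"
  shows "Sop a v = Sop b v"
  using Rop_period[of "Sop 0 v" a b] assms by (simp add: Rop_Sop op_V)

lemma Eop_period:
  assumes "v \<in> V" "i mod m = i' mod m"
  shows "Eop i v = Eop i' v"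
  unfolding Eop_def using assms by (intro lin_eqI eact_period)

lemma Rop_0: "v \<in> V \<Longrightarrow> Rop 0 v = v"
proof -
  assume "v \<in> V"
  then have "lin (\<lambda>b. \<delta> (ract 0 b)) v = lin \<delta> v"
    by (intro lin_eqI) (auto elim!: Bas_cases)
  then show ?thesis
    by (simp add: Rop_def)
qed

text \<open>\<open>e_i\<close> maps into the span of the \<open>r^h e_c = e_(2h+c) r^h\<close> with
  \<open>2h + c\<close> congruent to \<open>i\<close>. Relations that begin by applying
  \<open>e_i\<close> need to be checked on these vectors only.\<close>

lemma Eop_range_induct:
  assumes "v \<in> V"
    and "\<And>h c. (2 * h + c) mod m = i mod m \<Longrightarrow> P (\<delta> (E h c))"
    and "P 0" "\<And>v w. P v \<Longrightarrow> P w \<Longrightarrow> P (v + w)" "\<And>c v. P v \<Longrightarrow> P (pscale c v)"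
  shows "P (Eop i v)"
proof -
  have ee: "P (ee i k j)" for k j
  proof (cases "odd (i - j)")
    case True
    then show ?thesis using assms(3) by (simp add: ee_def)
  next
    case False
    then have "2 * ((i - j) div 2) + j = i"
      by simp
    moreover from this have "(2 * ((i - j) div 2 + int l) + j) mod m = i mod m"
      by (metis (no_types, opaque_lifting) add.commute add.left_commute distrib_left m_def mod_add_self1)
    moreover have "(2 * k + j) mod m = i mod m" if "m dvd (i - j - 2 * k)"
      using that by (metis add.commute diff_diff_eq mod_eq_dvd_iff)
    ultimately show ?thesis
      unfolding ee_def using assms(2-5) by (auto intro!: assms(4,5) assms(2))
  qed
  have e: "P (eact i b)" if "b \<in> Bas" for b
    using that
  proof (cases rule: Bas_cases)
    case (1 k) then show ?thesis by (auto intro!: assms(2))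
  next
    case (2 k)
    have "2 * (i - k) + (2 * k - i) = i" by simp
    with 2 show ?thesis by (simp add: assms(2))
  qed (simp add: ee)
  have "P (\<Sum>b\<in>A. pscale (Poly_Mapping.lookup v b) (eact i b))" if "finite A" "A \<subseteq> Bas" for A
    using that by (induction A rule: finite_induct) (auto intro: assms(3-5) e)
  then show ?thesis
    using assms(1) by (auto simp: Eop_def lin_def V_def)
qed

lemma Eop_E_self: "(2 * k + j) mod m = i mod m \<Longrightarrow> eact i (E k j) = pscale (\<tau> i) (\<delta> (E k j))"
proof -
  assume *: "(2 * k + j) mod m = i mod m"
  then have "m dvd (i - (2 * k + j))"
    by (metis mod_eq_dvd_iff)
  then have d: "m dvd (i - j - 2 * k)"
    by (simp add: algebra_simps)
  then have "even (i - j - 2 * k)"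
    using even_m dvd_trans by blast
  then show ?thesis
    using d by (simp add: ee_def)
qed

lemma Sop_Eop_self:
  assumes "v \<in> V" shows "Sop i (Eop i v) = Eop i v"
proof (rule Eop_range_induct[OF assms, where P = "\<lambda>w. Sop i w = w"])
  fix h c assume *: "(2 * h + c) mod m = i mod m"
  then have "(i - h - c) mod m = (2 * h + c - h - c) mod m"
    by (intro mod_diff_cong) auto
  then show "Sop i (\<delta> (E h c)) = \<delta> (E h c)"
    by simp
qed (auto simp: op_add op_pscale)

lemma Eop_conj:
  assumes "v \<in> V" shows "Sop a (Eop i v) = Eop (2 * a - i) (Sop a v)"
  unfolding Sop_def Eop_def lin_lin
proof (rule lin_eqI[OF assms])
  fix b assume "b \<in> Bas"
  then show "lin (\<lambda>b. \<delta> (sact a b)) (eact i b) = lin (eact (2 * a - i)) (\<delta> (sact a b))"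
  proof (cases rule: Bas_cases)
    case (1 k)
    then show ?thesis by (simp add: \<delta>_def algebra_simps)
  next
    case (2 k)
    then show ?thesis by (simp add: \<delta>_def algebra_simps)
  next
    case (3 k j)
    let ?k = "a - k - j"
    have 1: "m dvd (2 * a - i - j - 2 * ?k) \<longleftrightarrow> m dvd (i - j - 2 * k)"
      using dvd_minus_iff[of m "i - j - 2 * k"] by (simp add: algebra_simps)
    have "lin (\<lambda>b. \<delta> (sact a b)) (ee i k j) = ee (2 * a - i) ?k j"
    proof (cases "odd (i - j)")
      case True
      then have "odd (2 * a - i - j)" by simp
      with True show ?thesis by (simp add: ee_def)
    next
      case False
      \<comment> \<open>In terms of \<open>t\<close> all halves are exact integers.\<close>
      then obtain t where t: "i = j + 2 * t"
        by (metis add.commute diff_add_cancel evenE)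
      have 2: "(2 * a - i + j) div 2 = a - t" "(2 * a - i - j) div 2 = a - t - j"
        "(i + j) div 2 = j + t" "(i - j) div 2 = t"
        unfolding t by auto
      have 3: "\<mu> (a - t + ?k) = \<mu> (j + t + k)" "\<mu> (a - t + ?k + int l) = \<mu> (j + t + k + int l)"
        by (auto simp: \<mu>_def)
      have 5: "\<tau> (2 * a - i) = \<tau> i" by (simp add: \<tau>_def)
      \<comment> \<open>The reflection turns a shift by \<open>l\<close> into one by
        \<open>-l\<close>, and these agree modulo \<open>m\<close>.\<close>
      have 6: "E (a - t - j + int l) j = E (a - t - int l - j) j"
        using mod_add_self2[of "a - t - int l - j" m] by (simp add: m_def algebra_simps)
      have 7: "odd (2 * a - i - j) \<longleftrightarrow> False" using False by simp
      show ?thesis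
        unfolding ee_def 1 2 3 5 7 6 using False
        by (simp add: lin_add lin_pscale) (simp add: \<delta>_def algebra_simps)
    qed
    then show ?thesis
      by (simp add: 3) (simp add: \<delta>_def)
  qed
qed

lemma Eop_Sop_self:
  assumes "v \<in> V" shows "Eop i (Sop i v) = Eop i v"
  using Eop_conj[OF assms, of i i] Sop_Eop_self[OF assms, of i] by simp

lemma Eop_Eop_self:
  assumes "v \<in> V" shows "Eop i (Eop i v) = pscale (\<tau> i) (Eop i v)"
  by (rule Eop_range_induct[OF assms, where P = "\<lambda>w. Eop i w = pscale (\<tau> i) w"])
    (auto simp: op_add op_pscale Eop_E_self pm.scale_right_distrib mult.commute simp del: eact_simps)

lemma Eop_Eop_odd:
  assumes "v \<in> V" "odd (i + j)" shows "Eop i (Eop j v) = 0"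
proof (rule Eop_range_induct[OF assms(1), where P = "\<lambda>w. Eop i w = 0"])
  fix h c assume "(2 * h + c) mod m = j mod m"
  then have "even (2 * h + c - j)"
    by (metis even_m dvd_trans mod_eq_dvd_iff)
  then have "odd (i - c)"
    using assms(2) by auto
  then show "Eop i (\<delta> (E h c)) = 0"
    by (simp add: ee_def)
qed (auto simp: op_add op_pscale)

text \<open>Checked on \<open>r^h e_c\<close> with \<open>2h + c\<close> congruent to
  \<open>j\<close>. The integer representative matters: \<open>j = 2h + c + m q\<close> makes
  \<open>(i + j) div 2\<close> the midpoint of \<open>i\<close> and \<open>2h + c\<close>, plus
  \<open>l q\<close>.\<close>

lemma Eop_Eop_even:
  assumes "v \<in> V" "even (i + j)" "i mod m \<noteq> j mod m"
  shows "Eop i (Eop j v) = pscale (\<mu> ((i + j) div 2)) (Sop ((i + j) div 2) (Eop j v))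
     + pscale (\<mu> ((i + j) div 2 + int l)) (Sop ((i + j) div 2 + int l) (Eop j v))"
proof (rule Eop_range_induct[OF assms(1), where P = "\<lambda>w. Eop i w =
     pscale (\<mu> ((i + j) div 2)) (Sop ((i + j) div 2) w)
     + pscale (\<mu> ((i + j) div 2 + int l)) (Sop ((i + j) div 2 + int l) w)"])
  fix h c assume *: "(2 * h + c) mod m = j mod m"
  then have "m dvd j - (2 * h + c)"
    by (metis mod_eq_dvd_iff)
  then obtain q where "j - (2 * h + c) = 2 * int l * q"
    by (auto simp: m_def dvd_def)
  then have q: "j = 2 * h + c + 2 * int l * q"
    by simp
  then have ev: "even (i - c)"
    using assms(2) by auto
  then obtain t where t: "i = c + 2 * t"
    by (metis add.commute diff_add_cancel evenE)
  have a: "(i + j) div 2 = c + t + h + int l * q" "(i + c) div 2 = c + t" "(i - c) div 2 = t"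
    unfolding t q by auto
  have nd: "\<not> m dvd (i - c - 2 * h)"
  proof
    assume "m dvd (i - c - 2 * h)"
    then have "i mod m = (2 * h + c) mod m"
      by (simp add: mod_eq_dvd_iff algebra_simps)
    with * assms(3) show False by simp
  qed
  have 1: "Eop i (\<delta> (E h c)) = pscale (\<mu> (c + t + h)) (\<delta> (E t c))
         + pscale (\<mu> (c + t + h + int l)) (\<delta> (E (t + int l) c))"
    using nd ev a(2,3) by (simp add: ee_def)
  have 2: "Sop x (\<delta> (E h c)) = \<delta> (E (x - h - c) c)" for x
    by simp
  show "Eop i (\<delta> (E h c)) = pscale (\<mu> ((i + j) div 2)) (Sop ((i + j) div 2) (\<delta> (E h c)))
     + pscale (\<mu> ((i + j) div 2 + int l)) (Sop ((i + j) div 2 + int l) (\<delta> (E h c)))"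
  \<comment> \<open>An odd \<open>q\<close> moves the midpoint by \<open>l\<close> modulo
    \<open>m\<close>, which only exchanges the two summands.\<close>
  proof (cases "even q")
    case True
    then obtain n where "q = 2 * n" by (elim evenE)
    then have q': "int l * q = m * n" by (simp add: m_def)
    have "c + t + h + m * n - h - c = t + m * n"
      "c + t + h + m * n + int l - h - c = t + int l + m * n"
      by auto
    then have e: "E (c + t + h + m * n - h - c) c = E t c"
      "E (c + t + h + m * n + int l - h - c) c = E (t + int l) c"
      unfolding bas_eq by (metis mod_mult_self2)+
    have "\<mu> (c + t + h + m * n) = \<mu> (c + t + h)"
      "\<mu> (c + t + h + m * n + int l) = \<mu> (c + t + h + int l)"
      by (auto simp: \<mu>_def)
    then show ?thesis
      unfolding 1 2 a q' e by simp
  next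
    case False
    then obtain n where "q = 2 * n + 1" by (elim oddE)
    then have q': "int l * q = m * n + int l" by (simp add: m_def algebra_simps)
    have "c + t + h + (m * n + int l) - h - c = t + int l + m * n"
      "c + t + h + (m * n + int l) + int l - h - c = t + m * (n + 1)"
      by (auto simp: m_def algebra_simps)
    then have e: "E (c + t + h + (m * n + int l) - h - c) c = E (t + int l) c"
      "E (c + t + h + (m * n + int l) + int l - h - c) c = E t c"
      unfolding bas_eq by (metis mod_mult_self2)+
    have "\<mu> (c + t + h + (m * n + int l)) = \<mu> (c + t + h + int l)"
      "\<mu> (c + t + h + (m * n + int l) + int l) = \<mu> (c + t + h)"
      by (auto simp: \<mu>_def)
    then show ?thesis
      unfolding 1 2 a q' e by (simp add: add.commute)
  qed
qed (simp_all add: op_add op_pscale pm.scale_right_distrib mult.commute add_ac)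


section \<open>The dihedral group\<close>

definition ang :: "int \<Rightarrow> real" where "ang a = pi * real_of_int a / real_of_int m"

definition dir :: "int \<Rightarrow> real ^ 2" where "dir a = vector [cos (ang a), sin (ang a)]"

text \<open>Integer indices let products such as \<open>rfl_rfl\<close> hold without reduction to
  residues. The angle is doubled because the reflections in the mirrors at angles
  \<open>ang a\<close> and 0 compose to the rotation by \<open>2 * ang a\<close>.\<close>

definition rfl :: "int \<Rightarrow> real ^ 2 \<Rightarrow> real ^ 2" where
  "rfl a x = vector [cos (2 * ang a) * vec_nth x 1 + sin (2 * ang a) * vec_nth x 2,
     sin (2 * ang a) * vec_nth x 1 - cos (2 * ang a) * vec_nth x 2]"

definition rot :: "int \<Rightarrow> real ^ 2 \<Rightarrow> real ^ 2" where
  "rot a x = vector [cos (2 * ang a) * vec_nth x 1 - sin (2 * ang a) * vec_nth x 2,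
     sin (2 * ang a) * vec_nth x 1 + cos (2 * ang a) * vec_nth x 2]"

lemma vector2_eq_iff: "(x :: real ^ 2) = y \<longleftrightarrow> vec_nth x 1 = vec_nth y 1 \<and> vec_nth x 2 = vec_nth y 2"
  by (simp add: Finite_Cartesian_Product.vec_eq_iff forall_2)

lemma ang_add: "ang (a + b) = ang a + ang b" and ang_diff: "ang (a - b) = ang a - ang b"
  and ang_0 [simp]: "ang 0 = 0"
  by (auto simp: ang_def field_simps add_divide_distrib diff_divide_distrib)

lemma ang_m: "ang m = pi"
  using m_pos by (simp add: ang_def)

lemma mirror_dir_eq: "mirror_dir l i = dir (int i)"
  by (simp add: mirror_dir_def dir_def ang_def m_def)

lemma inner_vec2: "inner (x :: real ^ 2) y = vec_nth x 1 * vec_nth y 1 + vec_nth x 2 * vec_nth y 2"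
  by (simp add: inner_vec_def sum_2)

lemma reflection_eq: "reflection l i = rfl (int i)"
proof
  fix x
  show "reflection l i x = rfl (int i) x"
    unfolding reflection_def mirror_dir_eq rfl_def vector2_eq_iff
  proof
    show "vec_nth ((2 * inner x (dir (int i))) *\<^sub>R dir (int i) - x) 1 =
      vec_nth (vector [cos (2 * ang (int i)) * vec_nth x 1 + sin (2 * ang (int i)) * vec_nth x 2,
         sin (2 * ang (int i)) * vec_nth x 1 - cos (2 * ang (int i)) * vec_nth x 2] :: real ^ 2) 1"
      by (simp add: inner_vec2 dir_def cos_double_cos sin_double power2_eq_square algebra_simps)
    show "vec_nth ((2 * inner x (dir (int i))) *\<^sub>R dir (int i) - x) 2 =
      vec_nth (vector [cos (2 * ang (int i)) * vec_nth x 1 + sin (2 * ang (int i)) * vec_nth x 2,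
         sin (2 * ang (int i)) * vec_nth x 1 - cos (2 * ang (int i)) * vec_nth x 2] :: real ^ 2) 2"
      by (simp add: inner_vec2 dir_def cos_double_sin sin_double power2_eq_square algebra_simps)
  qed
qed

lemma rfl_rfl: "rfl a \<circ> rfl b = rot (a - b)"
  and rot_rot: "rot a \<circ> rot b = rot (a + b)"
  and rfl_rot: "rfl a \<circ> rot b = rfl (a - b)"
  and rot_rfl: "rot a \<circ> rfl b = rfl (a + b)"
  by (auto simp: fun_eq_iff rfl_def rot_def vector2_eq_iff ang_diff ang_add distrib_left
      right_diff_distrib cos_diff sin_diff cos_add sin_add algebra_simps)

lemma rot_rfl_apply [simp]: "rfl a (rfl b x) = rot (a - b) x" "rot a (rot b x) = rot (a + b) x"
  "rfl a (rot b x) = rfl (a - b) x" "rot a (rfl b x) = rfl (a + b) x"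
  using rfl_rfl rot_rot rfl_rot rot_rfl by (metis comp_apply)+

lemma rot_0: "rot 0 = id"
  by (auto simp: fun_eq_iff rot_def vector2_eq_iff)

lemma ang_eq: "2 * ang a = 2 * ang b + 2 * pi * of_int n \<longleftrightarrow> a = b + m * n"
proof -
  have "2 * ang a = 2 * ang b + 2 * pi * of_int n
      \<longleftrightarrow> real_of_int a = real_of_int (b + m * n)"
  proof -
    have "2 * ang a = 2 * ang b + 2 * pi * of_int n
      \<longleftrightarrow> 2 * pi * real_of_int a = 2 * pi * (real_of_int b + real_of_int m * real_of_int n)"
      using m_pos by (simp add: ang_def field_simps)
    then show ?thesis
      by simp
  qed
  then show ?thesis
    using of_int_eq_iff by blast
qed

lemma rot_eq_iff: "rot a = rot b \<longleftrightarrow> a mod m = b mod m"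
proof
  assume "rot a = rot b"
  from fun_cong[OF this, of "vector [1, 0]"]
  have "sin (2 * ang a) = sin (2 * ang b) \<and> cos (2 * ang a) = cos (2 * ang b)"
    by (simp add: rot_def vector2_eq_iff)
  then obtain n where "2 * ang a = 2 * ang b + 2 * pi * of_int n"
    using sin_cos_eq_iff by blast
  then show "a mod m = b mod m"
    unfolding ang_eq by simp
next
  assume "a mod m = b mod m"
  then obtain n where "a = b + m * n"
    by (metis mod_eqE)
  then have "2 * ang a = 2 * ang b + 2 * pi * of_int n"
    unfolding ang_eq .
  then have "sin (2 * ang a) = sin (2 * ang b) \<and> cos (2 * ang a) = cos (2 * ang b)"
    using sin_cos_eq_iff by blast
  then show "rot a = rot b"
    by (simp add: rot_def fun_eq_iff)
qed

lemma rfl_eq_iff: "rfl a = rfl b \<longleftrightarrow> a mod m = b mod m"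
proof -
  have "rot a = rfl a \<circ> rfl 0" "rfl a = rot a \<circ> rfl 0" for a
    by (simp_all add: rfl_rfl rot_rfl)
  then show ?thesis
    by (metis rot_eq_iff)
qed

lemma rfl_neq_rot [simp]: "rfl a \<noteq> rot b" "rot b \<noteq> rfl a"
proof -
  show "rfl a \<noteq> rot b"
  proof
    assume eq: "rfl a = rot b"
    \<comment> \<open>The image of the first unit vector makes the sines and cosines of the two
      double angles equal, that of the second makes them opposite.\<close>
    from fun_cong[OF eq, of "vector [1, 0]"] fun_cong[OF eq, of "vector [0, 1]"]
    have "sin (2 * ang b) = 0 \<and> cos (2 * ang b) = 0"
      by (auto simp: rot_def rfl_def vector2_eq_iff)
    then show False
      using sin_cos_squared_add[of "2 * ang b"] by simp
  qed
  then show "rot b \<noteq> rfl a" by metis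
qed

lemma rfl_dir: "rfl a (dir b) = dir (2 * a - b)"
proof -
  have "ang (2 * a - b) = 2 * ang a - ang b"
    using ang_add[of a a] by (simp add: ang_diff)
  then show ?thesis
    by (simp add: rfl_def dir_def vector2_eq_iff cos_diff sin_diff)
qed

lemma dir_m: "dir (a + m) = - dir a"
  by (simp add: dir_def vector2_eq_iff ang_add ang_m)

lemma eval_word_Nil: "eval_word l [] = rot 0"
  and eval_word_Cons: "eval_word l (a # u) = rfl (int a) \<circ> eval_word l u"
  by (simp_all add: eval_word_def reflection_eq rot_0)

definition D :: "(real ^ 2 \<Rightarrow> real ^ 2) set" where "D = range rot \<union> range rfl"

lemma rot_D [simp]: "rot k \<in> D" "rfl k \<in> D"
  by (auto simp: D_def)

lemma D_cases:
  assumes "w \<in> D" obtains k where "w = rot k" | k where "w = rfl k"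
  using assms by (auto simp: D_def)

lemma eval_word_in_D: "eval_word l u \<in> D"
  by (induction u) (auto simp: eval_word_Nil eval_word_Cons elim!: D_cases)

text \<open>\<open>n\<close> copies of \<open>s_1 s_0\<close> spell the rotation
  \<open>rot n\<close>, and one more \<open>s_0\<close> at the end gives the reflection. Residues
  modulo \<open>m\<close> supply natural exponents.\<close>

lemma eval_word_surj:
  assumes "w \<in> D" obtains u where "u \<in> lists {0, 1}" "eval_word l u = w"
proof -
  have rep: "eval_word l (concat (replicate n [1, 0]) @ u) = rot (int n) \<circ> eval_word l u" for n u
  proof (induction n)
    case 0
    then show ?case by (simp add: rot_0)
  next
    case (Suc n)
    then show ?case
      by (simp add: eval_word_Cons add.commute)
  qed
  have in_lists: "concat (replicate n [1, 0]) \<in> lists {0, 1 :: nat}" for n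
    by (induction n) auto
  from assms obtain k where "w = rot k \<or> w = rfl k"
    by (auto simp: D_def)
  moreover have k: "rot (int (nat (k mod m))) = rot k" "rfl (int (nat (k mod m))) = rfl k"
    using m_pos by (simp_all add: rot_eq_iff rfl_eq_iff)
  ultimately show ?thesis
    using rep[of "nat (k mod m)" "[]"] rep[of "nat (k mod m)" "[0]"] in_lists[of "nat (k mod m)"]
      that[of "concat (replicate (nat (k mod m)) [1, 0])"]
      that[of "concat (replicate (nat (k mod m)) [1, 0]) @ [0]"]
    by (auto simp: eval_word_Nil eval_word_Cons rot_0 rot_rfl rfl_rot k)
qed

lemma D_Bij: "w \<in> D \<Longrightarrow> w \<in> Bij UNIV"
proof -
  assume "w \<in> D"
  then obtain w' where "w \<circ> w' = id" "w' \<circ> w = id"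
  proof (elim D_cases)
    fix k assume "w = rot k" then show thesis using that[of "rot (- k)"] by (simp add: rot_rot rot_0)
  next
    fix k assume "w = rfl k" then show thesis using that[of "rfl k"] by (simp add: rfl_rfl rot_0)
  qed
  then show ?thesis
    using o_bij by (auto simp: Bij_def)
qed

lemma mult_plane_group: "v \<in> D \<Longrightarrow> w \<in> D \<Longrightarrow> v \<otimes>\<^bsub>plane_group\<^esub> w = v \<circ> w"
  using D_Bij by (auto simp: BijGroup_def compose_def)

lemma one_plane_group: "\<one>\<^bsub>plane_group\<^esub> = rot 0"
  by (auto simp: BijGroup_def rot_0)

lemma inv_plane_group: "inv\<^bsub>plane_group\<^esub> rot k = rot (- k)" "inv\<^bsub>plane_group\<^esub> rfl k = rfl k"
proof -
  interpret group plane_group by (rule group_BijGroup)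
  have c: "w \<in> carrier plane_group" if "w \<in> D" for w
    using D_Bij[OF that] by (simp add: BijGroup_def)
  show "inv\<^bsub>plane_group\<^esub> rot k = rot (- k)"
    using mult_plane_group[of "rot (- k)" "rot k"] c
    by (intro inv_equality) (auto simp: one_plane_group rot_rot)
  show "inv\<^bsub>plane_group\<^esub> rfl k = rfl k"
    using mult_plane_group[of "rfl k" "rfl k"] c
    by (intro inv_equality) (auto simp: one_plane_group rfl_rfl)
qed

lemma D_comp: "v \<in> D \<Longrightarrow> w \<in> D \<Longrightarrow> v \<circ> w \<in> D"
  by (auto elim!: D_cases simp: rfl_rfl rot_rot rfl_rot rot_rfl)

lemma dihedral_eq: "dihedral l = D"
proof
  show "dihedral l \<subseteq> D"
  proof
    fix w assume "w \<in> dihedral l"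
    then have "w \<in> generate plane_group {rfl 0, rfl 1}"
      by (simp add: dihedral_def reflection_eq)
    then show "w \<in> D"
    proof (induction rule: generate.induct)
      case (eng h1 h2)
      then show ?case
        using mult_plane_group[of h1 h2] D_comp[of h1 h2] by metis
    qed (auto simp: one_plane_group inv_plane_group)
  qed
  show "D \<subseteq> dihedral l"
  proof
    fix w assume "w \<in> D"
    then obtain u where u: "u \<in> lists {0, 1}" "eval_word l u = w"
      by (rule eval_word_surj)
    from u(1) have "eval_word l u \<in> generate plane_group {rfl 0, rfl 1}"
    proof (induction u)
      case Nil
      then show ?case
        using generate.one[of plane_group] by (simp add: eval_word_Nil one_plane_group)
    next
      case (Cons a u)
      then have "rfl (int a) \<in> generate plane_group {rfl 0, rfl 1}"
        by (auto intro: generate.incl)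
      then have "rfl (int a) \<otimes>\<^bsub>plane_group\<^esub> eval_word l u \<in> generate plane_group {rfl 0, rfl 1}"
        using Cons by (intro generate.eng) auto
      then show ?case
        unfolding eval_word_Cons mult_plane_group[OF rot_D(2) eval_word_in_D] .
    qed
    then show "w \<in> dihedral l"
      using u by (simp add: dihedral_def reflection_eq)
  qed
qed

text \<open>These properties are all that is ever used of the word picked by
  \<open>SOME\<close>.\<close>

lemma grp_word:
  assumes "w \<in> D"
  obtains u where "u \<in> lists {0, 1}" "eval_word l u = w" "grp l w = monomial (map SG u)"
proof -
  let ?u = "SOME u. u \<in> lists {0, 1} \<and> eval_word l u = w"
  obtain u where "u \<in> lists {0, 1}" "eval_word l u = w"
    using eval_word_surj[OF assms] .
  then have "?u \<in> lists {0, 1} \<and> eval_word l ?u = w"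
    by (intro someI[where P = "\<lambda>u. u \<in> lists {0, 1} \<and> eval_word l u = w"]) auto
  then show ?thesis
    using that[of ?u] by (simp add: grp_def)
qed

section \<open>The action of the free algebra\<close>

fun gact :: "gen \<Rightarrow> (bas \<Rightarrow>\<^sub>0 complex) \<Rightarrow> (bas \<Rightarrow>\<^sub>0 complex)" where
  "gact (SG n) = Sop (int n)"
| "gact (EG i) = Eop (int i)"

definition wop :: "gen list \<Rightarrow> (bas \<Rightarrow>\<^sub>0 complex) \<Rightarrow> (bas \<Rightarrow>\<^sub>0 complex)" where
  "wop u = foldr gact u"

lemma wop_simps [simp]: "wop [] v = v" "wop (g # u) v = gact g (wop u v)"
  "wop (u @ u') v = wop u (wop u' v)"
  by (simp_all add: wop_def)

lemma gact_add: "gact g (v + w) = gact g v + gact g w"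
  and gact_pscale: "gact g (pscale c v) = pscale c (gact g v)"
  and gact_zero [simp]: "gact g 0 = 0"
  and gact_V: "v \<in> V \<Longrightarrow> gact g v \<in> V"
  by (cases g; simp add: op_add op_pscale op_V)+

lemma wop_add: "wop u (v + w) = wop u v + wop u w"
  and wop_pscale: "wop u (pscale c v) = pscale c (wop u v)"
  and wop_zero [simp]: "wop u 0 = 0"
  and wop_V: "v \<in> V \<Longrightarrow> wop u v \<in> V"
  by (induction u) (auto simp: gact_add gact_pscale gact_V)

definition act :: "(gen list \<Rightarrow>\<^sub>0 complex) \<Rightarrow> (bas \<Rightarrow>\<^sub>0 complex) \<Rightarrow> (bas \<Rightarrow>\<^sub>0 complex)" where
  "act p v = lin (\<lambda>u. wop u v) p"

lemma act_simps [simp]: "act 0 v = 0" "act 1 v = v" "act (monomial u) v = wop u v"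
  "act (scalar c) v = pscale c v" "act p 0 = 0"
  by (simp_all add: act_def monomial_def scalar_def zero_list_def lin_def flip: single_one)

lemma act_add: "act (p + q) v = act p v + act q v"
  and act_diff: "act (p - q) v = act p v - act q v"
  and act_uminus: "act (- q) v = - act q v"
  and act_pscale: "act (pscale c p) v = pscale c (act p v)"
  by (simp_all add: act_def lin_add lin_diff lin_uminus lin_pscale)

lemma act_add_right: "act p (v + w) = act p v + act p w"
  by (simp add: act_def wop_add lin_const_add)

lemma act_V: "v \<in> V \<Longrightarrow> act p v \<in> V"
  unfolding act_def using keys_lin[of p "\<lambda>u. wop u v" Bas] wop_V[of v]
  by (auto simp: V_def)

lemma poly_mapping_additive_induct:
  fixes p :: "'a \<Rightarrow>\<^sub>0 complex"
  assumes "P 0" "\<And>a c. P (Poly_Mapping.single a c)" "\<And>p q. P p \<Longrightarrow> P q \<Longrightarrow> P (p + q)"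
  shows "P p"
proof -
  have "P (\<Sum>a\<in>A. pscale (Poly_Mapping.lookup p a) (Poly_Mapping.single a 1))" if "finite A" for A
    using that by (induction A rule: finite_induct) (auto intro: assms)
  from this[of "Poly_Mapping.keys p"] show ?thesis
    using lin_delta[of p] unfolding lin_def by (simp del: pscale_single)
qed

lemma act_mult: "act (p * q) v = act p (act q v)"
proof (induction p rule: poly_mapping_additive_induct)
  case (2 u c)
  show ?case
  proof (induction q rule: poly_mapping_additive_induct)
    case (2 u' c')
    then show ?case
      by (simp add: act_def mult_single plus_list_def wop_pscale)
  next
    case (3 p q)
    then show ?case by (simp add: distrib_left act_add act_add_right)
  qed simp
next
  case (3 p q)
  then show ?case by (simp add: distrib_right act_add)
qed simp

text \<open>Value and action of a word are tracked with the same index \<open>k\<close>, so the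
  operator of \<open>grp l w\<close> depends on \<open>w\<close> and not on the word chosen for
  it.\<close>

lemma wop_group:
  "(\<exists>k. eval_word l u = rot k \<and> (\<forall>v\<in>V. wop (map SG u) v = Rop k v)) \<or>
   (\<exists>k. eval_word l u = rfl k \<and> (\<forall>v\<in>V. wop (map SG u) v = Sop k v))"
proof (induction u)
  case Nil
  then show ?case using Rop_0 by (auto simp: eval_word_Nil intro!: exI[of _ 0])
next
  case (Cons a u)
  then show ?case
    by (auto simp: eval_word_Cons rfl_rot rfl_rfl rfl_eq_iff rot_eq_iff Sop_Rop Sop_Sop)
qed

lemma act_grp: assumes "v \<in> V"
  shows "act (grp l (rot k)) v = Rop k v" "act (grp l (rfl k)) v = Sop k v"
proof -
  obtain u where u: "u \<in> lists {0, 1}" "eval_word l u = rot k" "grp l (rot k) = monomial (map SG u)"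
    using grp_word[OF rot_D(1)] .
  then show "act (grp l (rot k)) v = Rop k v"
    using wop_group[of u] assms by (auto simp: rot_eq_iff intro: Rop_period[OF _ sym])
  obtain u where u: "u \<in> lists {0, 1}" "eval_word l u = rfl k" "grp l (rfl k) = monomial (map SG u)"
    using grp_word[OF rot_D(2)] .
  then show "act (grp l (rfl k)) v = Sop k v"
    using wop_group[of u] assms by (auto simp: rfl_eq_iff intro: Sop_period[OF _ sym])
qed

text \<open>\<open>r^a = s_a s_0\<close>, and \<open>Eop_conj\<close> applies to each
  factor.\<close>

lemma Rop_Eop:
  assumes "v \<in> V" shows "Rop a (Eop i v) = Eop (i + 2 * a) (Rop a v)"
proof -
  have "Rop a (Eop i v) = Sop a (Sop 0 (Eop i v))"
    using assms by (simp add: Sop_Sop op_V)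
  also have "\<dots> = Eop (i + 2 * a) (Sop a (Sop 0 v))"
    using assms by (simp add: Eop_conj op_V algebra_simps)
  finally show ?thesis
    using assms by (simp add: Sop_Sop)
qed

section \<open>The defining relations hold in the regular module\<close>

abbreviation F where "F \<equiv> free_algebra (gens l)"
abbreviation N where "N \<equiv> rel_ideal l \<mu>0 \<mu>1 \<tau>0 \<tau>1"
abbreviation Rels where "Rels \<equiv> relations l \<mu>0 \<mu>1 \<tau>0 \<tau>1"

sublocale F: ring F by (rule ring_free_algebra)

lemma F_simps [simp]: "mult F = (*)" "add F = (+)" "zero F = 0" "one F = 1"
  by (simp_all add: free_algebra_def)

lemma F_carrier: "carrier F = {p. Poly_Mapping.keys p \<subseteq> lists (gens l)}"
  by (simp add: free_algebra_def)

lemma F_minus [simp]: "p \<in> carrier F \<Longrightarrow> \<ominus>\<^bsub>F\<^esub> p = - p"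
  by (rule F.minus_equality) (auto simp: F_carrier)

lemma F_uminus_closed: "p \<in> carrier F \<Longrightarrow> - p \<in> carrier F"
  by (simp add: F_carrier)

lemma F_closed [simp]: "p \<in> carrier F \<Longrightarrow> q \<in> carrier F \<Longrightarrow> p + q \<in> carrier F"
  "p \<in> carrier F \<Longrightarrow> q \<in> carrier F \<Longrightarrow> p * q \<in> carrier F"
  "1 \<in> carrier F" "0 \<in> carrier F"
  using F.add.m_closed[of p q] F.m_closed[of p q] F.one_closed F.zero_closed by simp_all

lemma F_diff_closed [simp]: "p \<in> carrier F \<Longrightarrow> q \<in> carrier F \<Longrightarrow> p - q \<in> carrier F"
  using F_closed(1)[of p "- q"] F_uminus_closed by simp

lemma F_power [simp]: "p \<in> carrier F \<Longrightarrow> p ^ n \<in> carrier F"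
  by (induction n) auto

lemma monomial_carrier: "u \<in> lists (gens l) \<Longrightarrow> monomial u \<in> carrier F"
  by (simp add: F_carrier monomial_def)

lemma scalar_carrier [simp]: "scalar c \<in> carrier F"
  by (simp add: F_carrier scalar_def)

lemma pscale_carrier [simp]: "p \<in> carrier F \<Longrightarrow> pscale c p \<in> carrier F"
  using F_closed(2)[of "scalar c" p] by (simp add: scalar_mult)

lemma SG_word_carrier: "u \<in> lists {0, 1} \<Longrightarrow> monomial (map SG u) \<in> carrier F"
  by (intro monomial_carrier) (auto simp: gens_def)

lemma s_carrier [simp]: "monomial [SG 0] \<in> carrier F" "monomial [SG (Suc 0)] \<in> carrier F"
  by (auto intro!: monomial_carrier) (auto simp: gens_def)

lemma e_carrier [simp]: "i < 2 * l \<Longrightarrow> monomial [EG i] \<in> carrier F"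
  by (auto intro!: monomial_carrier) (auto simp: gens_def)

lemma grp_carrier [simp]:
  assumes "w \<in> D" shows "grp l w \<in> carrier F"
proof -
  obtain u where "u \<in> lists {0, 1}" "eval_word l u = w" "grp l w = monomial (map SG u)"
    using grp_word[OF assms] .
  then show ?thesis
    using SG_word_carrier by simp
qed

lemma relations_carrier: "Rels \<subseteq> carrier F"
proof -
  have "grp l (inv\<^bsub>plane_group\<^esub> w) \<in> carrier F" if "w \<in> D" for w
    using that by (auto simp: inv_plane_group elim!: D_cases)
  moreover have "mid i j < 2 * l" if "i < 2 * l" "j < 2 * l" for i j
    using that by (auto simp: mid_def)
  ultimately show ?thesis
    unfolding relations_def Let_def reflection_eq dihedral_eq
    by (auto intro!: F_diff_closed F_closed F_power)
qed

definition Ann :: "(gen list \<Rightarrow>\<^sub>0 complex) set" where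
  "Ann = {p \<in> carrier F. \<forall>v\<in>V. act p v = 0}"

text \<open>Annihilating all of \<open>V\<close>, and not just the vector of \<open>1\<close>, makes
  the ideal two-sided: \<open>act q v\<close> lies in \<open>V\<close> again.\<close>

lemma Ann_ideal: "ideal Ann F"
proof (rule idealI)
  show "ring F" by (rule F.ring_axioms)
  show "subgroup Ann (add_monoid F)"
  proof (rule subgroup.intro)
    show "inv\<^bsub>add_monoid F\<^esub> p \<in> Ann" if "p \<in> Ann" for p
    proof -
      have "inv\<^bsub>add_monoid F\<^esub> p = - p"
        using F_minus[of p] that by (simp add: Ann_def a_inv_def)
      then show ?thesis
        using that by (simp add: Ann_def act_uminus F_uminus_closed)
    qed
  qed (auto simp: Ann_def act_add)
qed (auto simp: Ann_def act_mult act_V)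

lemma act_power: "act (p ^ n) v = (act p ^^ n) v"
  by (induction n) (auto simp: act_mult)

lemma mid_int: "even (i + j) \<Longrightarrow> int (mid i j) = (int i + int j) div 2"
  by (auto simp: mid_def)

lemma mid'_int: "even (i + j) \<Longrightarrow> int (mid' l i j) = ((int i + int j) div 2 + int l) mod m"
  using mid_int[of i j] by (auto simp: mid'_def zmod_int m_def)

lemma by_parity_int: "by_parity \<mu>0 \<mu>1 i = \<mu> (int i)" "by_parity \<tau>0 \<tau>1 i = \<tau> (int i)"
  by (auto simp: by_parity_def \<mu>_def \<tau>_def)

lemma mu_mod: "\<mu> (a mod m) = \<mu> a"
  by (auto simp: \<mu>_def even_m dvd_mod_iff)

lemma relations_Ann: "Rels \<subseteq> Ann"
proof
  fix p assume p: "p \<in> Rels"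
  have "act p v = 0" if v: "v \<in> V" for v
  proof -
    \<comment> \<open>\<open>s_0 s_1\<close> is the inverse of \<open>r\<close>.\<close>
    have s0s1: "((Sop 0 \<circ> Sop 1) ^^ n) v = Rop (- int n) v" for n
      using v by (induction n) (auto simp: Rop_0 Sop_Sop Sop_Rop op_V)
    have inj: "i mod m \<noteq> j mod m" if "i = int a" "j = int b" "a \<noteq> b" "a < 2 * l" "b < 2 * l" for i j a b
      using that by (simp add: m_def)
    from p consider
        (1) "p = monomial [SG 0] * monomial [SG 0] - 1 \<or> p = monomial [SG 1] * monomial [SG 1] - 1"
      | (2) "p = (monomial [SG 0] * monomial [SG 1]) ^ (2 * l) - 1"
      | (3) i where "p = grp l (rfl (int i)) * monomial [EG i] - monomial [EG i]"
      | (4) i where "p = monomial [EG i] * grp l (rfl (int i)) - monomial [EG i]"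
      | (5) w i j where "p = grp l w * monomial [EG i] * grp l (inv\<^bsub>plane_group\<^esub> w) - monomial [EG j]"
         "w \<in> D" "w \<otimes>\<^bsub>plane_group\<^esub> rfl (int i) \<otimes>\<^bsub>plane_group\<^esub> inv\<^bsub>plane_group\<^esub> w = rfl (int j)"
      | (6) i where "p = monomial [EG i] * monomial [EG i] - scalar (\<tau> (int i)) * monomial [EG i]"
      | (7) i j where "p = monomial [EG i] * monomial [EG j]" "odd (i + j)"
      | (8) i j where "p = monomial [EG i] * monomial [EG j]
            - (scalar (\<mu> (int (mid i j))) * grp l (rfl (int (mid i j)))
               + scalar (\<mu> (int (mid' l i j))) * grp l (rfl (int (mid' l i j)))) * monomial [EG j]"
         "i < 2 * l" "j < 2 * l" "i \<noteq> j" "even (i + j)"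
      unfolding relations_def Let_def reflection_eq dihedral_eq by_parity_int
      by (elim UnE insertE CollectE exE conjE emptyE) metis+
    then show ?thesis
    proof cases
      case 1
      then show ?thesis
        using v by (auto simp: act_diff act_mult Sop_Sop Rop_0)
    next
      case 2
      have "act ((monomial [SG 0] * monomial [SG 1]) ^ (2 * l)) v = ((Sop 0 \<circ> Sop 1) ^^ (2 * l)) v"
        unfolding act_power by (rule arg_cong[where f = "\<lambda>f. (f ^^ (2 * l)) v"]) (auto simp: act_mult)
      also have "\<dots> = v"
        unfolding s0s1 using v Rop_period[of v "- int (2 * l)" 0]
        by (simp add: Rop_0 m_def)
      finally show ?thesis
        by (simp add: 2 act_diff)
    next
      case 3
      then show ?thesis
        using v by (simp add: act_diff act_mult act_grp op_V Sop_Eop_self)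
    next
      case 4
      then show ?thesis
        using v by (simp add: act_diff act_mult act_grp op_V Eop_Sop_self)
    next
      case (5 w i j)
      from 5(2) show ?thesis
      proof (elim D_cases)
        fix k assume w: "w = rot k"
        from 5(3) have "rfl (int i + 2 * k) = rfl (int j)"
          by (simp add: w inv_plane_group mult_plane_group rot_rfl rfl_rot algebra_simps)
        then have "Eop (int i + 2 * k) v = Eop (int j) v"
          using v by (intro Eop_period) (auto simp: rfl_eq_iff)
        then show ?thesis
          using v by (simp add: 5(1) w act_diff act_mult act_grp op_V inv_plane_group
              Rop_Eop Rop_Rop Rop_0)
      next
        fix k assume w: "w = rfl k"
        from 5(3) have "rfl (2 * k - int i) = rfl (int j)"
          by (simp add: w inv_plane_group mult_plane_group rfl_rfl rot_rfl algebra_simps)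
        then have "Eop (2 * k - int i) v = Eop (int j) v"
          using v by (intro Eop_period) (auto simp: rfl_eq_iff)
        then show ?thesis
          using v by (simp add: 5(1) w act_diff act_mult act_grp op_V inv_plane_group
              Eop_conj Sop_Sop Rop_0)
      qed
    next
      case 6
      then show ?thesis
        using v by (simp add: act_diff act_mult Eop_Eop_self)
    next
      case (7 i j)
      then show ?thesis
        using v Eop_Eop_odd[OF v, of "int i" "int j"] by (simp add: act_mult flip: of_nat_add)
    next
      case (8 i j)
      let ?a = "(int i + int j) div 2 + int l"
      have "even (int i + int j)" using 8(5) by presburger
      moreover have "int i mod m \<noteq> int j mod m"
        using inj 8(2-4) by blast
      ultimately have "Eop (int i) (Eop (int j) v)
        = pscale (\<mu> ((int i + int j) div 2)) (Sop ((int i + int j) div 2) (Eop (int j) v))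
          + pscale (\<mu> ?a) (Sop ?a (Eop (int j) v))"
        using v by (rule_tac Eop_Eop_even)
      \<comment> \<open>\<open>mid'\<close> is reduced modulo \<open>m\<close>, while the index in
        \<open>Eop_Eop_even\<close> is not.\<close>
      moreover have "Sop (?a mod m) (Eop (int j) v) = Sop ?a (Eop (int j) v)"
        using v by (intro Sop_period) (auto simp: op_V)
      ultimately show ?thesis
        using v by (simp add: 8(1) act_diff act_mult act_add act_grp op_V mid_int[OF 8(5)]
            mid'_int[OF 8(5)] mu_mod)
    qed
  qed
  then show "p \<in> Ann"
    using p relations_carrier by (auto simp: Ann_def)
qed

sublocale N: ideal N F
  unfolding rel_ideal_def by (rule F.genideal_ideal[OF relations_carrier])

lemma N_Ann: "N \<subseteq> Ann"
  unfolding rel_ideal_def by (rule F.genideal_minimal[OF Ann_ideal relations_Ann])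


section \<open>Normal forms modulo the relations\<close>

text \<open>Membership in the carrier is built in, so that congruences can be multiplied and chained
  without side conditions.\<close>

definition cg :: "(gen list \<Rightarrow>\<^sub>0 complex) \<Rightarrow> (gen list \<Rightarrow>\<^sub>0 complex) \<Rightarrow> bool" (infix "\<sim>" 50) where
  "p \<sim> q \<longleftrightarrow> p \<in> carrier F \<and> q \<in> carrier F \<and> p - q \<in> N"

lemma N_carrier: "p \<in> N \<Longrightarrow> p \<in> carrier F"
  using N.a_subset by blast

lemma N_closed: "p \<in> N \<Longrightarrow> q \<in> N \<Longrightarrow> p + q \<in> N" "0 \<in> N"
  "p \<in> carrier F \<Longrightarrow> q \<in> N \<Longrightarrow> p * q \<in> N" "p \<in> N \<Longrightarrow> q \<in> carrier F \<Longrightarrow> p * q \<in> N"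
  using N.a_closed[of p q] N.zero_closed N.I_l_closed[of q p] N.I_r_closed[of p q] by auto

lemma N_uminus: "p \<in> N \<Longrightarrow> - p \<in> N"
  using N.a_inv_closed[of p] F_minus[of p] N_carrier[of p] by simp

lemma N_diff: "p \<in> N \<Longrightarrow> q \<in> N \<Longrightarrow> p - q \<in> N"
  using N_closed(1)[of p "- q"] N_uminus[of q] by simp

lemma cg_refl [simp]: "p \<in> carrier F \<Longrightarrow> p \<sim> p"
  using N_closed by (simp add: cg_def)

lemma cg_sym: "p \<sim> q \<Longrightarrow> q \<sim> p"
  using N_uminus[of "p - q"] by (simp add: cg_def)

lemma cg_trans [trans]: "p \<sim> q \<Longrightarrow> q \<sim> r \<Longrightarrow> p \<sim> r"
  using N_closed(1)[of "p - q" "q - r"] by (simp add: cg_def)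

lemma cg_add: "p \<sim> p' \<Longrightarrow> q \<sim> q' \<Longrightarrow> p + q \<sim> p' + q'"
  using N_closed(1)[of "p - p'" "q - q'"] by (simp add: cg_def algebra_simps)

lemma cg_mult: "p \<sim> p' \<Longrightarrow> q \<sim> q' \<Longrightarrow> p * q \<sim> p' * q'"
  using N_closed(1)[of "(p - p') * q" "p' * (q - q')"] N_closed(3)[of p' "q - q'"]
    N_closed(4)[of "p - p'" q]
  by (simp add: cg_def algebra_simps)

lemma cg_pscale: "p \<sim> q \<Longrightarrow> pscale c p \<sim> pscale c q"
  using cg_mult[of "scalar c" "scalar c" p q] by (simp add: scalar_mult)

lemma cg_sum: "(\<And>x. x \<in> A \<Longrightarrow> f x \<sim> g x) \<Longrightarrow> sum f A \<sim> sum g A"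
  by (induction A rule: infinite_finite_induct) (auto intro: cg_add)

lemma cg_lin: "(\<And>b. b \<in> Poly_Mapping.keys v \<Longrightarrow> f b \<sim> g b) \<Longrightarrow> lin f v \<sim> lin g v"
  unfolding lin_def by (intro cg_sum cg_pscale)

lemma cg_in_N: "p \<sim> q \<Longrightarrow> p \<in> N \<longleftrightarrow> q \<in> N"
  using N_closed(1)[of "p - q" q] N_diff[of p "p - q"] by (auto simp: cg_def)

lemma cg_rel: "p - q \<in> Rels \<Longrightarrow> p \<in> carrier F \<Longrightarrow> q \<in> carrier F \<Longrightarrow> p \<sim> q"
  using F.genideal_self[OF relations_carrier] by (auto simp: cg_def rel_ideal_def)

section \<open>Words in the two reflections modulo the relations\<close>

definition s0 where "s0 = monomial [SG 0]"
definition s1 where "s1 = monomial [SG 1]"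
text \<open>Reducing the exponent admits all integers and turns equality of indices modulo
  \<open>m\<close> into equality of elements. The exponent law \<open>rp_rp\<close> is then only a
  congruence.\<close>

definition rp :: "int \<Rightarrow> gen list \<Rightarrow>\<^sub>0 complex" where "rp k = (s1 * s0) ^ nat (k mod m)"
definition ep :: "int \<Rightarrow> gen list \<Rightarrow>\<^sub>0 complex" where "ep j = monomial [EG (nat (j mod m))]"

lemma s_in [simp]: "s0 \<in> carrier F" "s1 \<in> carrier F"
  by (simp_all add: s0_def s1_def)

lemma nat_mod_less [simp]: "nat (j mod m) < 2 * l"
  using m_pos pos_mod_bound[of m j] pos_mod_sign[of m j] by (auto simp: m_def nat_less_iff)

lemma rp_in [simp]: "rp k \<in> carrier F" and ep_in [simp]: "ep j \<in> carrier F"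
  by (simp_all add: rp_def ep_def)

lemma rp_mod [simp]: "rp (k mod m) = rp k" and ep_mod [simp]: "ep (j mod m) = ep j"
  by (simp_all add: rp_def ep_def)

lemma rp_0 [simp]: "rp 0 = 1"
  by (simp add: rp_def)

lemma rp_1: "rp 1 = s1 * s0"
  using m_ge2 by (simp add: rp_def)

lemma rel_s: "s0 * s0 \<sim> 1" "s1 * s1 \<sim> 1" "(s0 * s1) ^ (2 * l) \<sim> 1"
  by (rule cg_rel; simp add: relations_def Let_def s0_def s1_def)+

lemma cg_mult_left: "p \<in> carrier F \<Longrightarrow> q \<sim> q' \<Longrightarrow> p * q \<sim> p * q'"
  and cg_mult_right: "q \<in> carrier F \<Longrightarrow> p \<sim> p' \<Longrightarrow> p * q \<sim> p' * q"
  by (auto intro: cg_mult)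

lemma rs_inverse: "(s1 * s0) * (s0 * s1) \<sim> 1" "(s0 * s1) * (s1 * s0) \<sim> 1"
proof -
  have "s1 * (s0 * s0) * s1 \<sim> s1 * 1 * s1"
    by (intro cg_mult rel_s cg_refl s_in)
  then show "(s1 * s0) * (s0 * s1) \<sim> 1"
    using cg_trans rel_s(2) by (simp add: mult.assoc)
  have "s0 * (s1 * s1) * s0 \<sim> s0 * 1 * s0"
    by (intro cg_mult rel_s cg_refl s_in)
  then show "(s0 * s1) * (s1 * s0) \<sim> 1"
    using cg_trans rel_s(1) by (simp add: mult.assoc)
qed

text \<open>The defining relation concerns \<open>s_0 s_1\<close>. It passes to
  \<open>r = s_1 s_0\<close>, whose powers are inverse to those of \<open>s_0 s_1\<close>.\<close>

lemma r_power_m: "(s1 * s0) ^ (2 * l) \<sim> 1"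
proof -
  have *: "(s1 * s0) ^ n * (s0 * s1) ^ n \<sim> 1" for n
  proof (induction n)
    case (Suc n)
    have "(s1 * s0) ^ Suc n * (s0 * s1) ^ Suc n
        = (s1 * s0) ^ n * ((s1 * s0) * (s0 * s1)) * (s0 * s1) ^ n"
      by (simp only: power_Suc2[of "s1 * s0"] power_Suc[of "s0 * s1"] mult.assoc)
    also have "\<dots> \<sim> (s1 * s0) ^ n * 1 * (s0 * s1) ^ n"
      by (intro cg_mult rs_inverse cg_refl) auto
    also have "\<dots> = (s1 * s0) ^ n * (s0 * s1) ^ n"
      by simp
    also have "\<dots> \<sim> 1"
      by (rule Suc)
    finally show ?case .
  qed simp
  have "(s1 * s0) ^ (2 * l) * 1 \<sim> (s1 * s0) ^ (2 * l) * (s0 * s1) ^ (2 * l)"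
    by (intro cg_mult cg_sym[OF rel_s(3)] cg_refl) auto
  then show ?thesis
    using cg_trans * by simp
qed

lemma r_rp: "(s1 * s0) * rp k \<sim> rp (k + 1)"
\<comment> \<open>Only at the last residue does the exponent wrap around, and there
  \<open>r_power_m\<close> is needed.\<close>
proof (cases "k mod m = m - 1")
  case True
  then have "(k + 1) mod m = 0"
    by (metis diff_add_cancel mod_add_left_eq mod_self)
  then have "rp (k + 1) = 1"
    by (simp add: rp_def)
  moreover have "(s1 * s0) * rp k = (s1 * s0) ^ Suc (nat (k mod m))"
    by (simp add: rp_def)
  moreover have "Suc (nat (k mod m)) = 2 * l"
    using l_pos unfolding True by (simp add: m_def)
  ultimately show ?thesis
    using r_power_m by simp
next
  case False
  have b: "0 \<le> k mod m" "k mod m < m"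
    using m_pos by auto
  then have "(k mod m + 1) mod m = k mod m + 1"
    using False by (intro mod_pos_pos_trivial) auto
  then have "(k + 1) mod m = k mod m + 1"
    by (simp add: mod_simps)
  then show ?thesis
    using b by (simp add: rp_def nat_add_distrib)
qed

lemma rp_rp: "rp a * rp b \<sim> rp (a + b)"
proof -
  have *: "(s1 * s0) ^ n * rp b \<sim> rp (int n + b)" for n
  proof (induction n)
    case (Suc n)
    have "(s1 * s0) ^ Suc n * rp b = (s1 * s0) * ((s1 * s0) ^ n * rp b)"
      by (simp add: mult.assoc)
    also have "\<dots> \<sim> (s1 * s0) * rp (int n + b)"
      by (intro cg_mult Suc cg_refl) auto
    also have "\<dots> \<sim> rp (int (Suc n) + b)"
      using r_rp[of "int n + b"] by (simp add: algebra_simps)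
    finally show ?case .
  qed simp
  have "rp (int (nat (a mod m)) + b) = rp ((a mod m + b) mod m)"
    using m_pos by simp
  also have "\<dots> = rp (a + b)"
    by (simp add: mod_simps)
  finally show ?thesis
    using *[of "nat (a mod m)"] by (simp add: rp_def[of a])
qed

text \<open>Conjugation by \<open>s_0\<close> inverts \<open>r\<close>. In the induction step
  \<open>s_0 (s_1 s_0)^(n+1)\<close> is re-bracketed so that \<open>s_0 s_1\<close>, acting as
  \<open>r^(-1)\<close>, comes first.\<close>

lemma s0_rp: "s0 * rp k \<sim> rp (- k) * s0"
proof -
  have q: "(s0 * s1) * rp k \<sim> rp (k - 1)" for k
  proof -
    have "(s0 * s1) * rp k \<sim> (s0 * s1) * ((s1 * s0) * rp (k - 1))"
      using cg_sym[OF r_rp[of "k - 1"]] by (intro cg_mult cg_refl) auto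
    also have "\<dots> = ((s0 * s1) * (s1 * s0)) * rp (k - 1)"
      by (simp add: mult.assoc)
    also have "\<dots> \<sim> 1 * rp (k - 1)"
      by (intro cg_mult rs_inverse cg_refl) auto
    finally show ?thesis by simp
  qed
  have *: "s0 * (s1 * s0) ^ n \<sim> rp (- int n) * s0" for n
  proof (induction n)
    case (Suc n)
    have "s0 * (s1 * s0) ^ Suc n = (s0 * s1) * (s0 * (s1 * s0) ^ n)"
      by (simp add: mult.assoc)
    also have "\<dots> \<sim> (s0 * s1) * (rp (- int n) * s0)"
      by (intro cg_mult Suc cg_refl) auto
    also have "\<dots> = ((s0 * s1) * rp (- int n)) * s0"
      by (simp add: mult.assoc)
    also have "\<dots> \<sim> rp (- int n - 1) * s0"
      by (rule cg_mult_right[OF s_in(1) q])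
    also have "- int n - 1 = - int (Suc n)"
      by simp
    finally show ?case .
  qed simp
  have "rp (- int (nat (k mod m))) = rp ((- (k mod m)) mod m)"
    using m_pos by simp
  also have "\<dots> = rp (- k)"
    by (metis mod_minus_eq rp_mod)
  finally show ?thesis
    using *[of "nat (k mod m)"] by (simp add: rp_def[of k])
qed

lemma s1_eq: "s1 \<sim> rp 1 * s0"
proof -
  have "s1 * 1 \<sim> s1 * (s0 * s0)"
    by (intro cg_mult cg_sym[OF rel_s(1)] cg_refl) auto
  then show ?thesis
    by (simp add: rp_1 mult.assoc)
qed

lemma s0_s0_cancel: "p \<in> carrier F \<Longrightarrow> p * s0 * s0 \<sim> p"
  using cg_mult_left[OF _ rel_s(1), of p] by (simp add: mult.assoc)

lemma s_rp:
  "a < 2 \<Longrightarrow> monomial [SG a] * rp k \<sim> rp (int a - k) * s0"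
  "a < 2 \<Longrightarrow> monomial [SG a] * (rp k * s0) \<sim> rp (int a - k)"
proof -
  show 1: "monomial [SG a] * rp k \<sim> rp (int a - k) * s0" if "a < 2" for k
  proof (cases "a = 0")
    case True
    then show ?thesis using s0_rp[of k] by (simp add: s0_def)
  next
    case False
    with that have a: "a = 1" by simp
    have "s1 * rp k \<sim> (rp 1 * s0) * rp k"
      by (intro cg_mult s1_eq cg_refl) auto
    also have "\<dots> = rp 1 * (s0 * rp k)"
      by (simp add: mult.assoc)
    also have "\<dots> \<sim> rp 1 * (rp (- k) * s0)"
      by (intro cg_mult s0_rp cg_refl) auto
    also have "\<dots> = (rp 1 * rp (- k)) * s0"
      by (simp add: mult.assoc)
    also have "\<dots> \<sim> rp (1 - k) * s0"
      using rp_rp[of 1 "- k"] by (intro cg_mult cg_refl) auto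
    finally show ?thesis
      by (simp add: a s1_def)
  qed
  show "monomial [SG a] * (rp k * s0) \<sim> rp (int a - k)" if "a < 2"
  proof -
    have "monomial [SG a] * (rp k * s0) = (monomial [SG a] * rp k) * s0"
      by (simp add: mult.assoc)
    also have "\<dots> \<sim> (rp (int a - k) * s0) * s0"
      by (rule cg_mult_right[OF s_in(1) 1[OF that]])
    also have "\<dots> \<sim> rp (int a - k)"
      by (rule s0_s0_cancel) simp
    finally show ?thesis .
  qed
qed

lemma monomial_Cons: "monomial (g # u) = monomial [g] * monomial u"
  by (simp add: monomial_def mult_single plus_list_def)

lemma monomial_Nil: "monomial [] = 1"
  by (simp add: monomial_def flip: zero_list_def)

text \<open>The content is that the first three relations present the dihedral group: the shared
  \<open>k\<close> shows that words with equal value are congruent, so the choice of word in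
  \<open>grp\<close> is harmless.\<close>

lemma word_normal_form:
  assumes "u \<in> lists {0, 1}"
  shows "(\<exists>k. eval_word l u = rot k \<and> monomial (map SG u) \<sim> rp k) \<or>
    (\<exists>k. eval_word l u = rfl k \<and> monomial (map SG u) \<sim> rp k * s0)"
  using assms
proof (induction u)
  case Nil
  have "eval_word l [] = rot 0" "monomial (map SG []) \<sim> rp 0"
    by (simp_all add: eval_word_Nil monomial_Nil)
  then show ?case by blast
next
  case (Cons a u)
  then have a: "a < 2" "monomial [SG a] \<in> carrier F" by auto
  from Cons.IH show ?case
  proof (elim disjE exE conjE)
    fix k assume k: "eval_word l u = rot k" "monomial (map SG u) \<sim> rp k"
    have "monomial (map SG (a # u)) \<sim> rp (int a - k) * s0"
      using cg_trans[OF cg_mult_left[OF a(2) k(2)] s_rp(1)[OF a(1)]]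
      by (simp flip: monomial_Cons)
    moreover have "eval_word l (a # u) = rfl (int a - k)"
      by (simp only: eval_word_Cons k(1) rfl_rot)
    ultimately show ?thesis by blast
  next
    fix k assume k: "eval_word l u = rfl k" "monomial (map SG u) \<sim> rp k * s0"
    have "monomial (map SG (a # u)) \<sim> rp (int a - k)"
      using cg_trans[OF cg_mult_left[OF a(2) k(2)] s_rp(2)[OF a(1)]]
      by (simp flip: monomial_Cons)
    moreover have "eval_word l (a # u) = rot (int a - k)"
      by (simp only: eval_word_Cons k(1) rfl_rfl)
    ultimately show ?thesis by blast
  qed
qed

lemma rp_cong: "a mod m = b mod m \<Longrightarrow> rp a = rp b"
  by (simp add: rp_def)

lemma grp_rot: "grp l (rot k) \<sim> rp k"
proof -
  obtain u where u: "u \<in> lists {0, 1}" "eval_word l u = rot k" "grp l (rot k) = monomial (map SG u)"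
    using grp_word[OF rot_D(1)] .
  then obtain k' where k': "rot k = rot k'" "monomial (map SG u) \<sim> rp k'"
    using word_normal_form[OF u(1)] by auto
  then have "rp k' = rp k"
    by (intro rp_cong) (simp add: rot_eq_iff)
  then show ?thesis
    using k' u by simp
qed

lemma grp_rfl: "grp l (rfl k) \<sim> rp k * s0"
proof -
  obtain u where u: "u \<in> lists {0, 1}" "eval_word l u = rfl k" "grp l (rfl k) = monomial (map SG u)"
    using grp_word[OF rot_D(2)] .
  then obtain k' where k': "rfl k = rfl k'" "monomial (map SG u) \<sim> rp k' * s0"
    using word_normal_form[OF u(1)] by auto
  then have "rp k' = rp k"
    by (intro rp_cong) (simp add: rfl_eq_iff)
  then show ?thesis
    using k' u by simp
qed

section \<open>Moving group elements to the left of the \<open>e_j\<close>\<close>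

lemma rel_members:
  "i < 2 * l \<Longrightarrow> grp l (rfl (int i)) * monomial [EG i] - monomial [EG i] \<in> Rels"
  "w \<in> D \<Longrightarrow> i < 2 * l \<Longrightarrow> j < 2 * l \<Longrightarrow>
    w \<otimes>\<^bsub>plane_group\<^esub> rfl (int i) \<otimes>\<^bsub>plane_group\<^esub> inv\<^bsub>plane_group\<^esub> w = rfl (int j) \<Longrightarrow>
    grp l w * monomial [EG i] * grp l (inv\<^bsub>plane_group\<^esub> w) - monomial [EG j] \<in> Rels"
  "i < 2 * l \<Longrightarrow>
    monomial [EG i] * monomial [EG i] - scalar (\<tau> (int i)) * monomial [EG i] \<in> Rels"
  "i < 2 * l \<Longrightarrow> j < 2 * l \<Longrightarrow> odd (i + j) \<Longrightarrow> monomial [EG i] * monomial [EG j] \<in> Rels"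
  "i < 2 * l \<Longrightarrow> j < 2 * l \<Longrightarrow> i \<noteq> j \<Longrightarrow> even (i + j) \<Longrightarrow> monomial [EG i] * monomial [EG j]
      - (scalar (\<mu> (int (mid i j))) * grp l (rfl (int (mid i j)))
         + scalar (\<mu> (int (mid' l i j))) * grp l (rfl (int (mid' l i j)))) * monomial [EG j] \<in> Rels"
  unfolding relations_def Let_def reflection_eq dihedral_eq by_parity_int by blast+

text \<open>The relation \<open>s_j e_j = e_j\<close> reads \<open>r^j s_0 e_j = e_j\<close>;
  multiply by \<open>r^(-j)\<close>.\<close>

lemma s0_ep: "s0 * ep j \<sim> rp (- j) * ep j"
proof -
  have "rfl (int (nat (j mod m))) = rfl j"
    using m_pos by (simp add: rfl_eq_iff)
  then have "grp l (rfl j) * ep j \<sim> ep j"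
    using cg_rel[OF rel_members(1)[of "nat (j mod m)"]] by (simp add: ep_def)
  from cg_trans[OF cg_mult_right[OF ep_in cg_sym[OF grp_rfl]] this]
  have *: "rp j * s0 * ep j \<sim> ep j" .
  have "s0 * ep j = rp 0 * (s0 * ep j)"
    by simp
  also have "\<dots> \<sim> (rp (- j) * rp j) * (s0 * ep j)"
    using cg_sym[OF rp_rp[of "- j" j]] by (intro cg_mult cg_refl) auto
  also have "\<dots> = rp (- j) * (rp j * s0 * ep j)"
    by (simp add: mult.assoc)
  also have "\<dots> \<sim> rp (- j) * ep j"
    by (intro cg_mult * cg_refl) auto
  finally show ?thesis .
qed

text \<open>The conjugation relation for \<open>r^k\<close>, which carries the mirror with index
  \<open>i - 2k\<close> to the one with index \<open>i\<close>.\<close>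

lemma ep_rp: "ep i * rp k \<sim> rp k * ep (i - 2 * k)"
proof -
  let ?i = "nat ((i - 2 * k) mod m)" and ?j = "nat (i mod m)"
  have ij: "int ?i = (i - 2 * k) mod m" "int ?j = i mod m"
    using m_pos by auto
  have e: "rfl (k + int ?i + k) = rfl (int ?j)"
    unfolding rfl_eq_iff ij using mod_add_right_eq[of "2 * k" "i - 2 * k" m]
    by (simp add: algebra_simps)
  have "rot k \<otimes>\<^bsub>plane_group\<^esub> rfl (int ?i) \<otimes>\<^bsub>plane_group\<^esub> inv\<^bsub>plane_group\<^esub> rot k = rfl (int ?j)"
    using e by (simp only: inv_plane_group mult_plane_group rot_D rot_rfl rfl_rot)
      (simp only: diff_minus_eq_add)
  then have 1: "grp l (rot k) * ep (i - 2 * k) * grp l (rot (- k)) \<sim> ep i"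
    using cg_rel[OF rel_members(2)[of "rot k" ?i ?j]]
    by (simp add: ep_def inv_plane_group)
  have 2: "rp k * ep (i - 2 * k) * rp (- k) \<sim> ep i"
    by (rule cg_trans[OF cg_mult[OF cg_mult[OF cg_sym[OF grp_rot] cg_refl] cg_sym[OF grp_rot]] 1]) simp
  have "ep i * rp k \<sim> (rp k * ep (i - 2 * k) * rp (- k)) * rp k"
    by (intro cg_mult_right cg_sym[OF 2]) simp
  also have "\<dots> = rp k * ep (i - 2 * k) * (rp (- k) * rp k)"
    by (simp add: mult.assoc)
  also have "\<dots> \<sim> rp k * ep (i - 2 * k) * rp 0"
    using rp_rp[of "- k" k] by (intro cg_mult cg_refl) auto
  finally show ?thesis by simp
qed

lemma ep_s0: "ep i * s0 \<sim> s0 * ep (- i)"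
proof -
  let ?i = "nat ((- i) mod m)" and ?j = "nat (i mod m)"
  have ij: "int ?i = (- i) mod m" "int ?j = i mod m"
    using m_pos by auto
  have e: "rfl (0 - int ?i) = rfl (int ?j)"
    unfolding rfl_eq_iff ij using mod_minus_eq[of "- i" m] by simp
  have "rfl 0 \<otimes>\<^bsub>plane_group\<^esub> rfl (int ?i) \<otimes>\<^bsub>plane_group\<^esub> inv\<^bsub>plane_group\<^esub> rfl 0 = rfl (int ?j)"
    using e by (simp only: inv_plane_group mult_plane_group rot_D rfl_rfl rot_rfl) simp
  then have 1: "grp l (rfl 0) * ep (- i) * grp l (rfl 0) \<sim> ep i"
    using cg_rel[OF rel_members(2)[of "rfl 0" ?i ?j]]
    by (simp add: ep_def inv_plane_group)
  have g: "grp l (rfl 0) \<sim> s0"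
    using grp_rfl[of 0] by simp
  have 2: "s0 * ep (- i) * s0 \<sim> ep i"
    by (rule cg_trans[OF cg_mult[OF cg_mult[OF cg_sym[OF g] cg_refl] cg_sym[OF g]] 1]) simp
  have "ep i * s0 \<sim> (s0 * ep (- i) * s0) * s0"
    by (intro cg_mult_right cg_sym[OF 2]) simp
  also have "\<dots> \<sim> s0 * ep (- i)"
    by (rule s0_s0_cancel) simp
  finally show ?thesis .
qed

section \<open>Left multiplication on normal forms\<close>

definition repr :: "bas \<Rightarrow> gen list \<Rightarrow>\<^sub>0 complex" where
  "repr b = (case b of Rot k \<Rightarrow> rp k | Ref k \<Rightarrow> rp k * s0 | Ed k j \<Rightarrow> rp k * ep j)"

lemma repr_simps [simp]: "repr (R k) = rp k" "repr (S k) = rp k * s0" "repr (E k j) = rp k * ep j"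
  by (simp_all add: repr_def R_def S_def E_def)

lemma repr_in [simp]: "repr b \<in> carrier F"
  by (simp add: repr_def split: bas.split)

definition NF :: "(bas \<Rightarrow>\<^sub>0 complex) \<Rightarrow> gen list \<Rightarrow>\<^sub>0 complex" where "NF = lin repr"

lemma NF_delta [simp]: "NF (\<delta> b) = repr b"
  by (simp add: NF_def \<delta>_def)

lemma NF_add: "NF (v + w) = NF v + NF w" and NF_pscale: "NF (pscale c v) = pscale c (NF v)"
  and NF_zero [simp]: "NF 0 = 0"
  by (simp_all add: NF_def lin_add lin_pscale)

lemma NF_in [simp]: "NF v \<in> carrier F"
  unfolding NF_def F_carrier mem_Collect_eq
  by (rule keys_lin) (use repr_in in \<open>auto simp: F_carrier\<close>)

text \<open>Scalars are central, being supported on the empty word.\<close>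

lemma mult_pscale: "(p :: 'a list \<Rightarrow>\<^sub>0 complex) * pscale c q = pscale c (p * q)"
proof -
  have "p * scalar c = scalar c * p"
  proof (induction p rule: poly_mapping_additive_induct)
    case (2 a d)
    then show ?case by (simp add: scalar_def mult_single plus_list_def mult.commute)
  next
    case (3 p q)
    then show ?case by (simp add: algebra_simps)
  qed simp
  then show ?thesis
    by (metis mult.assoc scalar_mult)
qed

lemma mult_lin: "(p :: 'a list \<Rightarrow>\<^sub>0 complex) * lin f v = lin (\<lambda>b. p * f b) v"
  by (simp add: lin_def sum_distrib_left mult_pscale)

lemma mult_NF_cg:
  assumes "v \<in> V" "\<And>b. b \<in> Bas \<Longrightarrow> p * repr b \<sim> NF (T b)"
  shows "p * NF v \<sim> NF (lin T v)"
  unfolding NF_def mult_lin lin_lin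
  using assms by (intro cg_lin) (auto simp: V_def NF_def)

lemma rp_NF: assumes "v \<in> V" shows "rp a * NF v \<sim> NF (Rop a v)"
  unfolding Rop_def
proof (rule mult_NF_cg[OF assms])
  fix b assume "b \<in> Bas"
  then show "rp a * repr b \<sim> NF (\<delta> (ract a b))"
  proof (cases rule: Bas_cases)
    case (1 k)
    then show ?thesis using rp_rp[of a k] by (simp add: add.commute)
  next
    case (2 k)
    then show ?thesis
      using cg_mult_right[OF s_in(1) rp_rp[of a k]] by (simp add: add.commute mult.assoc)
  next
    case (3 k j)
    then show ?thesis
      using cg_mult_right[OF ep_in rp_rp[of a k], of j] by (simp add: add.commute mult.assoc)
  qed
qed

lemma s0_NF: assumes "v \<in> V" shows "s0 * NF v \<sim> NF (Sop 0 v)"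
  unfolding Sop_def
proof (rule mult_NF_cg[OF assms])
  fix b assume "b \<in> Bas"
  then show "s0 * repr b \<sim> NF (\<delta> (sact 0 b))"
  proof (cases rule: Bas_cases)
    case (1 k)
    then show ?thesis using s0_rp[of k] by simp
  next
    case (2 k)
    then show ?thesis
      using s_rp(2)[of 0 k] by (simp add: s0_def)
  next
    case (3 k j)
    have "s0 * (rp k * ep j) = s0 * rp k * ep j"
      by (simp add: mult.assoc)
    also have "\<dots> \<sim> rp (- k) * s0 * ep j"
      by (intro cg_mult s0_rp cg_refl) auto
    also have "\<dots> = rp (- k) * (s0 * ep j)"
      by (simp add: mult.assoc)
    also have "\<dots> \<sim> rp (- k) * (rp (- j) * ep j)"
      by (intro cg_mult s0_ep cg_refl) auto
    also have "\<dots> = rp (- k) * rp (- j) * ep j"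
      by (simp add: mult.assoc)
    also have "\<dots> \<sim> rp (- k - j) * ep j"
      using rp_rp[of "- k" "- j"] by (intro cg_mult cg_refl) auto
    finally show ?thesis
      using 3 by simp
  qed
qed

lemma s1_NF: assumes "v \<in> V" shows "s1 * NF v \<sim> NF (Sop 1 v)"
proof -
  have "s1 * NF v \<sim> rp 1 * s0 * NF v"
    by (intro cg_mult s1_eq cg_refl) auto
  also have "\<dots> = rp 1 * (s0 * NF v)"
    by (simp add: mult.assoc)
  also have "\<dots> \<sim> rp 1 * NF (Sop 0 v)"
    using assms by (intro cg_mult s0_NF cg_refl) auto
  also have "\<dots> \<sim> NF (Rop 1 (Sop 0 v))"
    using assms by (intro rp_NF op_V)
  finally show ?thesis
    using assms by (simp add: Rop_Sop)
qed

text \<open>The case \<open>k = 0\<close> of \<open>ee\<close>. The relations speak of natural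
  indices below \<open>2 * l\<close>; they are applied to such representatives, and periodicity of
  \<open>ee\<close> does the rest.\<close>

lemma ep_ep: "ep x * ep j \<sim> NF (ee x 0 j)"
proof -
  have canonical: "ep (int x) * ep (int j) \<sim> NF (ee (int x) 0 (int j))" if xj: "x < 2 * l" "j < 2 * l" for x j
  proof -
    have ep_nat: "ep (int i) = monomial [EG i]" if "i < 2 * l" for i
      using that by (simp add: ep_def m_def)
    note ep_xj = ep_nat[OF xj(1)] ep_nat[OF xj(2)]
    show ?thesis
    proof (cases "odd (x + j)")
      case True
      then have "ee (int x) 0 (int j) = 0"
        by (simp add: ee_def)
      moreover have "monomial [EG x] * monomial [EG j] \<sim> 0"
        using rel_members(4)[OF xj True] xj by (intro cg_rel) auto
      ultimately show ?thesis
        by (simp add: ep_xj)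
    next
      case False
      show ?thesis
      proof (cases "x = j")
        case True
        have "monomial [EG j] * monomial [EG j] \<sim> scalar (\<tau> (int j)) * monomial [EG j]"
          using rel_members(3)[OF xj(2)] xj by (intro cg_rel) auto
        then show ?thesis
          using True by (simp add: ee_def scalar_mult NF_pscale ep_xj)
      next
        case ne: False
        let ?a = "(int x + int j) div 2"
        have "even (x + j)" using False by simp
        note mid = mid_int[OF this] mid'_int[OF this]
        have "mid x j < 2 * l" "mid' l x j < 2 * l"
          using xj l_pos by (auto simp: mid_def mid'_def)
        then have 1: "monomial [EG x] * monomial [EG j] \<sim>
           (scalar (\<mu> (int (mid x j))) * grp l (rfl (int (mid x j)))
           + scalar (\<mu> (int (mid' l x j))) * grp l (rfl (int (mid' l x j)))) * monomial [EG j]"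
          using rel_members(5)[OF xj ne \<open>even (x + j)\<close>] xj by (intro cg_rel) auto
        \<comment> \<open>\<open>s_c e_j = r^c s_0 e_j = r^(c-j) e_j\<close>.\<close>
        have g: "grp l (rfl c) * ep (int j) \<sim> rp (c - int j) * ep (int j)" for c
        proof -
          have "grp l (rfl c) * ep (int j) \<sim> (rp c * s0) * ep (int j)"
            by (intro cg_mult grp_rfl cg_refl) auto
          also have "\<dots> = rp c * (s0 * ep (int j))"
            by (simp add: mult.assoc)
          also have "\<dots> \<sim> rp c * (rp (- int j) * ep (int j))"
            by (intro cg_mult s0_ep cg_refl) auto
          also have "\<dots> = (rp c * rp (- int j)) * ep (int j)"
            by (simp add: mult.assoc)
          also have "\<dots> \<sim> rp (c - int j) * ep (int j)"
            using rp_rp[of c "- int j"] by (intro cg_mult cg_refl) auto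
          finally show ?thesis .
        qed
        have rfl_mod: "rfl (c mod m) = rfl c" for c
          by (simp add: rfl_eq_iff)
        note 1
        also have "(scalar (\<mu> (int (mid x j))) * grp l (rfl (int (mid x j)))
           + scalar (\<mu> (int (mid' l x j))) * grp l (rfl (int (mid' l x j)))) * monomial [EG j]
          = pscale (\<mu> ?a) (grp l (rfl ?a) * ep (int j))
            + pscale (\<mu> (?a + int l)) (grp l (rfl (?a + int l)) * ep (int j))"
          by (simp add: mid mu_mod rfl_mod ep_xj distrib_right mult.assoc flip: scalar_mult)
        also have "\<dots> \<sim> pscale (\<mu> ?a) (rp (?a - int j) * ep (int j))
            + pscale (\<mu> (?a + int l)) (rp (?a + int l - int j) * ep (int j))"
          by (intro cg_add cg_pscale g)
        finally have 2: "monomial [EG x] * monomial [EG j] \<sim> pscale (\<mu> ?a) (rp (?a - int j) * ep (int j))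
            + pscale (\<mu> (?a + int l)) (rp (?a + int l - int j) * ep (int j))"
          .
        have "even (int x - int j)"
          using \<open>even (x + j)\<close> by presburger
        then obtain t where t: "int x = int j + 2 * t"
          by (metis add.commute diff_add_cancel evenE)
        have 3: "?a - int j = (int x - int j) div 2" "?a + int l - int j = (int x - int j) div 2 + int l"
          unfolding t by auto
        have "\<not> m dvd int x - int j"
        proof
          assume "m dvd int x - int j"
          then have "int x mod m = int j mod m"
            by (simp add: mod_eq_dvd_iff)
          then show False
            using xj ne by (simp add: m_def)
        qed
        then have "NF (ee (int x) 0 (int j)) = pscale (\<mu> ?a) (rp (?a - int j) * ep (int j))
            + pscale (\<mu> (?a + int l)) (rp (?a + int l - int j) * ep (int j))"
          unfolding 3 using \<open>even (int x - int j)\<close> by (simp add: ee_def NF_add NF_pscale)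
        then show ?thesis
          using 2 by (simp add: ep_xj)
      qed
    qed
  qed
  have "ee (x mod m) 0 (j mod m) = ee x 0 j"
    using mod_if_periodic[of "\<lambda>x. ee x 0 (j mod m)" m x] mod_if_periodic[of "\<lambda>j. ee x 0 j" m j]
    by (simp add: ee_shift1 ee_shift3)
  then show ?thesis
    using canonical[of "nat (x mod m)" "nat (j mod m)"] m_pos by simp
qed

lemma ep_NF: assumes "v \<in> V" shows "ep i * NF v \<sim> NF (Eop i v)"
  unfolding Eop_def
proof (rule mult_NF_cg[OF assms])
  fix b assume "b \<in> Bas"
  then show "ep i * repr b \<sim> NF (eact i b)"
  proof (cases rule: Bas_cases)
    case (1 k)
    then show ?thesis using ep_rp[of i k] by simp
  next
    case (2 k)
    have "ep i * (rp k * s0) = ep i * rp k * s0"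
      by (simp add: mult.assoc)
    also have "\<dots> \<sim> rp k * ep (i - 2 * k) * s0"
      by (intro cg_mult ep_rp cg_refl) auto
    also have "\<dots> = rp k * (ep (i - 2 * k) * s0)"
      by (simp add: mult.assoc)
    also have "\<dots> \<sim> rp k * (s0 * ep (2 * k - i))"
      using ep_s0[of "i - 2 * k"] by (intro cg_mult_left) auto
    also have "\<dots> \<sim> rp k * (rp (i - 2 * k) * ep (2 * k - i))"
      using s0_ep[of "2 * k - i"] by (intro cg_mult_left) auto
    also have "\<dots> = rp k * rp (i - 2 * k) * ep (2 * k - i)"
      by (simp add: mult.assoc)
    also have "\<dots> \<sim> rp (i - k) * ep (2 * k - i)"
      using rp_rp[of k "i - 2 * k"] by (intro cg_mult cg_refl) auto
    finally show ?thesis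
      using 2 by simp
  next
    case (3 k j)
    have "ep i * (rp k * ep j) = ep i * rp k * ep j"
      by (simp add: mult.assoc)
    also have "\<dots> \<sim> rp k * ep (i - 2 * k) * ep j"
      by (intro cg_mult ep_rp cg_refl) auto
    also have "\<dots> = rp k * (ep (i - 2 * k) * ep j)"
      by (simp add: mult.assoc)
    also have "\<dots> \<sim> rp k * NF (ee (i - 2 * k) 0 j)"
      by (intro cg_mult ep_ep cg_refl) auto
    also have "\<dots> \<sim> NF (Rop k (ee (i - 2 * k) 0 j))"
      by (intro rp_NF ee_V)
    \<comment> \<open>The general case follows from \<open>k = 0\<close> by applying
      \<open>r^k e_(i-2k) = e_i r^k\<close> to the vector of \<open>e_j\<close>.\<close>
    also have "Rop k (ee (i - 2 * k) 0 j) = ee i k j"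
      using Rop_Eop[of "\<delta> (E 0 j)" k "i - 2 * k"] by simp
    finally show ?thesis
      using 3 by simp
  qed
qed

lemma gen_NF: assumes "g \<in> gens l" "v \<in> V" shows "monomial [g] * NF v \<sim> NF (gact g v)"
proof -
  from assms(1) consider "g = SG 0" | "g = SG 1" | i where "g = EG i" "i < 2 * l"
    by (auto simp: gens_def)
  then show ?thesis
  proof cases
    case 1
    then show ?thesis using s0_NF[OF assms(2)] by (simp add: s0_def)
  next
    case 2
    then show ?thesis using s1_NF[OF assms(2)] by (simp add: s1_def)
  next
    case (3 i)
    then have "ep (int i) = monomial [g]"
      by (simp add: ep_def m_def)
    then show ?thesis using ep_NF[OF assms(2), of "int i"] 3 by simp
  qed
qed

lemma word_NF: assumes "u \<in> lists (gens l)" "v \<in> V" shows "monomial u * NF v \<sim> NF (wop u v)"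
  using assms(1)
proof (induction u)
  case (Cons g u)
  have "monomial (g # u) * NF v = monomial [g] * (monomial u * NF v)"
    by (simp add: monomial_Cons[of g u] mult.assoc)
  also have "\<dots> \<sim> monomial [g] * NF (wop u v)"
    using Cons by (intro cg_mult_left monomial_carrier) auto
  also have "\<dots> \<sim> NF (gact g (wop u v))"
    using Cons assms(2) by (intro gen_NF wop_V) auto
  finally show ?case
    by simp
qed (simp add: monomial_Nil)

text \<open>Modulo the relations, left multiplication of normal forms is the action on
  \<open>V\<close>. The vector of \<open>1\<close> has normal form \<open>1\<close>, and for it the
  statement writes \<open>p\<close> as a combination of basis words. This is the spanning
  half.\<close>

lemma act_NF: assumes "p \<in> carrier F" "v \<in> V" shows "p * NF v \<sim> NF (act p v)"
proof -
  have "p * NF v = lin (\<lambda>u. monomial u * NF v) p"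
  proof -
    have "lin (\<lambda>u. monomial u * NF v) p = lin monomial p * NF v"
      by (simp add: lin_def sum_distrib_right mult.assoc flip: scalar_mult)
    also have "lin monomial p = p"
      using lin_delta[of p] by (simp add: monomial_def[abs_def])
    finally show ?thesis ..
  qed
  also have "\<dots> \<sim> lin (\<lambda>u. NF (wop u v)) p"
    using assms by (intro cg_lin word_NF) (auto simp: F_carrier)
  also have "\<dots> = NF (act p v)"
    by (simp add: NF_def act_def lin_lin)
  finally show ?thesis .
qed

section \<open>The quotient as the regular module\<close>

definition \<Theta> :: "(gen list \<Rightarrow>\<^sub>0 complex) \<Rightarrow> bas \<Rightarrow>\<^sub>0 complex" where "\<Theta> p = act p (\<delta> (R 0))"

lemma Theta_V [simp]: "\<Theta> p \<in> V"
  by (simp add: \<Theta>_def act_V)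

lemma Theta_mult: "\<Theta> (p * q) = act p (\<Theta> q)"
  by (simp add: \<Theta>_def act_mult)

lemma Theta_add: "\<Theta> (p + q) = \<Theta> p + \<Theta> q" and Theta_diff: "\<Theta> (p - q) = \<Theta> p - \<Theta> q"
  and Theta_zero [simp]: "\<Theta> 0 = 0" and Theta_one [simp]: "\<Theta> 1 = \<delta> (R 0)"
  by (simp_all add: \<Theta>_def act_add act_diff)

lemma NF_Theta: assumes "p \<in> carrier F" shows "p \<sim> NF (\<Theta> p)"
  using act_NF[OF assms, of "\<delta> (R 0)"] by (simp add: \<Theta>_def)

text \<open>The relations annihilate \<open>V\<close>, which gives one direction. For the other,
  \<open>p\<close> is congruent to the normal form of its own value, so a vanishing value puts
  \<open>p\<close> into the ideal. Together with \<open>Theta_NF\<close> this identifies the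
  quotient with \<open>V\<close>.\<close>

lemma Theta_eq_0_iff: assumes "p \<in> carrier F" shows "\<Theta> p = 0 \<longleftrightarrow> p \<in> N"
proof
  assume "\<Theta> p = 0"
  then show "p \<in> N"
    using NF_Theta[OF assms] N_closed(2) cg_in_N by fastforce
next
  assume "p \<in> N"
  then show "\<Theta> p = 0"
    using N_Ann by (auto simp: Ann_def \<Theta>_def)
qed

lemma Theta_eq_iff: assumes "p \<in> carrier F" "q \<in> carrier F" shows "\<Theta> p = \<Theta> q \<longleftrightarrow> p \<sim> q"
  using Theta_eq_0_iff[of "p - q"] assms by (simp add: Theta_diff cg_def)

lemma act_cong: "p \<sim> q \<Longrightarrow> v \<in> V \<Longrightarrow> act p v = act q v"
  using N_Ann by (auto simp: cg_def Ann_def act_diff)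

lemma act_rp: assumes "v \<in> V" shows "act (rp k) v = Rop k v"
  using act_cong[OF grp_rot assms] act_grp[OF assms] by simp

lemma act_s0: "act s0 v = Sop 0 v"
  by (simp add: s0_def)

lemma act_ep: assumes "v \<in> V" shows "act (ep j) v = Eop j v"
  using m_pos Eop_period[OF assms, of "j mod m" j] by (simp add: ep_def)

lemma Theta_repr: assumes "b \<in> Bas" shows "\<Theta> (repr b) = \<delta> b"
  using assms by (cases rule: Bas_cases)
    (auto simp: \<Theta>_def act_mult act_rp act_s0 act_ep op_V)

lemma Theta_NF: assumes "v \<in> V" shows "\<Theta> (NF v) = v"
proof -
  have "\<Theta> (NF v) = lin (\<lambda>b. \<Theta> (repr b)) v"
    by (simp add: \<Theta>_def NF_def act_def lin_lin)
  also have "\<dots> = lin \<delta> v"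
    using assms by (intro lin_eqI Theta_repr)
  finally show ?thesis by simp
qed


section \<open>Submodules of the regular module\<close>

definition submod :: "(bas \<Rightarrow>\<^sub>0 complex) set \<Rightarrow> bool" where
  "submod U \<longleftrightarrow> U \<subseteq> V \<and> pm.subspace U \<and> (\<forall>g\<in>gens l. \<forall>u\<in>U. gact g u \<in> U)"

definition simple0 :: "(bas \<Rightarrow>\<^sub>0 complex) set \<Rightarrow> bool" where
  "simple0 L \<longleftrightarrow> submod L \<and> (\<forall>U. submod U \<and> U \<subseteq> L \<longrightarrow> U = {0} \<or> U = L)"

lemma submodD:
  assumes "submod U"
  shows "0 \<in> U" "u \<in> U \<Longrightarrow> u' \<in> U \<Longrightarrow> u + u' \<in> U" "u \<in> U \<Longrightarrow> pscale c u \<in> U"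
    "u \<in> U \<Longrightarrow> u \<in> V" "g \<in> gens l \<Longrightarrow> u \<in> U \<Longrightarrow> gact g u \<in> U"
    "u \<in> U \<Longrightarrow> u' \<in> U \<Longrightarrow> u - u' \<in> U"
  using assms pm.subspace_0 pm.subspace_add pm.subspace_scale pm.subspace_diff
  by (auto simp: submod_def)

lemma submod_sum: "submod U \<Longrightarrow> (\<And>x. x \<in> A \<Longrightarrow> f x \<in> U) \<Longrightarrow> sum f A \<in> U"
  by (auto simp: submod_def intro: pm.subspace_sum)

lemma submod_act:
  assumes "submod U" "p \<in> carrier F" "u \<in> U" shows "act p u \<in> U"
proof -
  have w: "wop w u \<in> U" if "w \<in> lists (gens l)" for w
    using that by (induction w) (auto intro: submodD(5)[OF assms(1)] assms(3))
  show ?thesis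
    unfolding act_def lin_def using assms(2)
    by (intro submod_sum[OF assms(1)] submodD(3)[OF assms(1)] w) (auto simp: F_carrier)
qed

lemma submod_ops:
  assumes "submod U" "u \<in> U" shows "Rop k u \<in> U" "Sop k u \<in> U" "Eop k u \<in> U"
proof -
  have u: "u \<in> V" using submodD(4)[OF assms] .
  show "Rop k u \<in> U"
    using submod_act[OF assms(1) _ assms(2), of "rp k"] u by (simp add: act_rp)
  show "Eop k u \<in> U"
    using submod_act[OF assms(1) _ assms(2), of "ep k"] u by (simp add: act_ep)
  have "act (rp k * s0) u = Sop k u"
    using u by (simp add: act_mult act_s0 act_rp op_V Rop_Sop)
  then show "Sop k u \<in> U"
    using submod_act[OF assms(1) _ assms(2), of "rp k * s0"] by simp
qed

lemma submod_span:
  assumes "B \<subseteq> V" "\<And>b g. b \<in> B \<Longrightarrow> g \<in> gens l \<Longrightarrow> gact g b \<in> pm.span B"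
  shows "submod (pm.span B)"
proof -
  have V: "pm.subspace V"
    by (auto simp: pm.subspace_def V_add V_pscale)
  have "gact g u \<in> pm.span B" if "g \<in> gens l" "u \<in> pm.span B" for g u
    using that(2)
  proof (induction u rule: pm.span_induct_alt)
    case (step c x y)
    then show ?case
      using assms(2)[OF step(1) that(1)]
      by (simp add: gact_add gact_pscale pm.span_add pm.span_scale)
  qed (simp add: pm.span_zero)
  then show ?thesis
    using pm.span_minimal[OF assms(1) V] by (auto simp: submod_def)
qed

text \<open>Coefficients are indexed by \<open>A\<close> rather than by vectors, so \<open>f\<close>
  may identify indices.\<close>

lemma span_image_elem:
  assumes "finite A" "u \<in> pm.span (f ` A)"
  obtains c where "u = (\<Sum>a\<in>A. pscale (c a) (f a))"
proof -
  let ?W = "{u. \<exists>c. u = (\<Sum>a\<in>A. pscale (c a) (f a))}"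
  have "pm.subspace ?W"
  proof (rule pm.subspaceI)
    show "0 \<in> ?W" by (auto intro!: exI[of _ "\<lambda>_. 0"])
  next
    fix x y assume "x \<in> ?W" "y \<in> ?W"
    then obtain c d where "x = (\<Sum>a\<in>A. pscale (c a) (f a))" "y = (\<Sum>a\<in>A. pscale (d a) (f a))"
      by auto
    then show "x + y \<in> ?W"
      by (auto intro!: exI[of _ "\<lambda>a. c a + d a"] simp: pm.scale_left_distrib sum.distrib)
  next
    fix r x assume "x \<in> ?W"
    then obtain c where "x = (\<Sum>a\<in>A. pscale (c a) (f a))"
      by auto
    then show "pscale r x \<in> ?W"
      by (auto intro!: exI[of _ "\<lambda>a. r * c a"] simp: pm.scale_sum_right)
  qed
  moreover have "f ` A \<subseteq> ?W"
  proof
    fix x assume "x \<in> f ` A"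
    then obtain b where b: "b \<in> A" "x = f b" by auto
    have "f b = (\<Sum>a\<in>A. if a = b then f a else 0)"
      using assms(1) b by simp
    also have "\<dots> = (\<Sum>a\<in>A. pscale (if a = b then 1 else 0) (f a))"
      by (intro sum.cong) auto
    finally show "x \<in> ?W"
      using b by (auto intro!: exI[of _ "\<lambda>a. if a = b then 1 else 0"])
  qed
  ultimately have "pm.span (f ` A) \<subseteq> ?W"
    by (rule pm.span_minimal[rotated])
  then show ?thesis
    using assms(2) that by auto
qed

lemma simple0_span_single:
  assumes "v \<in> V" "\<And>g. g \<in> gens l \<Longrightarrow> gact g v \<in> pm.span {v}"
  shows "simple0 (pm.span {v})"
  unfolding simple0_def
proof (intro conjI allI impI)
  show "submod (pm.span {v})"
    using assms by (intro submod_span) auto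
  fix U assume U: "submod U \<and> U \<subseteq> pm.span {v}"
  show "U = {0} \<or> U = pm.span {v}"
  proof (cases "U \<subseteq> {0}")
    case True
    then show ?thesis using U submodD(1) by auto
  next
    case False
    then obtain u where u: "u \<in> U" "u \<noteq> 0" by auto
    then obtain c where c: "u = pscale c v"
      using U span_image_elem[of "{()}" u "\<lambda>_. v"] by auto
    then have "pscale (inverse c) u = v"
      using u by auto
    then have "v \<in> U"
      using submodD(3)[of U u "inverse c"] U u by auto
    then have "pm.span {v} \<subseteq> U"
      using U by (intro pm.span_minimal) (auto simp: submod_def)
    then show ?thesis using U by auto
  qed
qed

subsection \<open>The submodules generated by the elements \<open>e\<^sub>j\<close>\<close>

text \<open>The central rotation \<open>r\<^sup>l\<close> acts by \<open>\<zeta> = 1\<close> or \<open>\<zeta> = -1\<close> on the span of the vectors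
  \<open>vv \<zeta> j i\<close>, where \<open>i\<close> ranges over the indices of the parity of \<open>j\<close>. On these vectors the \<open>e\<^sub>i\<close> act
  through the matrix \<open>Q \<zeta>\<close>.\<close>

definition vv :: "complex \<Rightarrow> int \<Rightarrow> int \<Rightarrow> bas \<Rightarrow>\<^sub>0 complex" where
  "vv \<zeta> j i = \<delta> (E ((i - j) div 2) j) + pscale \<zeta> (\<delta> (E ((i - j) div 2 + int l) j))"

definition Q :: "complex \<Rightarrow> int \<Rightarrow> int \<Rightarrow> complex" where
  "Q \<zeta> x i = (if x = i then \<tau> x else \<mu> ((x + i) div 2) + \<zeta> * \<mu> ((x + i) div 2 + int l))"

definition par :: "int \<Rightarrow> int set" where "par j = {i \<in> {0..<m}. even (i - j)}"

lemma finite_par [simp]: "finite (par j)"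
  unfolding par_def by (rule finite_subset[of _ "{0..<m}"]) auto

lemma vv_V [simp]: "vv \<zeta> j i \<in> V"
  by (auto simp: vv_def intro!: V_add V_pscale)

lemma E_shift: "E (k + int l + int l) j = E k j" "E (k - int l) j = E (k + int l) j"
  using mod_add_self2[of k m] mod_add_self2[of "k - int l" m] by (simp_all add: m_def algebra_simps)

lemma Sop_vv:
  assumes "even (i - j)" shows "Sop a (vv \<zeta> j i) = vv \<zeta> j (2 * a - i)"
proof -
  obtain k where k: "i = j + 2 * k"
    using assms by (metis add.commute diff_add_cancel evenE)
  have 1: "(i - j) div 2 = k" "(2 * a - i - j) div 2 = a - k - j"
    unfolding k by auto
  have 2: "E (a - (k + int l) - j) j = E (a - k - j + int l) j"
    using E_shift(2)[of "a - k - j" j] by (simp add: algebra_simps)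
  show ?thesis
    unfolding vv_def 1 by (simp add: op_add op_pscale 2 del: bas_eq)
qed

lemma Rop_vv:
  assumes "even (i - j)" shows "Rop a (vv \<zeta> j i) = vv \<zeta> j (i + 2 * a)"
  using assms Sop_Sop[of "vv \<zeta> j i" a 0] by (simp add: Sop_vv algebra_simps)

lemma vv_shift:
  assumes "\<zeta> * \<zeta> = 1" shows "vv \<zeta> j (i + m) = pscale \<zeta> (vv \<zeta> j i)"
proof -
  have "(i + m - j) div 2 = (i - j) div 2 + int l"
    by (simp add: m_def)
  then show ?thesis
    using assms by (simp only: vv_def E_shift pm.scale_right_distrib pm.scale_scale)
      (simp add: add.commute del: bas_eq)
qed

text \<open>For \<open>\<zeta> = -1\<close> the vector itself changes sign when \<open>i\<close>
  moves by \<open>m\<close>; membership in a subspace does not notice this.\<close>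

lemma vv_mod:
  assumes "\<zeta> * \<zeta> = 1" "pm.subspace U" shows "vv \<zeta> j (i mod m) \<in> U \<longleftrightarrow> vv \<zeta> j i \<in> U"
proof (rule mod_if_periodic)
  fix x
  have "pscale \<zeta> (pscale \<zeta> (vv \<zeta> j x)) = vv \<zeta> j x"
    using assms(1) by simp
  then show "vv \<zeta> j (x + m) \<in> U \<longleftrightarrow> vv \<zeta> j x \<in> U"
    unfolding vv_shift[OF assms(1)] using pm.subspace_scale[OF assms(2)] by metis
qed

text \<open>The two terms of \<open>vv\<close> have images on the same two basis vectors, with the
  coefficients \<mu> exchanged; since \<zeta> squares to 1, a common factor splits off. The indices
  are confined to one period because \<open>Q\<close> compares \<open>x\<close> and \<open>i\<close>
  as integers and \<open>vv\<close> picks up \<zeta> over a period.\<close>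

lemma Eop_vv:
  assumes "\<zeta> * \<zeta> = 1" "even (i - j)" "i \<in> {0..<m}" "x \<in> {0..<m}"
  shows "Eop x (vv \<zeta> j i) = (if even (x - j) then pscale (Q \<zeta> x i) (vv \<zeta> j x) else 0)"
proof -
  obtain k where k: "i = j + 2 * k"
    using assms(2) by (metis add.commute diff_add_cancel evenE)
  have 1: "(i - j) div 2 = k"
    unfolding k by auto
  show ?thesis
  proof (cases "even (x - j)")
    case False
    then show ?thesis
      by (simp add: vv_def op_add op_pscale ee_def)
  next
    case True
    show ?thesis
    proof (cases "x = i")
      case True
      have "m dvd (x - j - 2 * k)" "m dvd (x - j - 2 * (k + int l))"
        unfolding True k by (simp_all add: m_def)
      moreover have "even (x - j)" using True assms(2) by simp
      ultimately show ?thesis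
        using True 1 by (simp add: vv_def op_add op_pscale ee_def Q_def pm.scale_right_distrib mult.commute)
    next
      case ne: False
      have "\<not> m dvd (x - i)"
      proof
        assume "m dvd x - i"
        then have "x mod m = i mod m" by (simp add: mod_eq_dvd_iff)
        with ne assms(3,4) show False by simp
      qed
      then have nd: "\<not> m dvd (x - j - 2 * k)"
        by (simp add: k algebra_simps)
      have "x - j - 2 * k = x - j - 2 * (k + int l) + m"
        by (simp add: m_def)
      then have nd': "\<not> m dvd (x - j - 2 * (k + int l))"
        using nd by (metis dvd_add_triv_right_iff)
      have a: "(x + j) div 2 + k = (x + i) div 2"
        unfolding k by auto
      have a2: "(x + j) div 2 + (k + int l) = (x + i) div 2 + int l"
        "\<mu> ((x + i) div 2 + int l + int l) = \<mu> ((x + i) div 2)"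
        using a mu_shift(2)[of "(x + i) div 2"] by (simp_all add: algebra_simps)
      have "Eop x (vv \<zeta> j i) = pscale (\<mu> ((x + i) div 2)) (\<delta> (E ((x - j) div 2) j))
          + pscale (\<mu> ((x + i) div 2 + int l)) (\<delta> (E ((x - j) div 2 + int l) j))
          + pscale \<zeta> (pscale (\<mu> ((x + i) div 2 + int l)) (\<delta> (E ((x - j) div 2) j))
          + pscale (\<mu> ((x + i) div 2)) (\<delta> (E ((x - j) div 2 + int l) j)))"
        unfolding vv_def 1 op_add op_pscale op_delta eact_simps ee_def
        using nd nd' \<open>even (x - j)\<close> by (simp only: if_False if_True a a2 simp_thms)
      also have "\<dots> = pscale (Q \<zeta> x i) (vv \<zeta> j x)"
        using ne assms(1)
        by (simp add: Q_def vv_def pm.scale_right_distrib pm.scale_left_distrib algebra_simps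
            flip: mult.assoc)
      finally show ?thesis
        using \<open>even (x - j)\<close> by simp
    qed
  qed
qed

lemma gens_cases:
  assumes "g \<in> gens l"
  obtains "gact g = Sop 0" | "gact g = Sop 1" | x where "x \<in> {0..<m}" "gact g = Eop x"
proof -
  from assms consider "g = SG 0" | "g = SG 1" | i where "g = EG i" "i < 2 * l"
    by (auto simp: gens_def)
  then show thesis
  proof cases
    case (3 i)
    then show thesis using that(3)[of "int i"] by (auto simp: m_def fun_eq_iff)
  qed (use that in \<open>auto simp: fun_eq_iff\<close>)
qed

end

text \<open>The form in which the determinant conditions are used: for each sign \<zeta> and each
  parity class, \<open>Ninv\<close> is the inverse of that block of \<open>Q \<zeta>\<close>, with
  residues as indices. The left inverse yields simplicity, the right one the coefficients of
  \<open>ff\<close>.\<close>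

locale brauer_regular = brauer_params +
  fixes Ninv :: "complex \<Rightarrow> int \<Rightarrow> int \<Rightarrow> complex"
  assumes Ninv_left: "\<And>\<zeta> x i. \<zeta> \<in> {1, -1} \<Longrightarrow> x \<in> {0..<m} \<Longrightarrow> i \<in> par x \<Longrightarrow>
      (\<Sum>u\<in>par x. Ninv \<zeta> x u * Q \<zeta> u i) = (if x = i then 1 else 0)"
    and Ninv_right: "\<And>\<zeta> x i. \<zeta> \<in> {1, -1} \<Longrightarrow> x \<in> {0..<m} \<Longrightarrow> i \<in> par x \<Longrightarrow>
      (\<Sum>u\<in>par x. Q \<zeta> x u * Ninv \<zeta> u i) = (if x = i then 1 else 0)"
begin

definition Lmod :: "complex \<Rightarrow> int \<Rightarrow> (bas \<Rightarrow>\<^sub>0 complex) set" where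
  "Lmod \<zeta> j = pm.span (vv \<zeta> j ` par j)"

lemma par_eq: "x \<in> par j \<Longrightarrow> par x = par j"
  by (auto simp: par_def)

lemma vv_Lmod:
  assumes "\<zeta> \<in> {1, -1}" "even (i - j)" shows "vv \<zeta> j i \<in> Lmod \<zeta> j"
proof -
  have "\<zeta> * \<zeta> = 1" using assms(1) by auto
  moreover have "i mod m \<in> par j"
    using assms(2) m_pos by (simp add: par_def even_m dvd_mod_iff)
  then have "vv \<zeta> j (i mod m) \<in> Lmod \<zeta> j"
    unfolding Lmod_def by (intro pm.span_base) auto
  ultimately show ?thesis
    using vv_mod[of \<zeta> "Lmod \<zeta> j"] pm.subspace_span by (auto simp: Lmod_def)
qed

text \<open>\<open>e_x\<close> maps the combination with coefficients \<open>c\<close> to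
  \<open>vv \<zeta> j x\<close> times the entry \<open>x\<close> of \<open>Q c\<close>. As
  \<open>Q\<close> is invertible, some entry is nonzero. So a nonzero submodule contains one of
  these vectors, and rotations carry it to all others.\<close>

lemma simple0_Lmod:
  assumes \<zeta>: "\<zeta> \<in> {1, -1}" shows "simple0 (Lmod \<zeta> j)"
  unfolding simple0_def
proof (intro conjI allI impI)
  have \<zeta>2: "\<zeta> * \<zeta> = 1" using \<zeta> by auto
  show "submod (Lmod \<zeta> j)"
    unfolding Lmod_def
  proof (rule submod_span)
    fix b g assume "b \<in> vv \<zeta> j ` par j" and g: "g \<in> gens l"
    then obtain i where i: "i \<in> par j" "b = vv \<zeta> j i" by auto
    then have ev: "even (i - j)" "i \<in> {0..<m}" by (auto simp: par_def)
    from g have "gact g b \<in> Lmod \<zeta> j"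
    proof (cases rule: gens_cases)
      case (3 x)
      then show ?thesis
        using vv_Lmod[OF \<zeta>, of x j] Eop_vv[OF \<zeta>2 ev 3(1)] i
        by (auto simp: Lmod_def pm.span_zero intro: pm.span_scale)
    qed (use ev i vv_Lmod[OF \<zeta>, of _ j] in \<open>auto simp: Sop_vv\<close>)
    then show "gact g b \<in> pm.span (vv \<zeta> j ` par j)"
      by (simp add: Lmod_def)
  qed auto
  fix U assume U: "submod U \<and> U \<subseteq> Lmod \<zeta> j"
  then have sU: "submod U" by simp
  show "U = {0} \<or> U = Lmod \<zeta> j"
  proof (cases "U \<subseteq> {0}")
    case True
    then show ?thesis using submodD(1)[OF sU] by auto
  next
    case False
    then obtain u where u: "u \<in> U" "u \<noteq> 0" by auto
    then have "u \<in> pm.span (vv \<zeta> j ` par j)"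
      using U by (auto simp: Lmod_def)
    then obtain c where c: "u = (\<Sum>i\<in>par j. pscale (c i) (vv \<zeta> j i))"
      using span_image_elem[OF finite_par] by blast
    have Eu: "Eop x u = pscale (\<Sum>i\<in>par j. Q \<zeta> x i * c i) (vv \<zeta> j x)" if "x \<in> par j" for x
    proof -
      have "Eop x u = (\<Sum>i\<in>par j. pscale (c i) (pscale (Q \<zeta> x i) (vv \<zeta> j x)))"
        unfolding c op_sum op_pscale
        using that \<zeta>2 by (intro sum.cong refl) (simp add: Eop_vv par_def)
      then show ?thesis
        by (simp add: pm.scale_sum_left mult.commute)
    qed
    \<comment> \<open>Otherwise \<open>Q c = 0\<close>, and the left inverse forces
      \<open>c = 0\<close>, hence \<open>u = 0\<close>.\<close>
    have "\<exists>x\<in>par j. (\<Sum>i\<in>par j. Q \<zeta> x i * c i) \<noteq> 0"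
    proof (rule ccontr)
      assume *: "\<not> (\<exists>x\<in>par j. (\<Sum>i\<in>par j. Q \<zeta> x i * c i) \<noteq> 0)"
      have "c y = 0" if y: "y \<in> par j" for y
      proof -
        have y': "y \<in> {0..<m}" "par y = par j" using y par_eq by (auto simp: par_def)
        have "0 = (\<Sum>x\<in>par j. Ninv \<zeta> y x * (\<Sum>i\<in>par j. Q \<zeta> x i * c i))"
          using * by simp
        also have "\<dots> = (\<Sum>i\<in>par j. (\<Sum>x\<in>par j. Ninv \<zeta> y x * Q \<zeta> x i) * c i)"
          unfolding sum_distrib_left sum_distrib_right mult.assoc by (rule sum.swap)
        also have "\<dots> = (\<Sum>i\<in>par j. if y = i then c i else 0)"
          using Ninv_left[OF \<zeta> y'(1)] by (intro sum.cong) (auto simp: y'(2))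
        also have "\<dots> = c y"
          using y by simp
        finally show ?thesis by simp
      qed
      then have "u = 0" by (simp add: c)
      with u show False by simp
    qed
    then obtain x where x: "x \<in> par j" "(\<Sum>i\<in>par j. Q \<zeta> x i * c i) \<noteq> 0" by blast
    let ?d = "\<Sum>i\<in>par j. Q \<zeta> x i * c i"
    have "pscale (inverse ?d) (Eop x u) = vv \<zeta> j x"
      using x(2) by (simp add: Eu[OF x(1)])
    then have vx: "vv \<zeta> j x \<in> U"
      using submodD(3)[OF sU submod_ops(3)[OF sU u(1)]] by metis
    have "vv \<zeta> j i \<in> U" if i: "i \<in> par j" for i
    proof -
      have "even (i - x)" "even (x - j)" using i x(1) by (auto simp: par_def)
      then have "Rop ((i - x) div 2) (vv \<zeta> j x) = vv \<zeta> j i"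
        by (simp add: Rop_vv)
      then show ?thesis
        using submod_ops(1)[OF sU vx] by metis
    qed
    then have "Lmod \<zeta> j \<subseteq> U"
      unfolding Lmod_def using sU by (intro pm.span_minimal) (auto simp: submod_def)
    then show ?thesis using U by auto
  qed
qed

text \<open>\<open>ff\<close> represents an idempotent that is the identity of the ideal generated by the \<open>e\<^sub>i\<close>.\<close>

definition ff :: "bas \<Rightarrow>\<^sub>0 complex" where
  "ff = (\<Sum>\<zeta>\<in>{1, -1}. \<Sum>j\<in>{0..<m}. \<Sum>i\<in>par j. pscale (Ninv \<zeta> i j / 2) (vv \<zeta> j i))"

definition hh :: "bas \<Rightarrow>\<^sub>0 complex" where "hh = \<delta> (R 0) - ff"

text \<open>The coefficients in \<open>ff\<close> form columns of the inverse matrix, so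
  \<open>e_x\<close> leaves only \<open>j = x\<close>. What remains is half of
  \<open>(1 + r^l) e_x\<close> plus half of \<open>(1 - r^l) e_x\<close>, which is the origin of the
  factor 1/2.\<close>

lemma Eop_ff:
  assumes x: "x \<in> {0..<m}" shows "Eop x ff = \<delta> (E 0 x)"
proof -
  have "Eop x (\<Sum>j\<in>{0..<m}. \<Sum>i\<in>par j. pscale (Ninv \<zeta> i j / 2) (vv \<zeta> j i)) = pscale (1 / 2) (vv \<zeta> x x)"
    if \<zeta>: "\<zeta> \<in> {1, -1}" for \<zeta>
  proof -
    have \<zeta>2: "\<zeta> * \<zeta> = 1" using \<zeta> by auto
    have inner: "(\<Sum>i\<in>par j. pscale (Ninv \<zeta> i j / 2) (Eop x (vv \<zeta> j i)))
      = (if j = x then pscale (1 / 2) (vv \<zeta> x x) else 0)" if j: "j \<in> {0..<m}" for j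
    proof (cases "even (x - j)")
      case True
      have "(\<Sum>i\<in>par j. pscale (Ninv \<zeta> i j / 2) (Eop x (vv \<zeta> j i)))
        = (\<Sum>i\<in>par j. pscale (Q \<zeta> x i * Ninv \<zeta> i j) (pscale (1 / 2) (vv \<zeta> j x)))"
        using True x \<zeta>2 by (intro sum.cong refl) (simp add: Eop_vv par_def mult.commute)
      also have "\<dots> = pscale (\<Sum>i\<in>par j. Q \<zeta> x i * Ninv \<zeta> i j) (pscale (1 / 2) (vv \<zeta> j x))"
        by (simp only: pm.scale_sum_left)
      also have "(\<Sum>i\<in>par j. Q \<zeta> x i * Ninv \<zeta> i j) = (if x = j then 1 else 0)"
      proof -
        have "par x = par j"
          using True x by (intro par_eq) (simp add: par_def)
        moreover have "j \<in> par x"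
          using True j by (auto simp: par_def)
        ultimately show ?thesis
          using Ninv_right[OF \<zeta> x] by metis
      qed
      finally show ?thesis by auto
    next
      case False
      have "(\<Sum>i\<in>par j. pscale (Ninv \<zeta> i j / 2) (Eop x (vv \<zeta> j i))) = (\<Sum>i\<in>par j. 0)"
        using False x \<zeta>2 by (intro sum.cong refl) (simp add: Eop_vv par_def)
      then show ?thesis
        using False by auto
    qed
    have "Eop x (\<Sum>j\<in>{0..<m}. \<Sum>i\<in>par j. pscale (Ninv \<zeta> i j / 2) (vv \<zeta> j i))
      = (\<Sum>j\<in>{0..<m}. if j = x then pscale (1 / 2) (vv \<zeta> x x) else 0)"
      unfolding op_sum op_pscale by (intro sum.cong refl inner)
    then show ?thesis
      using x by simp
  qed
  from this[of 1] this[of "-1"]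
  have "Eop x ff = pscale (1 / 2) (vv 1 x x) + pscale (1 / 2) (vv (-1) x x)"
    by (simp add: ff_def op_add)
  also have "\<dots> = \<delta> (E 0 x)"
    by (rule poly_mapping_eqI) (simp add: vv_def lookup_add lookup_minus algebra_simps)
  finally show ?thesis .
qed

lemma hh_V [simp]: "hh \<in> V"
proof -
  have "ff \<in> V"
    unfolding ff_def by (intro V_sum V_pscale vv_V)
  then show ?thesis
    unfolding hh_def using V_add[of "\<delta> (R 0)" "pscale (-1) ff"] V_pscale[of ff "-1"] by simp
qed

lemma Eop_hh [simp]: "Eop x hh = 0"
proof -
  have "Eop (x mod m) hh = 0"
    using m_pos by (simp add: hh_def op_diff Eop_ff)
  then show ?thesis
    using Eop_period[of hh "x mod m" x] by simp
qed

subsection \<open>The submodule isomorphic to the group algebra\<close>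

text \<open>A discrete Fourier component of \<open>hh\<close>: for \<omega> with
  \<open>\<omega> ^ (2 * l) = 1\<close> it is, up to the factor \<open>2 * l\<close>, the projection
  of \<open>hh\<close> to the eigenspace of \<open>r\<close> for \<omega>.\<close>

definition xw :: "complex \<Rightarrow> bas \<Rightarrow>\<^sub>0 complex" where
  "xw \<omega> = (\<Sum>k<2 * l. pscale (inverse \<omega> ^ k) (Rop (int k) hh))"

definition yw :: "complex \<Rightarrow> bas \<Rightarrow>\<^sub>0 complex" where "yw \<omega> = Sop 0 (xw \<omega>)"

lemma xw_V [simp]: "xw \<omega> \<in> V" and yw_V [simp]: "yw \<omega> \<in> V"
proof -
  show "xw \<omega> \<in> V"
    unfolding xw_def by (intro V_sum V_pscale op_V hh_V)
  then show "yw \<omega> \<in> V"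
    by (simp add: yw_def op_V)
qed

lemma Rop_xw:
  assumes "\<omega> ^ (2 * l) = 1" shows "Rop 1 (xw \<omega>) = pscale \<omega> (xw \<omega>)"
proof -
  have \<omega>: "\<omega> \<noteq> 0"
    using assms l_pos by (intro notI) (simp add: power_0_left)
  let ?f = "\<lambda>k. pscale (inverse \<omega> ^ k) (Rop (int k) hh)"
  have "Rop 1 (xw \<omega>) = (\<Sum>k<2 * l. pscale \<omega> (?f (Suc k)))"
    unfolding xw_def op_sum op_pscale using \<omega>
    by (intro sum.cong refl) (simp add: Rop_Rop add.commute)
  also have "\<dots> = pscale \<omega> (\<Sum>k<2 * l. ?f (Suc k))"
    by (simp add: pm.scale_sum_right)
  \<comment> \<open>The index shift is cyclic, because the power of \<omega> and the rotation both
    have period \<open>2 * l\<close>.\<close>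
  also have "?f (2 * l) = ?f 0"
    using assms Rop_period[of hh "int (2 * l)" 0]
    by (simp add: power_inverse m_def)
  then have "(\<Sum>k<2 * l. ?f (Suc k)) = (\<Sum>k<2 * l. ?f k)"
    using sum.lessThan_Suc_shift[of ?f "2 * l"] sum.lessThan_Suc[of ?f "2 * l"]
    by (simp add: add.commute)
  finally show ?thesis
    by (simp add: xw_def)
qed

lemma Eop_xw: "Eop i (xw \<omega>) = 0" and Eop_yw: "Eop i (yw \<omega>) = 0"
proof -
  have *: "Eop i (Rop k hh) = 0" for i k
    using Rop_Eop[of hh k "i - 2 * k"] by simp
  show x: "Eop i (xw \<omega>) = 0" for i
    unfolding xw_def op_sum op_pscale by (simp add: *)
  show "Eop i (yw \<omega>) = 0"
    using Eop_conj[of "xw \<omega>" 0 "- i"] x by (simp add: yw_def)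
qed

lemma xw_yw_ops:
  assumes "\<omega> ^ (2 * l) = 1"
  shows "Sop 0 (xw \<omega>) = yw \<omega>" "Sop 0 (yw \<omega>) = xw \<omega>"
    "Sop 1 (xw \<omega>) = pscale (inverse \<omega>) (yw \<omega>)" "Sop 1 (yw \<omega>) = pscale \<omega> (xw \<omega>)"
    "Rop 1 (yw \<omega>) = pscale (inverse \<omega>) (yw \<omega>)"
proof -
  have \<omega>: "\<omega> \<noteq> 0"
    using assms l_pos by (intro notI) (simp add: power_0_left)
  show "Sop 0 (xw \<omega>) = yw \<omega>"
    by (simp add: yw_def)
  show y: "Sop 0 (yw \<omega>) = xw \<omega>"
    by (simp add: yw_def Sop_Sop Rop_0)
  show "Sop 1 (yw \<omega>) = pscale \<omega> (xw \<omega>)"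
    using Rop_xw[OF assms] by (simp add: yw_def Sop_Sop)
  have "Rop (-1) (Rop 1 (xw \<omega>)) = pscale \<omega> (Rop (-1) (xw \<omega>))"
    unfolding Rop_xw[OF assms] op_pscale ..
  then have "pscale (inverse \<omega>) (xw \<omega>) = pscale (inverse \<omega>) (pscale \<omega> (Rop (-1) (xw \<omega>)))"
    by (simp add: Rop_Rop Rop_0)
  then have "Rop (-1) (xw \<omega>) = pscale (inverse \<omega>) (xw \<omega>)"
    using \<omega> by simp
  then have "Sop 0 (Rop (-1) (xw \<omega>)) = pscale (inverse \<omega>) (yw \<omega>)"
    by (simp add: op_pscale yw_def)
  then show 1: "Sop 1 (xw \<omega>) = pscale (inverse \<omega>) (yw \<omega>)"
    by (simp add: Sop_Rop)
  then show "Rop 1 (yw \<omega>) = pscale (inverse \<omega>) (yw \<omega>)"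
    by (simp add: yw_def Rop_Sop)
qed

text \<open>\<open>s_0\<close> sends the eigenvalue \<omega> of \<open>r\<close> to its inverse. If
  the two coincide, the candidates are eigenlines of \<open>s_0\<close>; otherwise the span of
  \<open>xw\<close> and \<open>yw\<close> stays whole.\<close>

definition Wset :: "complex \<Rightarrow> (bas \<Rightarrow>\<^sub>0 complex) set set" where
  "Wset \<omega> = (if \<omega> * \<omega> = 1 then {pm.span {xw \<omega> + yw \<omega>}, pm.span {xw \<omega> - yw \<omega>}}
     else {pm.span {xw \<omega>, yw \<omega>}})"

lemma V_subspace: "pm.subspace V"
  by (auto simp: pm.subspace_def V_add V_pscale)

lemma simple0_Wset:
  assumes \<omega>: "\<omega> ^ (2 * l) = 1" and L: "L \<in> Wset \<omega>" shows "simple0 L"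
proof -
  note ops = xw_yw_ops[OF \<omega>]
  have \<omega>0: "\<omega> \<noteq> 0"
    using \<omega> l_pos by (intro notI) (simp add: power_0_left)
  show ?thesis
  proof (cases "\<omega> * \<omega> = 1")
    case True
    then have inv: "inverse \<omega> = \<omega>"
      using \<omega>0 by (metis inverse_unique)
    have pm: "simple0 (pm.span {v})" if v: "v = xw \<omega> + yw \<omega> \<or> v = xw \<omega> - yw \<omega>" for v
    proof (rule simple0_span_single)
      show "v \<in> V"
        using v pm.subspace_add[OF V_subspace xw_V yw_V] pm.subspace_diff[OF V_subspace xw_V yw_V] by auto
      fix g assume "g \<in> gens l"
      then show "gact g v \<in> pm.span {v}"
      proof (cases rule: gens_cases)
        case 1
        from v have "Sop 0 v = v \<or> Sop 0 v = - v"
          by (auto simp: op_add op_diff ops add.commute)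
        then show ?thesis
          using 1 pm.span_neg[of v "{v}"] pm.span_base[of v "{v}"] by auto
      next
        case 2
        from v have "Sop 1 v = pscale \<omega> v \<or> Sop 1 v = pscale \<omega> (- v)"
          by (auto simp: op_add op_diff ops inv add.commute pm.scale_right_distrib pm.scale_right_diff_distrib)
        then show ?thesis
          using 2 pm.span_scale[OF pm.span_base[of v "{v}"]] pm.span_scale[OF pm.span_neg[OF pm.span_base[of v "{v}"]]]
          by auto
      next
        case (3 x)
        from v have "Eop x v = 0"
          by (auto simp: op_add op_diff Eop_xw Eop_yw)
        then show ?thesis
          using 3 by (simp add: pm.span_zero)
      qed
    qed
    show ?thesis
      using L True pm by (auto simp: Wset_def)
  next
    case False
    then have ne: "inverse \<omega> \<noteq> \<omega>"
      using \<omega>0 by (metis right_inverse)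
    have L_eq: "L = pm.span {xw \<omega>, yw \<omega>}"
      using L False by (simp add: Wset_def)
    have xy: "xw \<omega> \<in> L" "yw \<omega> \<in> L"
      unfolding L_eq by (auto intro: pm.span_base)
    show ?thesis
      unfolding simple0_def
    proof (intro conjI allI impI)
      show "submod L"
        unfolding L_eq
      proof (rule submod_span)
        fix b g assume "b \<in> {xw \<omega>, yw \<omega>}" "g \<in> gens l"
        then show "gact g b \<in> pm.span {xw \<omega>, yw \<omega>}"
          unfolding L_eq[symmetric]
          by (elim gens_cases insertE emptyE)
            (use xy in \<open>auto simp: ops Eop_xw Eop_yw L_eq pm.span_zero intro: pm.span_scale\<close>)
      qed auto
      fix U assume U: "submod U \<and> U \<subseteq> L"
      then have sU: "submod U" by simp
      show "U = {0} \<or> U = L"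
      proof (cases "U \<subseteq> {0}")
        case True
        then show ?thesis using submodD(1)[OF sU] by auto
      next
        case False
        then obtain u where u: "u \<in> U" "u \<noteq> 0" by auto
        then obtain a b where ab: "u = pscale a (xw \<omega>) + pscale b (yw \<omega>)"
        proof -
          \<comment> \<open>Indexing the pair by booleans gives two coefficients even if both
            vectors coincide.\<close>
          have "u \<in> pm.span ((\<lambda>t. if t then xw \<omega> else yw \<omega>) ` {True, False})"
            using u U by (auto simp: L_eq insert_commute)
          then obtain c where "u = (\<Sum>t\<in>{True, False}. pscale (c t) (if t then xw \<omega> else yw \<omega>))"
            using span_image_elem[of "{True, False}" u "\<lambda>t. if t then xw \<omega> else yw \<omega>"]
            by (metis finite.emptyI finite.insertI)
          then show ?thesis
            using that[of "c True" "c False"] by simp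
        qed
        have closed: "xw \<omega> \<in> U \<longleftrightarrow> yw \<omega> \<in> U"
          using submod_ops(2)[OF sU, of _ 0] ops(1,2) by metis
        have "xw \<omega> \<in> U"
        proof (cases "b = 0")
          case True
          then have "pscale (inverse a) u = xw \<omega>"
            using u by (auto simp: ab)
          then show ?thesis
            using submodD(3)[OF sU u(1)] by metis
        next
          case False
          \<comment> \<open>\<open>r - \<omega>\<close> removes the component along
            \<open>xw\<close> and multiplies the one along \<open>yw\<close> by
            \<open>inverse \<omega> - \<omega>\<close>, which is nonzero here.\<close>
          have "Rop 1 u - pscale \<omega> u = pscale (b * (inverse \<omega> - \<omega>)) (yw \<omega>)"
            by (simp add: ab op_add op_pscale Rop_xw[OF \<omega>] ops(5) pm.scale_right_distrib
                pm.scale_left_diff_distrib right_diff_distrib mult.commute)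
          then have "pscale (b * (inverse \<omega> - \<omega>)) (yw \<omega>) \<in> U"
            using submodD(6)[OF sU submod_ops(1)[OF sU u(1)] submodD(3)[OF sU u(1)]] by metis
          from submodD(3)[OF sU this, of "inverse (b * (inverse \<omega> - \<omega>))"]
          have "yw \<omega> \<in> U"
            using False ne by (simp del: inverse_mult_distrib)
          then show ?thesis using closed by simp
        qed
        then have "L \<subseteq> U"
          unfolding L_eq using closed sU by (intro pm.span_minimal) (auto simp: submod_def)
        then show ?thesis using U by auto
      qed
    qed
  qed
qed

lemma xw_in_submod:
  assumes "submod U" "\<Union>(Wset \<omega>) \<subseteq> U" shows "xw \<omega> \<in> U"
proof (cases "\<omega> * \<omega> = 1")
  case True
  then have "xw \<omega> + yw \<omega> \<in> U" "xw \<omega> - yw \<omega> \<in> U"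
    using assms(2) pm.span_base by (auto simp: Wset_def)
  then have "pscale (1 / 2) ((xw \<omega> + yw \<omega>) + (xw \<omega> - yw \<omega>)) \<in> U"
    using submodD[OF assms(1)] by blast
  also have "(xw \<omega> + yw \<omega>) + (xw \<omega> - yw \<omega>) = pscale 2 (xw \<omega>)"
    using pm.scale_left_distrib[of 1 1 "xw \<omega>"] by simp
  finally show ?thesis by simp
next
  case False
  then show ?thesis
    using assms(2) pm.span_base[of "xw \<omega>" "{xw \<omega>, yw \<omega>}"] by (auto simp: Wset_def)
qed

definition \<omega> :: "nat \<Rightarrow> complex" where
  "\<omega> t = exp (2 * of_real pi * \<i> * of_nat t / of_nat (2 * l))"

lemma omega_power: "\<omega> t ^ (2 * l) = 1"
  using complex_root_unity[of "2 * l" t] l_pos by (simp add: \<omega>_def)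

text \<open>This symmetry turns the sum over all roots in \<open>sum_omega\<close> into a geometric
  series in the powers of one root.\<close>

lemma omega_swap: "\<omega> t ^ k = \<omega> k ^ t"
  by (simp add: \<omega>_def mult_ac flip: exp_of_nat_mult)

lemma sum_omega: "k < 2 * l \<Longrightarrow> (\<Sum>t<2 * l. inverse (\<omega> t) ^ k) = (if k = 0 then of_nat (2 * l) else 0)"
proof -
  assume k: "k < 2 * l"
  have eq: "(\<Sum>t<2 * l. inverse (\<omega> t) ^ k) = (\<Sum>t<2 * l. inverse (\<omega> k) ^ t)"
    by (simp add: power_inverse omega_swap[of _ k])
  show ?thesis
  proof (cases "k = 0")
    case False
    have "\<omega> k \<noteq> 1"
      unfolding \<omega>_def using complex_root_unity_eq_1[of "2 * l" k] l_pos k False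
      by (auto dest: dvd_imp_le)
    then have "inverse (\<omega> k) \<noteq> 1" by simp
    then show ?thesis
      unfolding eq geometric_sum[OF \<open>inverse (\<omega> k) \<noteq> 1\<close>]
      using False omega_power[of k] by (simp only: power_inverse) simp
  qed simp
qed

text \<open>Fourier inversion: summing over all roots leaves only the term with
  \<open>k = 0\<close>.\<close>

lemma sum_xw: "(\<Sum>t<2 * l. xw (\<omega> t)) = pscale (of_nat (2 * l)) hh"
proof -
  have "(\<Sum>t<2 * l. xw (\<omega> t)) = (\<Sum>k<2 * l. pscale (\<Sum>t<2 * l. inverse (\<omega> t) ^ k) (Rop (int k) hh))"
    unfolding xw_def pm.scale_sum_left by (rule sum.swap)
  also have "\<dots> = (\<Sum>k<2 * l. if k = 0 then pscale (of_nat (2 * l)) (Rop 0 hh) else 0)"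
    by (intro sum.cong refl) (simp add: sum_omega)
  also have "\<dots> = pscale (of_nat (2 * l)) hh"
    using l_pos by (simp add: Rop_0)
  finally show ?thesis .
qed

text \<open>A submodule above the family contains \<open>ff\<close> because of the
  \<open>Lmod\<close> and \<open>hh\<close> because of the \<open>Wset\<close>, and these add up to
  the vector of \<open>1\<close>.\<close>

lemma simple_submodules:
  obtains \<L> where "finite \<L>" "\<And>L. L \<in> \<L> \<Longrightarrow> simple0 L"
    "\<And>U. submod U \<Longrightarrow> \<Union>\<L> \<subseteq> U \<Longrightarrow> \<delta> (R 0) \<in> U"
proof
  let ?\<L> = "(\<lambda>(\<zeta>, j). Lmod \<zeta> j) ` ({1, -1} \<times> {0..<m}) \<union> (\<Union>t<2 * l. Wset (\<omega> t))"
  show "finite ?\<L>"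
    by (auto simp: Wset_def)
  show "simple0 L" if "L \<in> ?\<L>" for L
    using that simple0_Lmod simple0_Wset[OF omega_power] by auto
  show "\<delta> (R 0) \<in> U" if U: "submod U" "\<Union>?\<L> \<subseteq> U" for U
  proof -
    have "vv \<zeta> j i \<in> U" if "\<zeta> \<in> {1, -1}" "j \<in> {0..<m}" "i \<in> par j" for \<zeta> j i
    proof -
      have "vv \<zeta> j i \<in> Lmod \<zeta> j"
        using that by (intro vv_Lmod) (auto simp: par_def)
      then show ?thesis
        using U(2) that by blast
    qed
    then have "ff \<in> U"
      unfolding ff_def by (intro submod_sum[OF U(1)] submodD(3)[OF U(1)])
    moreover have "xw (\<omega> t) \<in> U" if "t < 2 * l" for t
      using that U(2) by (intro xw_in_submod[OF U(1)]) blast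
    then have "pscale (of_nat (2 * l)) hh \<in> U"
      unfolding sum_xw[symmetric] by (intro submod_sum[OF U(1)]) simp
    then have "pscale (inverse (of_nat (2 * l))) (pscale (of_nat (2 * l)) hh) \<in> U"
      by (rule submodD(3)[OF U(1)])
    then have "hh \<in> U"
      using l_pos by simp
    ultimately have "hh + ff \<in> U"
      using submodD(2)[OF U(1)] by blast
    then show ?thesis
      by (simp add: hh_def)
  qed
qed


section \<open>The quotient algebra\<close>

abbreviation B where "B \<equiv> brauer_algebra l \<mu>0 \<mu>1 \<tau>0 \<tau>1"
abbreviation rc where "rc \<equiv> residue_class l \<mu>0 \<mu>1 \<tau>0 \<tau>1"
abbreviation K where "K \<equiv> scalars l \<mu>0 \<mu>1 \<tau>0 \<tau>1"

sublocale B: ring B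
  unfolding brauer_algebra_def by (rule N.quotient_is_ring)

lemma rc_hom: "rc \<in> Ring.ring_hom F B"
proof -
  have "rc = (+>\<^bsub>F\<^esub>) N"
    by (simp add: residue_class_def fun_eq_iff)
  then show ?thesis
    using N.rcos_ring_hom by (simp add: brauer_algebra_def)
qed

lemma carrier_B: "carrier B = rc ` carrier F"
  by (auto simp: brauer_algebra_def FactRing_def A_RCOSETS_def' residue_class_def)

lemma rc_closed [simp]: "p \<in> carrier F \<Longrightarrow> rc p \<in> carrier B"
  by (simp add: carrier_B)

lemma rc_add: "p \<in> carrier F \<Longrightarrow> q \<in> carrier F \<Longrightarrow> rc p \<oplus>\<^bsub>B\<^esub> rc q = rc (p + q)"
  and rc_mult: "p \<in> carrier F \<Longrightarrow> q \<in> carrier F \<Longrightarrow> rc p \<otimes>\<^bsub>B\<^esub> rc q = rc (p * q)"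
  and rc_one: "\<one>\<^bsub>B\<^esub> = rc 1"
  using ring_hom_add[OF rc_hom, of p q] ring_hom_mult[OF rc_hom, of p q] ring_hom_one[OF rc_hom]
  by auto

text \<open>From here on, equality of cosets is decided by vectors in \<open>V\<close>.\<close>

lemma rc_eq_iff:
  assumes "p \<in> carrier F" "q \<in> carrier F" shows "rc p = rc q \<longleftrightarrow> \<Theta> p = \<Theta> q"
proof -
  have "rc p = rc q \<longleftrightarrow> p \<sim> q"
  proof
    assume "rc p = rc q"
    moreover have "p \<in> rc p"
      unfolding residue_class_def using N_closed(2)
      by (auto simp: a_r_coset_def' intro!: bexI[of _ 0])
    ultimately have "p \<in> rc q" by simp
    then show "p \<sim> q"
      using assms by (auto simp: residue_class_def a_r_coset_def' cg_def)
  next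
    assume "p \<sim> q"
    then have "p \<in> rc q"
      unfolding residue_class_def by (auto simp: a_r_coset_def' cg_def intro!: bexI[of _ "p - q"])
    then show "rc p = rc q"
      unfolding residue_class_def using N.a_repr_independence' assms by metis
  qed
  then show ?thesis
    using Theta_eq_iff[OF assms] by simp
qed

lemma rc_zero: "\<zero>\<^bsub>B\<^esub> = rc 0"
proof -
  have "rc 0 \<oplus>\<^bsub>B\<^esub> rc 0 = rc 0"
    by (simp add: rc_add)
  then show ?thesis
    using B.add.r_cancel_one'[of "rc 0" "rc 0"] by simp
qed

lemma Theta_pscale: "\<Theta> (pscale c p) = pscale c (\<Theta> p)"
  by (simp add: \<Theta>_def act_pscale)

section \<open>Left ideals and submodules\<close>

text \<open>\<open>ideal_of\<close> and \<open>submod_of\<close> transport along the isomorphism of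
  left modules from the algebra to \<open>V\<close> that \<open>\<Theta>\<close> induces. Both go
  through representatives, since \<open>\<Theta>\<close> lives on the free algebra.\<close>

definition ideal_of :: "(bas \<Rightarrow>\<^sub>0 complex) set \<Rightarrow> (gen list \<Rightarrow>\<^sub>0 complex) set set" where
  "ideal_of U = rc ` {p \<in> carrier F. \<Theta> p \<in> U}"

definition submod_of :: "(gen list \<Rightarrow>\<^sub>0 complex) set set \<Rightarrow> (bas \<Rightarrow>\<^sub>0 complex) set" where
  "submod_of J = \<Theta> ` {p \<in> carrier F. rc p \<in> J}"

lemma rc_in_ideal_of: "p \<in> carrier F \<Longrightarrow> rc p \<in> ideal_of U \<longleftrightarrow> \<Theta> p \<in> U"
  using rc_eq_iff by (auto simp: ideal_of_def)

lemma Theta_in_submod_of: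
  assumes "p \<in> carrier F" shows "\<Theta> p \<in> submod_of J \<longleftrightarrow> rc p \<in> J"
proof
  assume "\<Theta> p \<in> submod_of J"
  then obtain q where "q \<in> carrier F" "rc q \<in> J" "\<Theta> p = \<Theta> q"
    by (auto simp: submod_of_def)
  then show "rc p \<in> J"
    using rc_eq_iff[OF assms, of q] by simp
qed (use assms in \<open>auto simp: submod_of_def\<close>)

lemma left_ideal_ideal_of:
  assumes U: "submod U" shows "left_ideal (ideal_of U) B"
proof (rule B.left_idealI)
  show "ideal_of U \<subseteq> carrier B"
    by (auto simp: ideal_of_def)
  show "\<zero>\<^bsub>B\<^esub> \<in> ideal_of U"
    using submodD(1)[OF U] by (simp add: rc_zero rc_in_ideal_of)
  show "x \<oplus>\<^bsub>B\<^esub> y \<in> ideal_of U" if xy: "x \<in> ideal_of U" "y \<in> ideal_of U" for x y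
  proof -
    obtain p q where "p \<in> carrier F" "q \<in> carrier F" "\<Theta> p \<in> U" "\<Theta> q \<in> U" "x = rc p" "y = rc q"
      using xy by (auto simp: ideal_of_def)
    then show ?thesis
      using submodD(2)[OF U] by (simp add: rc_add rc_in_ideal_of Theta_add)
  qed
  show "r \<otimes>\<^bsub>B\<^esub> x \<in> ideal_of U" if rx: "r \<in> carrier B" "x \<in> ideal_of U" for r x
  proof -
    obtain p q where "p \<in> carrier F" "q \<in> carrier F" "\<Theta> q \<in> U" "r = rc p" "x = rc q"
      using rx by (auto simp: ideal_of_def carrier_B)
    then show ?thesis
      using submod_act[OF U] by (simp add: rc_mult rc_in_ideal_of Theta_mult)
  qed
qed

lemma submod_submod_of:
  assumes J: "left_ideal J B" shows "submod (submod_of J)"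
  unfolding submod_def
proof (intro conjI ballI)
  note Jc = B.left_ideal_closed[OF J]
  show "submod_of J \<subseteq> V"
    by (auto simp: submod_of_def)
  have smult: "act p u \<in> submod_of J" if "p \<in> carrier F" "u \<in> submod_of J" for p u
  proof -
    obtain q where q: "q \<in> carrier F" "rc q \<in> J" "u = \<Theta> q"
      using \<open>u \<in> _\<close> by (auto simp: submod_of_def)
    then have "rc (p * q) \<in> J"
      using that Jc(4)[of "rc p" "rc q"] by (simp add: rc_mult)
    then show ?thesis
      using that q Theta_in_submod_of[of "p * q" J] by (simp add: Theta_mult)
  qed
  show "pm.subspace (submod_of J)"
  proof (rule pm.subspaceI)
    show "0 \<in> submod_of J"
      using Theta_in_submod_of[of 0 J] Jc(1) by (simp add: rc_zero)
    show "pscale c u \<in> submod_of J" if "u \<in> submod_of J" for c u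
      using smult[OF scalar_carrier that] by simp
    show "u + v \<in> submod_of J" if uv: "u \<in> submod_of J" "v \<in> submod_of J" for u v
    proof -
      obtain p q where pq: "p \<in> carrier F" "rc p \<in> J" "u = \<Theta> p" "q \<in> carrier F" "rc q \<in> J" "v = \<Theta> q"
        using uv by (auto simp: submod_of_def)
      then have "rc (p + q) \<in> J"
        using Jc(2)[of "rc p" "rc q"] by (simp add: rc_add)
      then show ?thesis
        using pq Theta_in_submod_of[of "p + q" J] by (simp add: Theta_add)
    qed
  qed
  show "gact g u \<in> submod_of J" if "g \<in> gens l" "u \<in> submod_of J" for g u
    using smult[OF monomial_carrier[of "[g]"] that(2)] that(1) by simp
qed

lemma minimal_ideal_of:
  assumes L: "simple0 L" and ne: "L \<noteq> {0}" shows "minimal_left_ideal (ideal_of L) B"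
  unfolding minimal_left_ideal_def
proof (intro conjI allI impI)
  have sL: "submod L"
    using L by (simp add: simple0_def)
  show "left_ideal (ideal_of L) B"
    by (rule left_ideal_ideal_of[OF sL])
  obtain u where u: "u \<in> L" "u \<noteq> 0"
    using ne submodD(1)[OF sL] by auto
  then have uV: "u \<in> V"
    using submodD(4)[OF sL] by simp
  then have "rc (NF u) \<in> ideal_of L" "rc (NF u) \<noteq> rc 0"
    using u by (simp_all add: rc_in_ideal_of Theta_NF rc_eq_iff)
  then show "ideal_of L \<noteq> {\<zero>\<^bsub>B\<^esub>}"
    by (auto simp: rc_zero)
  fix J assume J: "left_ideal J B \<and> J \<subseteq> ideal_of L"
  then have "submod_of J \<subseteq> L"
    using rc_in_ideal_of by (auto simp: submod_of_def)
  then consider "submod_of J = {0}" | "submod_of J = L"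
    using L submod_submod_of J by (auto simp: simple0_def)
  then show "J = {\<zero>\<^bsub>B\<^esub>} \<or> J = ideal_of L"
  proof cases
    case 1
    have "x = \<zero>\<^bsub>B\<^esub>" if x: "x \<in> J" for x
    proof -
      obtain p where p: "p \<in> carrier F" "x = rc p"
        using J x by (auto simp: ideal_of_def)
      then have "\<Theta> p \<in> submod_of J"
        using x by (simp add: Theta_in_submod_of)
      then have "\<Theta> p = \<Theta> 0"
        using 1 by simp
      then show ?thesis
        using p by (simp add: rc_zero rc_eq_iff)
    qed
    then show ?thesis
      using B.left_ideal_closed(1) J by blast
  next
    case 2
    have "ideal_of L \<subseteq> J"
      using 2 Theta_in_submod_of by (auto simp: ideal_of_def)
    then show ?thesis
      using J by auto
  qed
qed

section \<open>The basis\<close>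

lemma scalars_iff: "k \<in> K \<longleftrightarrow> (\<exists>c. k = rc (scalar c))"
  by (auto simp: scalars_def)

definition bB :: "bas \<Rightarrow> (gen list \<Rightarrow>\<^sub>0 complex) set" where "bB b = rc (repr b)"

declare B.Span.simps [simp del]

text \<open>Describing spans by the support of \<open>\<Theta> p\<close> makes independence
  immediate: a further basis word has its support outside.\<close>

lemma Span_bB:
  assumes "set bs \<subseteq> Bas"
  shows "B.Span K (map bB bs) = rc ` {p \<in> carrier F. Poly_Mapping.keys (\<Theta> p) \<subseteq> set bs}"
  using assms
proof (induction bs)
  case Nil
  have "rc ` {p \<in> carrier F. \<Theta> p = 0} = {rc 0}"
    using rc_eq_iff[of _ 0] by force
  then show ?case
    by (simp add: B.Span.simps rc_zero)
next
  case (Cons b bs)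
  then have b: "b \<in> Bas" and IH:
    "B.Span K (map bB bs) = rc ` {p \<in> carrier F. Poly_Mapping.keys (\<Theta> p) \<subseteq> set bs}"
    by auto
  have "B.Span K (map bB (b # bs)) = B.line_extension K (bB b) (B.Span K (map bB bs))"
    by (simp add: B.Span.simps)
  also have "\<dots> = rc ` {p \<in> carrier F. Poly_Mapping.keys (\<Theta> p) \<subseteq> set (b # bs)}"
  proof (intro equalityI subsetI)
    fix x assume "x \<in> B.line_extension K (bB b) (B.Span K (map bB bs))"
    then obtain c p where cp: "p \<in> carrier F" "Poly_Mapping.keys (\<Theta> p) \<subseteq> set bs"
      "x = rc (scalar c) \<otimes>\<^bsub>B\<^esub> bB b \<oplus>\<^bsub>B\<^esub> rc p"
      unfolding B.line_extension_mem_iff IH by (auto simp: scalars_iff)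
    then have x: "x = rc (pscale c (repr b) + p)"
      by (simp add: bB_def rc_mult rc_add scalar_mult)
    have "Poly_Mapping.keys (pscale c (\<delta> b) + \<Theta> p) \<subseteq> set (b # bs)"
      using Poly_Mapping.keys_add[of "pscale c (\<delta> b)" "\<Theta> p"] keys_pscale[of c "\<delta> b"] cp(2)
      by (auto simp: \<delta>_def split: if_splits)
    then have "Poly_Mapping.keys (\<Theta> (pscale c (repr b) + p)) \<subseteq> set (b # bs)"
      using b by (simp add: Theta_add Theta_pscale Theta_repr)
    then show "x \<in> rc ` {p \<in> carrier F. Poly_Mapping.keys (\<Theta> p) \<subseteq> set (b # bs)}"
      using x cp(1) by auto
  next
    fix x assume "x \<in> rc ` {p \<in> carrier F. Poly_Mapping.keys (\<Theta> p) \<subseteq> set (b # bs)}"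
    then obtain p where p: "p \<in> carrier F" "Poly_Mapping.keys (\<Theta> p) \<subseteq> insert b (set bs)" "x = rc p"
      by auto
    \<comment> \<open>The multiple of \<open>bB b\<close> to split off is read from the coordinate
      of \<open>\<Theta> p\<close> at \<open>b\<close>.\<close>
    define c where "c = Poly_Mapping.lookup (\<Theta> p) b"
    define q where "q = p - pscale c (repr b)"
    have q: "q \<in> carrier F" "\<Theta> q = \<Theta> p - pscale c (\<delta> b)"
      using p(1) b by (simp_all add: q_def Theta_diff Theta_pscale Theta_repr)
    have "Poly_Mapping.keys (\<Theta> q) \<subseteq> set bs"
    proof
      fix b' assume b': "b' \<in> Poly_Mapping.keys (\<Theta> q)"
      then have "Poly_Mapping.lookup (\<Theta> p) b' - c * Poly_Mapping.lookup (\<delta> b) b' \<noteq> 0"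
        by (simp add: in_keys_iff q(2) lookup_minus)
      then show "b' \<in> set bs"
        using p(2) by (cases "b' = b") (auto simp: c_def \<delta>_def lookup_single in_keys_iff when_def)
    qed
    moreover have "x = rc (scalar c) \<otimes>\<^bsub>B\<^esub> bB b \<oplus>\<^bsub>B\<^esub> rc q"
      using p q by (simp add: bB_def rc_mult rc_add scalar_mult) (simp add: q_def)
    ultimately show "x \<in> B.line_extension K (bB b) (B.Span K (map bB bs))"
      unfolding B.line_extension_mem_iff IH using q(1) scalars_iff by blast
  qed
  finally show ?case .
qed

lemma independent_bB:
  assumes "set bs \<subseteq> Bas" "distinct bs" shows "B.independent K (map bB bs)"
  using assms
proof (induction bs)
  case (Cons b bs)
  have "bB b \<notin> B.Span K (map bB bs)"
  proof
    assume "bB b \<in> B.Span K (map bB bs)"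
    then obtain p where p: "p \<in> carrier F" "Poly_Mapping.keys (\<Theta> p) \<subseteq> set bs" "rc (repr b) = rc p"
      using Cons.prems by (auto simp: Span_bB bB_def)
    then have "\<Theta> p = \<delta> b"
      using Cons.prems rc_eq_iff[of "repr b" p] by (simp add: Theta_repr)
    then show False
      using p(2) Cons.prems by (simp add: \<delta>_def)
  qed
  then have "B.independent K (bB b # map bB bs)"
    using Cons.IH Cons.prems by (intro B.li_Cons) (simp_all add: bB_def[of b])
  then show ?case by simp
qed simp

lemma Span_Bas: "set bs = Bas \<Longrightarrow> B.Span K (map bB bs) = carrier B"
proof -
  assume bs: "set bs = Bas"
  have "Poly_Mapping.keys (\<Theta> p) \<subseteq> Bas" for p
    using Theta_V[of p] by (simp add: V_def)
  then show ?thesis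
    using bs Span_bB[of bs] by (simp add: carrier_B)
qed

lemma Bas_eq: "Bas = R ` {0..<m} \<union> S ` {0..<m} \<union> case_prod E ` ({0..<m} \<times> {0..<m})"
proof -
  have "R k \<in> R ` {0..<m}" "S k \<in> S ` {0..<m}" "E k j \<in> case_prod E ` ({0..<m} \<times> {0..<m})" for k j
    using m_pos by (auto simp: image_iff intro!: bexI[of _ "k mod m"] bexI[of _ "(k mod m, j mod m)"])
  then show ?thesis
    by (auto simp: Bas_def)
qed

lemma finite_Bas: "finite Bas" and card_Bas: "card Bas = 4 * l + 4 * l ^ 2"
proof -
  have inj: "inj_on R {0..<m}" "inj_on S {0..<m}" "inj_on (case_prod E) ({0..<m} \<times> {0..<m})"
    by (auto simp: inj_on_def)
  show "finite Bas"
    unfolding Bas_eq by auto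
  have "card Bas = card (R ` {0..<m} \<union> S ` {0..<m}) + card (case_prod E ` ({0..<m} \<times> {0..<m}))"
    unfolding Bas_eq by (intro card_Un_disjoint) auto
  also have "card (R ` {0..<m} \<union> S ` {0..<m}) = card (R ` {0..<m}) + card (S ` {0..<m})"
    by (intro card_Un_disjoint) auto
  also have "card (case_prod E ` ({0..<m} \<times> {0..<m})) = 4 * l ^ 2"
    using card_image[OF inj(3)] by (simp add: card_cartesian_product m_def power2_eq_square nat_mult_distrib)
  finally show "card Bas = 4 * l + 4 * l ^ 2"
    using card_image[OF inj(1)] card_image[OF inj(2)] by (simp add: m_def nat_mult_distrib)
qed

abbreviation ge where "ge \<equiv> group_elem l \<mu>0 \<mu>1 \<tau>0 \<tau>1"
abbreviation eE where "eE \<equiv> e_elem l \<mu>0 \<mu>1 \<tau>0 \<tau>1"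

lemma ge_eq: "ge (rot k) = bB (R k)" "ge (rfl k) = bB (S k)"
  unfolding group_elem_def bB_def
  by (simp_all add: rc_eq_iff Theta_repr del: repr_simps) (simp_all add: \<Theta>_def act_grp)

text \<open>As \<open>s_k e_i = r^(k-i) e_i\<close>, the rotation \<open>rot k\<close> and the
  reflection \<open>rfl (k + i)\<close> have the same product with \<open>e_i\<close>. These are the
  repetitions \<open>w e_i = w s_i e_i\<close>, by which the 8 l^2 pairs yield 4 l^2
  elements.\<close>

lemma ge_e_eq:
  assumes "i < 2 * l"
  shows "ge (rot k) \<otimes>\<^bsub>B\<^esub> eE i = bB (E k (int i))" "ge (rfl k) \<otimes>\<^bsub>B\<^esub> eE i = bB (E (k - int i) (int i))"
  unfolding group_elem_def e_elem_def bB_def using assms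
  by (simp_all add: rc_mult rc_eq_iff Theta_repr del: repr_simps)
    (simp_all add: \<Theta>_def act_mult act_grp)

lemma inj_bB: "inj_on bB Bas"
proof (rule inj_onI)
  fix b b' assume b: "b \<in> Bas" "b' \<in> Bas" "bB b = bB b'"
  then have "\<Theta> (repr b) = \<Theta> (repr b')"
    by (simp add: bB_def rc_eq_iff)
  then show "b = b'"
    using b by (simp add: Theta_repr)
qed

lemma ge_image: "ge ` D = bB ` (range R \<union> range S)"
  by (auto simp: D_def image_Un image_image ge_eq)

lemma ge_e_set: "{ge w \<otimes>\<^bsub>B\<^esub> eE i | w i. w \<in> D \<and> i < 2 * l} = bB ` range (case_prod E)"
proof (intro equalityI subsetI)
  fix x assume "x \<in> {ge w \<otimes>\<^bsub>B\<^esub> eE i | w i. w \<in> D \<and> i < 2 * l}"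
  then obtain w i where x: "x = ge w \<otimes>\<^bsub>B\<^esub> eE i" and w: "w \<in> D" and i: "i < 2 * l"
    by auto
  have "bB (E k j) \<in> bB ` range (case_prod E)" for k j
    by (intro imageI range_eqI[of _ _ "(k, j)"]) simp
  then show "x \<in> bB ` range (case_prod E)"
    using w unfolding x by (elim D_cases) (simp_all only: ge_e_eq[OF i])
next
  fix x assume "x \<in> bB ` range (case_prod E)"
  then obtain k j where x: "x = bB (E k j)" by auto
  have "E k j = E k (int (nat (j mod m)))"
    using m_pos by simp
  then have "x = ge (rot k) \<otimes>\<^bsub>B\<^esub> eE (nat (j mod m))"
    using x by (simp only: ge_e_eq(1)[OF nat_mod_less])
  then show "x \<in> {ge w \<otimes>\<^bsub>B\<^esub> eE i | w i. w \<in> D \<and> i < 2 * l}"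
    using nat_mod_less rot_D(1) by blast
qed

lemma basis_theorem:
  "B.dimension (4 * l + 4 * l ^ 2) K (carrier B)"
  "inj_on ge D"
  "ge ` D \<inter> {ge w \<otimes>\<^bsub>B\<^esub> eE i | w i. w \<in> D \<and> i < 2 * l} = {}"
  "basis_over K B (ge ` D \<union> {ge w \<otimes>\<^bsub>B\<^esub> eE i | w i. w \<in> D \<and> i < 2 * l})"
proof -
  obtain bs where bs: "set bs = Bas" "distinct bs"
    using finite_distinct_list[OF finite_Bas] by blast
  have len: "length bs = 4 * l + 4 * l ^ 2"
    using distinct_card[OF bs(2)] card_Bas bs(1) by simp
  have ind: "B.independent K (map bB bs)"
    using bs by (intro independent_bB) auto
  show "B.dimension (4 * l + 4 * l ^ 2) K (carrier B)"
    using B.dimension_independent[OF ind] Span_Bas[OF bs(1)] len by simp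
  show "inj_on ge D"
  proof (rule inj_onI)
    fix v w assume "v \<in> D" "w \<in> D" "ge v = ge w"
    then show "v = w"
      by (elim D_cases) (auto simp: ge_eq inj_on_eq_iff[OF inj_bB] rot_eq_iff rfl_eq_iff)
  qed
  have "(range R \<union> range S) \<inter> range (case_prod E) = {}"
    by auto
  then show "ge ` D \<inter> {ge w \<otimes>\<^bsub>B\<^esub> eE i | w i. w \<in> D \<and> i < 2 * l} = {}"
    unfolding ge_image ge_e_set
    by (subst inj_on_image_Int[OF inj_bB, symmetric]) (auto simp: Bas_def)
  have "set (map bB bs) = ge ` D \<union> {ge w \<otimes>\<^bsub>B\<^esub> eE i | w i. w \<in> D \<and> i < 2 * l}"
    unfolding ge_image ge_e_set using bs(1) by (simp add: Bas_def image_Un)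
  then show "basis_over K B (ge ` D \<union> {ge w \<otimes>\<^bsub>B\<^esub> eE i | w i. w \<in> D \<and> i < 2 * l})"
    unfolding basis_over_def using ind Span_Bas[OF bs(1)] by blast
qed

end

context brauer_regular
begin

lemma semisimple_B: "semisimple_ring B"
proof -
  obtain \<L> where \<L>: "finite \<L>" "\<And>L. L \<in> \<L> \<Longrightarrow> simple0 L"
    "\<And>U. submod U \<Longrightarrow> \<Union>\<L> \<subseteq> U \<Longrightarrow> \<delta> (R 0) \<in> U"
    using simple_submodules by blast
  show ?thesis
  proof (rule B.semisimple_ringI)
    \<comment> \<open>Minimal left ideals are nonzero by definition, so the zero modules are
      dropped; they contribute nothing to the sum.\<close>
    show "finite (ideal_of ` (\<L> - {{0}}))"
      using \<L>(1) by simp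
    show "minimal_left_ideal L B" if "L \<in> ideal_of ` (\<L> - {{0}})" for L
      using that \<L>(2) minimal_ideal_of by auto
    show "\<one>\<^bsub>B\<^esub> \<in> J" if J: "left_ideal J B" "\<Union>(ideal_of ` (\<L> - {{0}})) \<subseteq> J" for J
    proof -
      have sJ: "submod (submod_of J)"
        by (rule submod_submod_of[OF J(1)])
      have "u \<in> submod_of J" if "L \<in> \<L>" "u \<in> L" for L u
      proof (cases "L = {0}")
        case True
        then show ?thesis using that submodD(1)[OF sJ] by simp
      next
        case False
        have "u \<in> V"
          using \<L>(2)[OF that(1)] that(2) submodD(4) by (auto simp: simple0_def)
        then have "rc (NF u) \<in> ideal_of L" "u = \<Theta> (NF u)"
          using that(2) by (simp_all add: rc_in_ideal_of Theta_NF)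
        moreover have "ideal_of L \<subseteq> J"
          using that(1) False J(2) by blast
        ultimately show ?thesis
          using Theta_in_submod_of[of "NF u" J] by auto
      qed
      then have "\<Theta> 1 \<in> submod_of J"
        using \<L>(3)[OF sJ] by auto
      then show ?thesis
        by (simp add: rc_one Theta_in_submod_of del: Theta_one)
    qed
  qed
qed

end

section \<open>The determinant conditions\<close>

lemma det_nonzero_inverse:
  fixes f :: "nat \<Rightarrow> nat \<Rightarrow> complex"
  assumes "Determinant.det (Matrix.mat n n (\<lambda>(s, t). f s t)) \<noteq> 0"
  shows "\<exists>g. \<forall>s<n. \<forall>t<n. (\<Sum>k<n. f s k * g k t) = (if s = t then 1 else 0)
    \<and> (\<Sum>k<n. g s k * f k t) = (if s = t then 1 else 0)"
proof -
  let ?A = "Matrix.mat n n (\<lambda>(s, t). f s t)"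
  have A: "?A \<in> carrier_mat n n" by simp
  from det_non_zero_imp_unit[OF A assms, of "()"]
  obtain B where B: "B \<in> carrier_mat n n" "B * ?A = 1\<^sub>m n" "?A * B = 1\<^sub>m n"
    unfolding Units_def ring_mat_def by auto
  have "(\<Sum>k<n. f s k * B $$ (k, t)) = (if s = t then 1 else 0)"
    "(\<Sum>k<n. B $$ (s, k) * f k t) = (if s = t then 1 else 0)" if "s < n" "t < n" for s t
  proof -
    have "(?A * B) $$ (s, t) = (\<Sum>k<n. f s k * B $$ (k, t))"
      using that B(1) by (simp add: scalar_prod_def atLeast0LessThan)
    then show "(\<Sum>k<n. f s k * B $$ (k, t)) = (if s = t then 1 else 0)"
      using that B(3) by simp
    have "(B * ?A) $$ (s, t) = (\<Sum>k<n. B $$ (s, k) * f k t)"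
      using that B(1) by (simp add: scalar_prod_def atLeast0LessThan)
    then show "(\<Sum>k<n. B $$ (s, k) * f k t) = (if s = t then 1 else 0)"
      using that B(2) by simp
  qed
  then show ?thesis
    by (intro exI[of _ "\<lambda>s t. B $$ (s, t)"]) simp
qed

context brauer_params
begin

lemma par_image:
  fixes p :: nat
  assumes "p < 2" "even (x - int p)"
  shows "par x = (\<lambda>k. int (2 * k + p)) ` {..<l}"
proof (intro equalityI subsetI)
  fix i assume "i \<in> par x"
  then have i: "0 \<le> i" "i < m" "even (i - int p)"
    using assms(2) by (auto simp: par_def)
  then have "even (nat i - p) \<and> nat i \<ge> p"
    using assms(1) by (cases "p = 0") (auto simp: even_nat_iff not_le less_Suc_eq elim!: oddE, presburger+)
  then obtain k where "nat i = 2 * k + p"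
    by (metis add.commute evenE le_add_diff_inverse)
  then show "i \<in> (\<lambda>k. int (2 * k + p)) ` {..<l}"
    using i by (auto simp: m_def image_iff intro!: bexI[of _ k])
next
  fix i assume "i \<in> (\<lambda>k. int (2 * k + p)) ` {..<l}"
  then show "i \<in> par x"
    using assms by (auto simp: par_def m_def)
qed

lemma sum_par:
  fixes p :: nat
  assumes "p < 2" "even (x - int p)"
  shows "(\<Sum>u\<in>par x. h u) = (\<Sum>k<l. h (int (2 * k + p)))"
  unfolding par_image[OF assms] by (subst sum.reindex) (auto simp: inj_on_def)

text \<open>Conjugation of the matrix by the diagonal matrix of the signs \<open>\<eta>\<close> accounts for the choice of
  the unit normal vectors.\<close>

lemma Q_inverse:
  fixes \<eta> :: "nat \<Rightarrow> complex"
  assumes \<eta>: "\<And>i. i < 2 * l \<Longrightarrow> \<eta> i * \<eta> i = 1"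
    and det: "\<And>p. p < 2 \<Longrightarrow> Determinant.det (Matrix.mat l l (\<lambda>(s, t).
       \<eta> (2 * s + p) * \<eta> (2 * t + p) * Q \<zeta> (int (2 * s + p)) (int (2 * t + p)))) \<noteq> 0"
  shows "\<exists>N. \<forall>x\<in>{0..<m}. \<forall>i\<in>par x.
      (\<Sum>u\<in>par x. N x u * Q \<zeta> u i) = (if x = i then 1 else 0) \<and>
      (\<Sum>u\<in>par x. Q \<zeta> x u * N u i) = (if x = i then 1 else 0)"
proof -
  let ?f = "\<lambda>p s t. \<eta> (2 * s + p) * \<eta> (2 * t + p) * Q \<zeta> (int (2 * s + p)) (int (2 * t + p))"
  define P where "P p g \<longleftrightarrow> (\<forall>s<l. \<forall>t<l. (\<Sum>k<l. ?f p s k * g k t) = (if s = t then 1 else 0)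
      \<and> (\<Sum>k<l. g s k * ?f p k t) = (if s = t then 1 else 0))" for p g
  have "\<forall>p\<in>{..<2}. \<exists>g. P p g"
  proof
    fix p :: nat assume "p \<in> {..<2}"
    then show "\<exists>g. P p g"
      unfolding P_def by (intro det_nonzero_inverse det) simp
  qed
  then obtain G where "\<forall>p\<in>{..<2}. P p (G p)"
    by (rule bchoice[THEN exE])
  then have G: "(\<Sum>k<l. ?f p s k * G p k t) = (if s = t then 1 else 0)"
     "(\<Sum>k<l. G p s k * ?f p k t) = (if s = t then 1 else 0)"
    if "p < 2" "s < l" "t < l" for p s t
    using that by (simp_all add: P_def)
  \<comment> \<open>For T the diagonal matrix of the signs, \<open>G\<close> inverts T Q T, hence T
    G T inverts Q, as T squares to 1. A residue \<open>2 * s + p\<close> is split into its parity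
    and its matrix index.\<close>
  define N where "N x u = \<eta> (nat x) * \<eta> (nat u) * G (nat x mod 2) (nat x div 2) (nat u div 2)" for x u
  have N: "N (int (2 * s + p)) (int (2 * t + p)) = \<eta> (2 * s + p) * \<eta> (2 * t + p) * G p s t"
    if "p < 2" for p s t
    using that by (simp add: N_def nat_add_distrib nat_mult_distrib)
  show ?thesis
  proof (intro exI[of _ N] ballI)
    fix x i assume x: "x \<in> {0..<m}" and i: "i \<in> par x"
    define p where "p = nat (x mod 2)"
    have p: "p < 2" "even (x - int p)"
      by (auto simp: p_def minus_mod_eq_mult_div)
    have "x \<in> par x" using x by (simp add: par_def)
    then obtain s where s: "s < l" "x = int (2 * s + p)"
      unfolding par_image[OF p] by auto
    obtain t where t: "t < l" "i = int (2 * t + p)"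
      using i unfolding par_image[OF p] by auto
    have \<eta>': "\<eta> (2 * k + p) * \<eta> (2 * k + p) = 1" if "k < l" for k
      using \<eta>[of "2 * k + p"] that p(1) by simp
    have st: "\<eta> (2 * s + p) * \<eta> (2 * t + p) * (if s = t then 1 else 0) = (if x = i then 1 else 0)"
      using \<eta>'[OF s(1)] s t by auto
    have "(\<Sum>u\<in>par x. N x u * Q \<zeta> u i)
      = (\<Sum>k<l. \<eta> (2 * s + p) * \<eta> (2 * t + p) * (G p s k * ?f p k t))"
      unfolding sum_par[OF p] unfolding s(2) t(2) N[OF p(1)]
      using \<eta>'[OF t(1)] by (intro sum.cong refl) (simp add: algebra_simps)
    also have "\<dots> = \<eta> (2 * s + p) * \<eta> (2 * t + p) * (if s = t then 1 else 0)"
      unfolding sum_distrib_left[symmetric] G(2)[OF p(1) s(1) t(1)] ..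
    finally have 1: "(\<Sum>u\<in>par x. N x u * Q \<zeta> u i) = (if x = i then 1 else 0)"
      unfolding st .
    have "(\<Sum>u\<in>par x. Q \<zeta> x u * N u i)
      = (\<Sum>k<l. \<eta> (2 * s + p) * \<eta> (2 * t + p) * (?f p s k * G p k t))"
      unfolding sum_par[OF p] unfolding s(2) t(2) N[OF p(1)]
      using \<eta>'[OF s(1)] by (intro sum.cong refl) (simp add: algebra_simps)
    also have "\<dots> = \<eta> (2 * s + p) * \<eta> (2 * t + p) * (if s = t then 1 else 0)"
      unfolding sum_distrib_left[symmetric] G(1)[OF p(1) s(1) t(1)] ..
    finally have 2: "(\<Sum>u\<in>par x. Q \<zeta> x u * N u i) = (if x = i then 1 else 0)"
      unfolding st .
    show "(\<Sum>u\<in>par x. N x u * Q \<zeta> u i) = (if x = i then 1 else 0) \<and>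
      (\<Sum>u\<in>par x. Q \<zeta> x u * N u i) = (if x = i then 1 else 0)"
      using 1 2 ..
  qed
qed

lemma beta_eq:
  assumes "even (i + j)"
  shows "beta l \<mu>0 \<mu>1 \<tau>0 \<tau>1 i j = Q 1 (int i) (int j)"
  unfolding beta_def Q_def by_parity_int mid_int[OF assms] mid'_int[OF assms] mu_mod by simp

section \<open>Signs of the unit normal vectors\<close>

lemma rfl_scaleR: "rfl a (c *\<^sub>R x) = c *\<^sub>R rfl a x"
  by (simp add: rfl_def vector2_eq_iff algebra_simps)

lemma norm_dir: "norm (dir b) = 1"
  by (simp add: norm_eq_1 inner_vec2 dir_def flip: power2_eq_square)

text \<open>\<open>dir (i + l)\<close> is \<open>dir i\<close> turned by a right angle, and the
  plane has only two unit vectors orthogonal to \<open>dir i\<close>.\<close>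

lemma normal_vector_cases:
  assumes "normal_vectors l a" "i < 2 * l"
  shows "a i = dir (int i + int l) \<or> a i = - dir (int i + int l)"
proof -
  have l: "ang (int l) = pi / 2"
    using l_pos by (simp add: ang_def m_def)
  then have d: "dir (int i + int l) = vector [- sin (ang (int i)), cos (ang (int i))]"
    unfolding dir_def ang_add l by (simp add: cos_add sin_add)
  have "dir (int i) \<in> mirror l i"
    by (simp add: mirror_def mirror_dir_eq span_base)
  then have orth: "inner (a i) (dir (int i)) = 0" and unit: "norm (a i) = 1"
    using assms by (auto simp: normal_vectors_def)
  define c s x y where "c = cos (ang (int i))" and "s = sin (ang (int i))"
    and "x = vec_nth (a i) 1" and "y = vec_nth (a i) 2"
  have o: "x * c + y * s = 0"
    using orth by (simp add: inner_vec2 dir_def c_def s_def x_def y_def)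
  have u: "x * x + y * y = 1"
    using unit by (simp add: norm_eq_1 inner_vec2 x_def y_def)
  have cs: "c * c + s * s = 1"
    by (simp add: c_def s_def flip: power2_eq_square)
  \<comment> \<open>\<open>t\<close> is the coordinate of the normal vector along
    \<open>dir (i + l)\<close>; unit length forces it to be 1 or -1.\<close>
  define t where "t = y * c - x * s"
  have o': "x * c = - (y * s)" "y * s = - (x * c)"
    using o by simp_all
  have "x = x * (c * c + s * s)"
    using cs by simp
  also have "\<dots> = (x * c) * c + x * s * s"
    by (simp add: algebra_simps)
  also have "\<dots> = - (t * s)"
    unfolding o'(1) t_def by (simp add: algebra_simps)
  finally have x: "x = - (t * s)" .
  have "y = y * (c * c + s * s)"
    using cs by simp
  also have "\<dots> = y * c * c + (y * s) * s"
    by (simp add: algebra_simps)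
  also have "\<dots> = t * c"
    unfolding o'(2) t_def by (simp add: algebra_simps)
  finally have y: "y = t * c" .
  note xy = x y
  have "t * t * (c * c + s * s) = x * x + y * y"
    unfolding xy by (simp add: algebra_simps)
  then have "t * t * (c * c + s * s) = 1"
    using u by simp
  then have "t = 1 \<or> t = -1"
    using cs by (simp add: square_eq_1_iff)
  then show ?thesis
    unfolding d vector2_eq_iff using xy by (auto simp: x_def y_def c_def s_def)
qed

lemma rfl_cong: "a mod m = b mod m \<Longrightarrow> rfl a = rfl b"
  by (simp add: rfl_eq_iff)

text \<open>The mirror with index \<open>[i + l]\<close> is orthogonal to the one with index
  \<open>i\<close>, so its normal is \<open>\<eta> i\<close> times \<open>dir i\<close>. The
  reflection \<open>s_k\<close> sends \<open>dir j\<close> to \<open>dir (2k - j)\<close>, which is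
  \<open>dir i\<close> for the midpoint \<open>k\<close> and \<open>dir (i + m) = - dir i\<close>
  for \<open>k + l\<close>. Both values of \<open>eps\<close> thus carry the factor
  \<open>\<eta> i * \<eta> j\<close> and differ in sign, which is the case \<zeta> = -1 of
  \<open>Q\<close>.\<close>

lemma gamma_eq:
  assumes a: "normal_vectors l a"
  obtains \<eta> :: "nat \<Rightarrow> complex" where "\<And>i. i < 2 * l \<Longrightarrow> \<eta> i * \<eta> i = 1"
    "\<And>i j. i < 2 * l \<Longrightarrow> j < 2 * l \<Longrightarrow> even (i + j) \<Longrightarrow>
      gamma l \<mu>0 \<mu>1 \<tau>0 \<tau>1 a i j = \<eta> i * \<eta> j * Q (-1) (int i) (int j)"
proof -
  let ?b = "\<lambda>i. a ((i + l) mod (2 * l))"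
  have "\<exists>e::real. e \<in> {1, -1} \<and> ?b i = e *\<^sub>R dir (int i)" if i: "i < 2 * l" for i
  proof -
    let ?k = "(i + l) mod (2 * l)"
    have k: "?k < 2 * l" using l_pos by simp
    \<comment> \<open>Adding \<open>l\<close> twice either wraps back to \<open>i\<close> or ends at
      \<open>i + m\<close>, and the latter costs a sign.\<close>
    have "int ?k + int l = int i \<or> int ?k + int l = int i + m"
    proof (cases "i < l")
      case True
      then show ?thesis by (simp add: m_def)
    next
      case False
      then have "?k = i - l"
        using i by (simp add: le_mod_geq)
      then show ?thesis using False by simp
    qed
    then have "dir (int ?k + int l) = dir (int i) \<or> dir (int ?k + int l) = - dir (int i)"
      using dir_m by metis
    then have "?b i = 1 *\<^sub>R dir (int i) \<or> ?b i = (-1) *\<^sub>R dir (int i)"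
      using normal_vector_cases[OF a k] by auto
    then show ?thesis by blast
  qed
  then obtain e :: "nat \<Rightarrow> real" where e: "\<And>i. i < 2 * l \<Longrightarrow> e i \<in> {1, -1}"
    "\<And>i. i < 2 * l \<Longrightarrow> ?b i = e i *\<^sub>R dir (int i)"
    by metis
  have ee: "e i * e i = 1" if "i < 2 * l" for i
    using e(1)[OF that] by auto
  have b0: "?b i \<noteq> 0" if "i < 2 * l" for i
  proof -
    have "norm (?b i) = 1"
      using e[OF that] norm_dir[of "int i"] by auto
    then show ?thesis by auto
  qed
  \<comment> \<open>\<open>d\<close> is the sign contributed by the reflection: 1 for
    \<open>mid\<close>, -1 for \<open>mid'\<close>.\<close>
  have eps: "eps l a k j i = d * (e i * e j)"
    if ij: "i < 2 * l" "j < 2 * l" and k: "dir (2 * int k - int j) = d *\<^sub>R dir (int i)" and d: "d \<in> {1, -1}"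
    for k i j d
  proof -
    have "reflection l k (?b j) = (e j * d) *\<^sub>R dir (int i)"
      by (simp add: e(2)[OF ij(2)] reflection_eq rfl_scaleR rfl_dir k)
    also have "\<dots> = (e j * d * (e i * e i)) *\<^sub>R dir (int i)"
      by (simp add: ee[OF ij(1)])
    also have "\<dots> = (d * (e i * e j)) *\<^sub>R ?b i"
      unfolding e(2)[OF ij(1)] scaleR_scaleR by (simp add: mult_ac)
    finally have r: "reflection l k (?b j) = (d * (e i * e j)) *\<^sub>R ?b i" .
    have mem: "d * (e i * e j) \<in> {1, -1}"
      using e(1)[OF ij(1)] e(1)[OF ij(2)] d by auto
    show ?thesis
      unfolding eps_def
    proof (rule the_equality)
      show "d * (e i * e j) \<in> {1, -1} \<and> reflection l k (?b j) = (d * (e i * e j)) *\<^sub>R ?b i"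
        using r mem by blast
      fix x assume "x \<in> {1, -1} \<and> reflection l k (?b j) = x *\<^sub>R ?b i"
      then have "x *\<^sub>R ?b i = (d * (e i * e j)) *\<^sub>R ?b i"
        using r by metis
      then show "x = d * (e i * e j)"
        using b0[OF ij(1)] by simp
    qed
  qed
  show thesis
  proof (rule that[of "\<lambda>i. complex_of_real (e i)"])
    show "complex_of_real (e i) * complex_of_real (e i) = 1" if "i < 2 * l" for i
      using ee[OF that] by (metis of_real_1 of_real_mult)
    fix i j assume ij: "i < 2 * l" "j < 2 * l" "even (i + j)"
    show "gamma l \<mu>0 \<mu>1 \<tau>0 \<tau>1 a i j = complex_of_real (e i) * complex_of_real (e j) * Q (-1) (int i) (int j)"
    proof (cases "i = j")
      case True
      then show ?thesis
        using ee[OF ij(1)] by (simp add: gamma_def Q_def by_parity_int flip: of_real_mult)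
    next
      case False
      let ?h = "(int i + int j) div 2"
      have h: "2 * ?h - int j = int i"
        using ij(3) by (metis add_diff_cancel_right' dvd_mult_div_cancel even_of_nat of_nat_add)
      have 1: "eps l a (mid i j) j i = 1 * (e i * e j)"
        using h by (intro eps ij) (simp_all add: mid_int[OF ij(3)])
      have "dir (2 * int (mid' l i j) - int j) = - dir (int i)"
      proof -
        \<comment> \<open>The reduction in \<open>mid'\<close> is undone on \<open>rfl\<close>,
          which has period \<open>m\<close>, whereas \<open>dir\<close> changes sign over
          \<open>m\<close>.\<close>
        have "rfl (int (mid' l i j)) = rfl (?h + int l)"
          by (intro rfl_cong) (simp add: mid'_int[OF ij(3)])
        then have "dir (2 * int (mid' l i j) - int j) = dir (2 * (?h + int l) - int j)"
          using rfl_dir by metis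
        also have "2 * (?h + int l) - int j = int i + m"
          using h by (simp add: m_def)
        finally show ?thesis
          by (simp add: dir_m)
      qed
      then have 2: "eps l a (mid' l i j) j i = (-1) * (e i * e j)"
        by (intro eps ij) simp_all
      show ?thesis
        using False unfolding gamma_def Q_def 1 2 by_parity_int mid_int[OF ij(3)] mid'_int[OF ij(3)] mu_mod
        by (simp add: algebra_simps)
    qed
  qed
qed

end

theorem theorem5p5:
  fixes l :: nat and \<mu>0 \<mu>1 \<tau>0 \<tau>1 :: complex and a :: "nat \<Rightarrow> real ^ 2"
  assumes "l \<ge> 1"
    and "normal_vectors l a"
    and "Determinant.det (M_mat l \<mu>0 \<mu>1 \<tau>0 \<tau>1 0) \<noteq> 0"
    and "Determinant.det (M_mat l \<mu>0 \<mu>1 \<tau>0 \<tau>1 1) \<noteq> 0"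
    and "Determinant.det (A_mat l \<mu>0 \<mu>1 \<tau>0 \<tau>1 a 0) \<noteq> 0"
    and "Determinant.det (A_mat l \<mu>0 \<mu>1 \<tau>0 \<tau>1 a 1) \<noteq> 0"
  shows "semisimple_ring (brauer_algebra l \<mu>0 \<mu>1 \<tau>0 \<tau>1)
    \<and> ring.dimension (brauer_algebra l \<mu>0 \<mu>1 \<tau>0 \<tau>1) (4 * l + 4 * l ^ 2)
        (scalars l \<mu>0 \<mu>1 \<tau>0 \<tau>1) (carrier (brauer_algebra l \<mu>0 \<mu>1 \<tau>0 \<tau>1))
    \<and> inj_on (group_elem l \<mu>0 \<mu>1 \<tau>0 \<tau>1) (dihedral l)
    \<and> group_elem l \<mu>0 \<mu>1 \<tau>0 \<tau>1 ` dihedral l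
        \<inter> {group_elem l \<mu>0 \<mu>1 \<tau>0 \<tau>1 w \<otimes>\<^bsub>brauer_algebra l \<mu>0 \<mu>1 \<tau>0 \<tau>1\<^esub> e_elem l \<mu>0 \<mu>1 \<tau>0 \<tau>1 i
            | w i. w \<in> dihedral l \<and> i < 2 * l} = {}
    \<and> basis_over (scalars l \<mu>0 \<mu>1 \<tau>0 \<tau>1) (brauer_algebra l \<mu>0 \<mu>1 \<tau>0 \<tau>1)
        (group_elem l \<mu>0 \<mu>1 \<tau>0 \<tau>1 ` dihedral l
          \<union> {group_elem l \<mu>0 \<mu>1 \<tau>0 \<tau>1 w \<otimes>\<^bsub>brauer_algebra l \<mu>0 \<mu>1 \<tau>0 \<tau>1\<^esub> e_elem l \<mu>0 \<mu>1 \<tau>0 \<tau>1 i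
              | w i. w \<in> dihedral l \<and> i < 2 * l})"
proof -
  interpret brauer_params l \<mu>0 \<mu>1 \<tau>0 \<tau>1
    by unfold_locales (rule assms(1))
  obtain \<eta> :: "nat \<Rightarrow> complex" where \<eta>: "\<And>i. i < 2 * l \<Longrightarrow> \<eta> i * \<eta> i = 1"
    "\<And>i j. i < 2 * l \<Longrightarrow> j < 2 * l \<Longrightarrow> even (i + j) \<Longrightarrow>
      gamma l \<mu>0 \<mu>1 \<tau>0 \<tau>1 a i j = \<eta> i * \<eta> j * Q (-1) (int i) (int j)"
    using gamma_eq[OF assms(2)] by blast
  \<comment> \<open>The factors 1 fit the shape of \<open>Q_inverse\<close> with all signs equal to
    1.\<close>
  have M: "M_mat l \<mu>0 \<mu>1 \<tau>0 \<tau>1 p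
    = Matrix.mat l l (\<lambda>(s, t). 1 * 1 * Q 1 (int (2 * s + p)) (int (2 * t + p)))" for p
    unfolding M_mat_def by (intro cong_mat) (auto simp: beta_eq)
  have A: "A_mat l \<mu>0 \<mu>1 \<tau>0 \<tau>1 a p = Matrix.mat l l (\<lambda>(s, t).
       \<eta> (2 * s + p) * \<eta> (2 * t + p) * Q (-1) (int (2 * s + p)) (int (2 * t + p)))" if "p < 2" for p
    unfolding A_mat_def using that by (intro cong_mat) (auto simp: \<eta>(2))
  have p_cases: "p = 0 \<or> p = 1" if "p < 2" for p :: nat
    using that by auto
  have "\<exists>N. \<forall>x\<in>{0..<m}. \<forall>i\<in>par x.
      (\<Sum>u\<in>par x. N x u * Q 1 u i) = (if x = i then 1 else 0) \<and>
      (\<Sum>u\<in>par x. Q 1 x u * N u i) = (if x = i then 1 else 0)"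
  proof (rule Q_inverse[of "\<lambda>_. 1"])
    fix p :: nat assume p: "p < 2"
    show "Determinant.det (Matrix.mat l l (\<lambda>(s, t).
       1 * 1 * Q 1 (int (2 * s + p)) (int (2 * t + p)))) \<noteq> 0"
      unfolding M[symmetric] using p_cases[OF p] assms(3,4) by auto
  qed simp
  then obtain N1 where N1: "\<forall>x\<in>{0..<m}. \<forall>i\<in>par x.
      (\<Sum>u\<in>par x. N1 x u * Q 1 u i) = (if x = i then 1 else 0) \<and>
      (\<Sum>u\<in>par x. Q 1 x u * N1 u i) = (if x = i then 1 else 0)" ..
  have "\<exists>N. \<forall>x\<in>{0..<m}. \<forall>i\<in>par x.
      (\<Sum>u\<in>par x. N x u * Q (-1) u i) = (if x = i then 1 else 0) \<and>
      (\<Sum>u\<in>par x. Q (-1) x u * N u i) = (if x = i then 1 else 0)"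
  proof (rule Q_inverse[OF \<eta>(1)])
    fix p :: nat assume p: "p < 2"
    have "Determinant.det (A_mat l \<mu>0 \<mu>1 \<tau>0 \<tau>1 a p) \<noteq> 0"
      using p_cases[OF p] assms(5,6) by auto
    then show "Determinant.det (Matrix.mat l l (\<lambda>(s, t).
       \<eta> (2 * s + p) * \<eta> (2 * t + p) * Q (-1) (int (2 * s + p)) (int (2 * t + p)))) \<noteq> 0"
      unfolding A[OF p] .
  qed
  then obtain N2 where N2: "\<forall>x\<in>{0..<m}. \<forall>i\<in>par x.
      (\<Sum>u\<in>par x. N2 x u * Q (-1) u i) = (if x = i then 1 else 0) \<and>
      (\<Sum>u\<in>par x. Q (-1) x u * N2 u i) = (if x = i then 1 else 0)" ..
  interpret brauer_regular l \<mu>0 \<mu>1 \<tau>0 \<tau>1 "\<lambda>\<zeta>. if \<zeta> = 1 then N1 else N2"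
    by unfold_locales (use N1 N2 in auto)
  show ?thesis
    unfolding dihedral_eq by (intro conjI semisimple_B basis_theorem)
qed

end
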